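(* Let $\Psi=(\psi_1,\dots,\psi_d)$ with each $\psi_i:(0,\infty)\to(0,\infty)$ decreasing. Assume each $m_i$ is $\delta_i$-Ahlfors regular, the $\kappa$-scaling property holds for each $\{\mathcal R_{\alpha,i}\}_{\alpha\in J}$, and $(\{\mathcal R_\alpha\},\beta)$ is a uniform local ubiquity system for rectangles w.r.t. $(\rho,\mathbf a)$, $\mathbf a\in(0,\infty)^d$. Assume the accumulation points considered below lie in $[0,\infty)^d$. Then $$\dim_H W(\Psi)\ge\sup\{s(\mathbf t):\mathbf t\in\widehat{\mathcal U}\}.$$ If moreover $\lim_{n\to\infty}\frac{\log\rho(u_{n+1})}{\log\rho(u_n)}=1$, then $$\dim_H W(\Psi)\ge\sup\{s(\mathbf t):\mathbf t\in\mathcal U\}.$$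
   Context: Fix an integer $d\ge1$. For each $1\le i\le d$, $(X_i,|\cdot|_i)$ is a bounded locally compact metric space carrying a Borel probability measure $m_i$. The measure $m_i$ is $\delta_i$-Ahlfors regular ($\delta_i>0$) if there are constants $c,C,r_0>0$ with $c\,r^{\delta_i}\le m_i(B(x,r))\le C\,r^{\delta_i}$ for all $x\in X_i$ and $0<r\le r_0$. Put $X=\prod_{i=1}^dX_i$ with metric $|x-y|=\max_i|x_i-y_i|_i$ and measure $m=\prod_i m_i$; thus a ball in $X$ is $B(x,r)=\prod_iB(x_i,r)$. For $E\subset X_i$ and $\epsilon>0$, $\Delta(E,\epsilon)=\{y\in X_i:\operatorname{dist}(y,E)<\epsilon\}$. $J$ is an infinite countable index set and $\beta:J\to(0,\infty)$, $\alpha\mapsto\beta_\alpha$, satisfies: $\{\alpha:\beta_\alpha<M\}$ is finite for every $M>1$. $\{\ell_n\},\{u_n\}$ are increasing sequences with $\ell_n\le u_n$, $\ell_n\to\infty$, and $J_n=\{\alpha\in J:\ell_n\le\beta_\alpha\le u_n\}$. $\rho:(0,\infty)\to(0,\infty)$ is non-increasing with $\rho(u)\to0$ as $u\to\infty$. For each $i$, $\{\mathcal R_{\alpha,i}:\alpha\in J\}$ are subsets of $X_i$ and $\mathcal R_\alpha=\prod_i\mathcal R_{\alpha,i}$. For $\mathbf b=(b_1,\dots,b_d)\in(0,\infty)^d$ and $r>0$, $\Delta(\mathcal R_\alpha,r^{\mathbf b})=\prod_{i=1}^d\Delta(\mathcal R_{\alpha,i},r^{b_i})$. $\kappa$-scaling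 property ($0\le\kappa<1$): there are constants $c_2,c_3>0$ such that for every $\alpha\in J$, every $x_i\in\mathcal R_{\alpha,i}$ and every $0<\epsilon<r$ (with $r$ sufficiently small), $c_2r^{\delta_i\kappa}\epsilon^{\delta_i(1-\kappa)}\le m_i(B(x_i,r)\cap\Delta(\mathcal R_{\alpha,i},\epsilon))\le c_3r^{\delta_i\kappa}\epsilon^{\delta_i(1-\kappa)}$. Uniform local ubiquity system for rectangles w.r.t. $(\rho,\mathbf a)$: there is $c>0$ such that for every ball $B\subset X$ there is $n_0(B)$ with $m\big(B\cap\bigcup_{\alpha\in J_n}\Delta(\mathcal R_\alpha,\rho(u_n)^{\mathbf a})\big)\ge c\,m(B)$ for all $n\ge n_0(B)$. $W(\Psi)=\{x\in X: x\in\prod_{i=1}^d\Delta(\mathcal R_{\alpha,i},\rho(\beta_\alpha)^{a_i}\psi_i(\beta_\alpha))\text{ for infinitely many }\alpha\in J\}$. $\widehat{\mathcal U}$ is the set of accumulation points of $\big(\frac{\log\psi_1(u_n)}{\log\rho(u_n)},\dots,\frac{\log\psi_d(u_n)}{\log\rho(u_n)}\big)_{n\in\mathbb N}$, and $\mathcal U$ the set of accumulation points of $\big(\frac{\log\psi_1(n)}{\log\rho(n)},\dots,\frac{\log\psi_d(n)}{\log\rho(n)}\big)_{n\in\mathbb N}$. Dimensional number for $\mathbf t\in[0,\infty)^d$: let $\mathcal A=\{a_i,\ a_i+t_i:1\le i\le d\}$. For $A\in\mathcal A$ let $\mathcal K_1=\{k:a_k\ge A\}$, $\mathcal K_2=\{k:a_k+t_k\le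 A\}\setminus\mathcal K_1$, $\mathcal K_3=\{1,\dots,d\}\setminus(\mathcal K_1\cup\mathcal K_2)$, and $$s(\mathbf t)=\min_{A\in\mathcal A}\Big\{\sum_{k\in\mathcal K_1}\delta_k+\sum_{k\in\mathcal K_2}\delta_k+\kappa\sum_{k\in\mathcal K_3}\delta_k+(1-\kappa)\frac{\sum_{k\in\mathcal K_3}a_k\delta_k-\sum_{k\in\mathcal K_2}t_k\delta_k}{A}\Big\}.$$ *)

theory Defs
  imports "HOL-Analysis.Analysis" "HOL-Probability.Probability"
begin

text \<open>Diameter of a subset of a metric space given by carrier M and distance d
  (meaningful for bounded sets; the empty set has diameter 0).\<close>
definition mdiam :: "'a set \<Rightarrow> ('a \<Rightarrow> 'a \<Rightarrow> real) \<Rightarrow> 'a set \<Rightarrow> real" where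
  "mdiam M d S = (if S = {} then 0 else (SUP p\<in>S \<times> S. d (fst p) (snd p)))"

definition hausdorff_content ::
  "'a set \<Rightarrow> ('a \<Rightarrow> 'a \<Rightarrow> real) \<Rightarrow> real \<Rightarrow> real \<Rightarrow> 'a set \<Rightarrow> ennreal" where
  "hausdorff_content M d s \<delta> E =
     (INF U\<in>{U :: nat \<Rightarrow> 'a set. (\<forall>j. U j \<subseteq> M \<and> Metric_space.mbounded M d (U j)
                                     \<and> mdiam M d (U j) \<le> \<delta>) \<and> E \<subseteq> (\<Union>j. U j)}.
        (\<Sum>j. ennreal (mdiam M d (U j) powr s)))"

definition hausdorff_measure ::
  "'a set \<Rightarrow> ('a \<Rightarrow> 'a \<Rightarrow> real) \<Rightarrow> real \<Rightarrow> 'a set \<Rightarrow> ennreal" where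
  "hausdorff_measure M d s E = (SUP \<delta>\<in>{0<..}. hausdorff_content M d s \<delta> E)"

definition hausdorff_dim :: "'a set \<Rightarrow> ('a \<Rightarrow> 'a \<Rightarrow> real) \<Rightarrow> 'a set \<Rightarrow> ereal" where
  "hausdorff_dim M d E = Inf {ereal s | s. 0 < s \<and> hausdorff_measure M d s E = 0}"

definition nbhd :: "'a set \<Rightarrow> ('a \<Rightarrow> 'a \<Rightarrow> real) \<Rightarrow> 'a set \<Rightarrow> real \<Rightarrow> 'a set" where
  "nbhd M d E \<epsilon> = {y \<in> M. \<exists>x\<in>E. d y x < \<epsilon>}"

definition prod_dist :: "nat \<Rightarrow> (nat \<Rightarrow> 'a \<Rightarrow> 'a \<Rightarrow> real) \<Rightarrow> (nat \<Rightarrow> 'a) \<Rightarrow> (nat \<Rightarrow> 'a) \<Rightarrow> real" where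
  "prod_dist n ds x y = Max ((\<lambda>i. ds i (x i) (y i)) ` {..<n})"

definition metric_borel :: "'a set \<Rightarrow> ('a \<Rightarrow> 'a \<Rightarrow> real) \<Rightarrow> 'a set set" where
  "metric_borel M d = sigma_sets M {U. openin (Metric_space.mtopology M d) U}"

definition acc_points :: "nat \<Rightarrow> (nat \<Rightarrow> nat \<Rightarrow> real) \<Rightarrow> (nat \<Rightarrow> real) set" where
  "acc_points n v = {t. (\<forall>i\<ge>n. t i = 0) \<and>
     (\<forall>\<epsilon>>0. \<forall>N. \<exists>k\<ge>N. \<forall>i<n. \<bar>v k i - t i\<bar> < \<epsilon>)}"

definition dim_number ::
  "nat \<Rightarrow> (nat \<Rightarrow> real) \<Rightarrow> real \<Rightarrow> (nat \<Rightarrow> real) \<Rightarrow> (nat \<Rightarrow> real) \<Rightarrow> real" where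
  "dim_number n \<delta> \<kappa> a t =
     Min ((\<lambda>A. let K1 = {k\<in>{..<n}. a k \<ge> A};
                   K2 = {k\<in>{..<n}. a k + t k \<le> A} - K1;
                   K3 = {..<n} - (K1 \<union> K2)
               in (\<Sum>k\<in>K1. \<delta> k) + (\<Sum>k\<in>K2. \<delta> k) + \<kappa> * (\<Sum>k\<in>K3. \<delta> k)
                  + (1 - \<kappa>) * ((\<Sum>k\<in>K3. a k * \<delta> k) - (\<Sum>k\<in>K2. t k * \<delta> k)) / A)
          ` ((\<lambda>i. a i) ` {..<n} \<union> (\<lambda>i. a i + t i) ` {..<n}))"

end

theory Submission
  imports Defs
begin

text \<open>
  At the scale \<open>\<rho> = \<rho>(u n)\<close> choose a maximal family of disjoint boxes with sides \<open>\<rho> powr a i\<close> centred on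
  the sets \<open>R \<alpha>\<close> with \<open>\<alpha>\<close> in the \<open>n\<close>-th window; by ubiquity their dilates fill a fixed proportion of
  every ball. Restrict the product measure to the parts of these boxes that are \<open>\<rho> powr (a i + t i)\<close>-close
  to \<open>R \<alpha>\<close>, and renormalise. The scaling property makes a ball of radius \<open>\<rho> powr A\<close> have mass at most a
  constant times \<open>\<rho> powr (\<Sum>i. \<delta> i * (A - (1 - \<kappa>) * min (t i) (max 0 (A - a i))))\<close>, and the minimum
  over \<open>A > 0\<close> of this exponent divided by \<open>A\<close> is the dimensional number. So these measures are
  Frostman with exponent \<open>s(t)\<close> uniformly in \<open>n\<close>, while being comparable to the product measure on each
  fixed ball for large \<open>n\<close>.

  Now iterate: given a measure with bounded density on an open set, move its mass from small cells of
  diameter \<open>\<eta>\<close> onto such a level set inside the cells. Balls larger than \<open>\<eta>\<close> hardly notice, and for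
  smaller balls the uniform Frostman bound beats the density bound once \<open>\<eta>\<close> is small, at the cost of an
  arbitrarily small loss in the exponent. The nested compact supports shrink to a subset of the limsup
  set, whose covers are controlled by the measures of the finite stages. Finally \<open>t\<close> is perturbed to
  \<open>t + \<epsilon>\<close>, which absorbs all constants.
\<close>

section \<open>Finite measures\<close>

text \<open>The shape of the exponent: in coordinate \<open>i\<close>, thinning a box of side
  \<open>\<rho> powr a i\<close> to width \<open>\<rho> powr (a i + t i)\<close> around
  \<open>R \<alpha> i\<close> concentrates mass by
  \<open>\<rho> powr (- t i * \<delta> i * (1 - \<kappa>))\<close>. A ball of radius
  \<open>\<rho> powr A\<close> sees none of this gain while \<open>A \<le> a i\<close>, the share of
  \<open>A - a i\<close> in between, and all of it once \<open>A \<ge> a i + t i\<close>. These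
  regimes are K1, K3 and K2 of the dimensional number.

  The perturbation of \<open>t\<close> has a second purpose: the scaling property compares radii
  \<open>\<epsilon> < r\<close> and so asks for \<open>t i > 0\<close>, whereas accumulation points
  may have zero coordinates.

  Both assertions come from one statement with a free sequence \<open>y k \<ge> u (n k)\<close> of
  arguments of \<open>\<Psi>\<close>. The first takes \<open>y k = u (n k)\<close>. In the second
  \<open>y k\<close> is an integer bracketed by \<open>u (n k)\<close> and
  \<open>u (Suc (n k))\<close>, and the hypothesis on consecutive logarithms allows
  \<open>\<rho> (u (n k))\<close> to replace \<open>\<rho> (y k)\<close> in the quotients.\<close>

lemma exists_maximal_pairwise_subset:
  assumes bound: "\<And>Z. finite Z \<Longrightarrow> Z \<subseteq> S \<Longrightarrow> pairwise R Z \<Longrightarrow> card Z \<le> N"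
    and sym: "\<And>x y. R x y \<Longrightarrow> R y x"
  obtains Z where "finite Z" "Z \<subseteq> S" "pairwise R Z" "\<And>x. x \<in> S \<Longrightarrow> x \<notin> Z \<Longrightarrow> \<exists>z\<in>Z. \<not> R x z"
proof -
  define P where "P Z \<longleftrightarrow> finite Z \<and> Z \<subseteq> S \<and> pairwise R Z" for Z
  have "P {}" by (simp add: P_def)
  moreover have "\<forall>Z. P Z \<longrightarrow> card Z < Suc N"
    using bound by (simp add: P_def less_Suc_eq_le)
  \<comment> \<open>The bound on cardinalities makes a largest family exist; a point that could
    still be added would produce a larger one.\<close>
  ultimately have "\<exists>Z. P Z \<and> (\<forall>Y. P Y \<longrightarrow> card Y \<le> card Z)"
    by (rule ex_has_greatest_nat)
  then obtain Z where Z: "P Z" "\<And>Y. P Y \<Longrightarrow> card Y \<le> card Z" by blast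
  have far: "\<exists>z\<in>Z. \<not> R x z" if x: "x \<in> S" "x \<notin> Z" for x
  proof (rule ccontr)
    assume "\<not> ?thesis"
    hence "P (insert x Z)"
      using Z(1) x(1) sym unfolding P_def pairwise_def by auto
    from Z(2)[OF this] x(2) Z(1) show False by (simp add: P_def)
  qed
  show ?thesis
    by (rule that[of Z]) (use Z(1) far in \<open>simp_all add: P_def\<close>)
qed

text \<open>Volume packing. It bounds the number of net points and of boxes from above, and in
  \<open>level_set\<close> also the mass of \<open>F\<close> from below.\<close>

lemma card_times_le_measure:
  assumes "finite_measure \<mu>" "finite Z" "disjoint_family_on P Z"
    and "\<And>z. z \<in> Z \<Longrightarrow> P z \<in> sets \<mu> \<and> P z \<subseteq> B \<and> v \<le> measure \<mu> (P z)" and "B \<in> sets \<mu>"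
  shows "real (card Z) * v \<le> measure \<mu> B"
proof -
  interpret finite_measure \<mu> by fact
  have "real (card Z) * v = (\<Sum>z\<in>Z. v)" by simp
  also have "\<dots> \<le> (\<Sum>z\<in>Z. measure \<mu> (P z))" by (intro sum_mono) (use assms in auto)
  also have "\<dots> = measure \<mu> (\<Union>z\<in>Z. P z)"
    using assms by (intro finite_measure_finite_Union[symmetric]) auto
  also have "\<dots> \<le> measure \<mu> B" using assms by (intro finite_measure_mono) auto
  finally show ?thesis .
qed

lemma finite_cover_disjoint_refinement:
  assumes "finite Z" "\<And>z. z \<in> Z \<Longrightarrow> A z \<in> sets \<mu>"
  obtains V where "\<And>z. z \<in> Z \<Longrightarrow> V z \<in> sets \<mu>" "\<And>z. z \<in> Z \<Longrightarrow> V z \<subseteq> A z"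
    "disjoint_family_on V Z" "(\<Union>z\<in>Z. V z) = (\<Union>z\<in>Z. A z)"
proof -
  obtain f :: "'a \<Rightarrow> nat" where f: "inj_on f Z"
    using finite_imp_inj_to_nat_seg[OF assms(1)] by blast
  \<comment> \<open>Every point goes to the first set that contains it; \<open>f\<close> merely
    supplies an order on \<open>Z\<close>.\<close>
  define V where "V z = A z - (\<Union>y\<in>{y\<in>Z. f y < f z}. A y)" for z
  have 1: "V z \<in> sets \<mu>" if "z \<in> Z" for z
    unfolding V_def using assms that by (intro sets.Diff sets.finite_UN) auto
  have 2: "V z \<subseteq> A z" for z by (auto simp: V_def)
  have "V y \<inter> V z = {}" if "y \<in> Z" "z \<in> Z" "y \<noteq> z" for y z
  proof -
    have "f y \<noteq> f z" using f that by (auto dest: inj_onD)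
    hence "f y < f z \<or> f z < f y" by linarith
    thus ?thesis using that by (auto simp: V_def)
  qed
  hence 3: "disjoint_family_on V Z" by (auto simp: disjoint_family_on_def)
  have "x \<in> (\<Union>z\<in>Z. V z)" if x: "y \<in> Z" "x \<in> A y" for x y
  proof -
    obtain z where z: "z \<in> Z" "x \<in> A z" "\<And>y. y \<in> Z \<and> x \<in> A y \<Longrightarrow> f z \<le> f y"
      using ex_has_least_nat[of "\<lambda>y. y \<in> Z \<and> x \<in> A y" y f] x by blast
    hence "x \<in> V z" by (force simp: V_def)
    thus ?thesis using z by blast
  qed
  hence 4: "(\<Union>z\<in>Z. V z) = (\<Union>z\<in>Z. A z)" using 2 by blast
  show ?thesis using that[OF 1 2 3 4] .
qed

text \<open>All transported measures have this form. Using a simple function as density gives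
  countable additivity at once and lets the sets \<open>A z\<close> overlap.\<close>

lemma weighted_restrictions_measure:
  fixes w :: "'b \<Rightarrow> real"
  assumes "finite_measure \<mu>" "finite Z"
    and A: "\<And>z. z \<in> Z \<Longrightarrow> A z \<in> sets \<mu>" and w: "\<And>z. z \<in> Z \<Longrightarrow> 0 \<le> w z"
  obtains \<nu> where "finite_measure \<nu>" "sets \<nu> = sets \<mu>"
    "\<And>B. B \<in> sets \<mu> \<Longrightarrow> measure \<nu> B = (\<Sum>z\<in>Z. w z * measure \<mu> (A z \<inter> B))"
proof -
  interpret finite_measure \<mu> by fact
  define f where "f x = (\<Sum>z\<in>Z. ennreal (w z) * indicator (A z) x)" for x
  have f: "f \<in> borel_measurable \<mu>" unfolding f_def
    by (intro borel_measurable_sum borel_measurable_times_ennreal borel_measurable_indicator A) auto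
  have e: "emeasure (density \<mu> f) B = ennreal (\<Sum>z\<in>Z. w z * measure \<mu> (A z \<inter> B))" if "B \<in> sets \<mu>" for B
  proof -
    have "emeasure (density \<mu> f) B = (\<integral>\<^sup>+x. (\<Sum>z\<in>Z. ennreal (w z) * indicator (A z \<inter> B) x) \<partial>\<mu>)"
      unfolding emeasure_density[OF f that] f_def
      by (intro nn_integral_cong) (simp add: sum_distrib_right indicator_inter_arith mult.assoc)
    also have "\<dots> = (\<Sum>z\<in>Z. ennreal (w z) * emeasure \<mu> (A z \<inter> B))"
      using A that by (subst nn_integral_sum) (auto simp: nn_integral_cmult_indicator)
    also have "\<dots> = (\<Sum>z\<in>Z. ennreal (w z * measure \<mu> (A z \<inter> B)))"
      using w by (intro sum.cong) (auto simp: emeasure_eq_measure ennreal_mult)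
    also have "\<dots> = ennreal (\<Sum>z\<in>Z. w z * measure \<mu> (A z \<inter> B))"
      using w by (intro sum_ennreal) auto
    finally show ?thesis .
  qed
  show ?thesis
  proof (rule that[of "density \<mu> f"])
    show "finite_measure (density \<mu> f)"
      using e[of "space \<mu>"] by (intro finite_measureI) auto
    show "measure (density \<mu> f) B = (\<Sum>z\<in>Z. w z * measure \<mu> (A z \<inter> B))" if "B \<in> sets \<mu>" for B
      unfolding measure_def e[OF that] using w by (intro enn2real_ennreal sum_nonneg) auto
  qed simp
qed

lemma measure_eventually_vanishing_tendsto_0:
  assumes "finite_measure \<mu>" "\<And>n::nat. S n \<in> sets \<mu>"
    and ev: "\<And>x. x \<in> space \<mu> \<Longrightarrow> eventually (\<lambda>n. x \<notin> S n) sequentially"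
  shows "(\<lambda>n. measure \<mu> (S n)) \<longlonglongrightarrow> 0"
proof -
  interpret finite_measure \<mu> by fact
  \<comment> \<open>\<open>S\<close> need not be monotone. Its tails decrease, and their
    intersection is empty because every point leaves \<open>S\<close> for good.\<close>
  define T where "T n = (\<Union>k\<in>{n..}. S k)" for n
  have T: "T n \<in> sets \<mu>" for n unfolding T_def by (intro sets.countable_UN') (auto simp: assms)
  have "(\<Inter>n. T n) = {}"
  proof (rule ccontr)
    assume "(\<Inter>n. T n) \<noteq> {}"
    then obtain x where x: "\<And>n. x \<in> T n" by blast
    hence "x \<in> space \<mu>" using sets.sets_into_space[OF T[of 0]] by blast
    from ev[OF this] obtain N where "\<And>n. n \<ge> N \<Longrightarrow> x \<notin> S n"
      unfolding eventually_sequentially by blast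
    thus False using x[of N] by (auto simp: T_def)
  qed
  moreover have "decseq T" unfolding decseq_def T_def by (intro allI impI UN_mono) auto
  moreover have "range T \<subseteq> sets \<mu>" using T by blast
  ultimately have lim: "(\<lambda>n. measure \<mu> (T n)) \<longlonglongrightarrow> 0"
    using finite_Lim_measure_decseq[of T] by simp
  have le: "measure \<mu> (S n) \<le> measure \<mu> (T n)" for n
    by (intro finite_measure_mono T) (auto simp: T_def)
  show ?thesis
    by (rule tendsto_sandwich[OF _ _ tendsto_const lim]) (simp_all add: le)
qed

section \<open>Mass transport onto Frostman level sets\<close>

text \<open>Balls rather than all open sets are assumed measurable, since balls of the product are
  boxes of measurable sets. Later open sets therefore carry their measurability explicitly.\<close>

locale ahlfors_metric_space = Metric_space M D for M :: "'a set" and D +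
  fixes \<mu> :: "'a measure" and Q cl cu r0 :: real
  assumes finite_mu: "finite_measure \<mu>" and space_mu: "space \<mu> = M"
    and sets_mball: "\<And>x r. x \<in> M \<Longrightarrow> mball x r \<in> sets \<mu>"
    and Q_pos: "0 < Q" and cl_pos: "0 < cl" and cu_pos: "0 < cu" and r0_pos: "0 < r0"
    and lower: "\<And>x r. x \<in> M \<Longrightarrow> 0 < r \<Longrightarrow> r \<le> r0 \<Longrightarrow> cl * r powr Q \<le> measure \<mu> (mball x r)"
    and upper: "\<And>x r. x \<in> M \<Longrightarrow> 0 < r \<Longrightarrow> r \<le> r0 \<Longrightarrow> measure \<mu> (mball x r) \<le> cu * r powr Q"
begin

lemma disjoint_mball:
  assumes "r + r' \<le> D x y"
  shows "mball x r \<inter> mball y r' = {}"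
proof (rule ccontr)
  assume "mball x r \<inter> mball y r' \<noteq> {}"
  then obtain z where z: "x \<in> M" "y \<in> M" "z \<in> M" "D x z < r" "D y z < r'" by auto
  have "D x y \<le> D x z + D z y" using z by (intro triangle)
  thus False using z assms commute[of z y] by linarith
qed

text \<open>Ahlfors regularity and finite total mass force total boundedness: balls around separated
  points are disjoint and have a common lower mass bound. A maximal separated set is then a
  net.\<close>

lemma exists_separated_net:
  assumes "0 < \<eta>"
  obtains Z where "finite Z" "Z \<subseteq> M" "pairwise (\<lambda>x y. \<eta> \<le> D x y) Z" "\<And>x. x \<in> M \<Longrightarrow> \<exists>z\<in>Z. D x z < \<eta>"
proof -
  \<comment> \<open>Half the separation gives disjoint balls; the cap \<open>r0\<close> keeps the
    radius in the range of the Ahlfors bounds.\<close>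
  define t where "t = min (\<eta>/2) r0"
  define v where "v = cl * t powr Q"
  have t: "0 < t" "t \<le> r0" "2 * t \<le> \<eta>" using assms r0_pos by (auto simp: t_def)
  have v: "0 < v" using cl_pos t by (simp add: v_def)
  have M: "M \<in> sets \<mu>" using sets.top[of \<mu>] by (simp add: space_mu)
  have "card Z \<le> nat \<lfloor>measure \<mu> M / v\<rfloor>"
    if Z: "finite Z" "Z \<subseteq> M" "pairwise (\<lambda>x y. \<eta> \<le> D x y) Z" for Z
  proof -
    have "real (card Z) * v \<le> measure \<mu> M"
    proof (rule card_times_le_measure[OF finite_mu Z(1), where P = "\<lambda>z. mball z t"])
      show "disjoint_family_on (\<lambda>z. mball z t) Z"
        unfolding disjoint_family_on_def
      proof (intro ballI impI)
        fix y z assume "y \<in> Z" "z \<in> Z" "y \<noteq> z"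
        hence "\<eta> \<le> D y z" using Z(3) by (auto simp: pairwise_def)
        thus "mball y t \<inter> mball z t = {}" using t by (intro disjoint_mball) auto
      qed
      show "mball z t \<in> sets \<mu> \<and> mball z t \<subseteq> M \<and> v \<le> measure \<mu> (mball z t)" if "z \<in> Z" for z
        using that Z(2) t lower[of z t] sets_mball[of z t] by (auto simp: v_def)
    qed (rule M)
    hence "real (card Z) \<le> measure \<mu> M / v" using v by (simp add: field_simps)
    thus ?thesis by (rule le_nat_floor)
  qed
  note bound = this
  obtain Z where Z: "finite Z" "Z \<subseteq> M" "pairwise (\<lambda>x y. \<eta> \<le> D x y) Z"
     "\<And>x. x \<in> M \<Longrightarrow> x \<notin> Z \<Longrightarrow> \<exists>z\<in>Z. \<not> \<eta> \<le> D x z"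
  proof (rule exists_maximal_pairwise_subset[of M "\<lambda>x y. \<eta> \<le> D x y", OF bound])
    show "\<eta> \<le> D y x" if "\<eta> \<le> D x y" for x y using that by (simp add: commute)
  qed (assumption, assumption, assumption, rule that)
  have "\<exists>z\<in>Z. D x z < \<eta>" if x: "x \<in> M" for x
  proof (cases "x \<in> Z")
    case True
    thus ?thesis using x assms by (intro bexI[of _ x]) auto
  next
    case False
    from Z(4)[OF x this] show ?thesis by (auto simp: not_le)
  qed
  with Z(1-3) show ?thesis by (rule that)
qed

text \<open>The two bounds have opposite roles. \<open>b\<close> may grow without control from stage
  to stage and only decides how small the next cells must be, whereas \<open>L\<close> has to stay
  bounded along the whole construction.\<close>

definition spread :: "'a measure \<Rightarrow> 'a set \<Rightarrow> real \<Rightarrow> real \<Rightarrow> real \<Rightarrow> bool" where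
  "spread \<nu> U b L s \<longleftrightarrow> finite_measure \<nu> \<and> sets \<nu> = sets \<mu> \<and> openin mtopology U \<and> U \<in> sets \<mu>
     \<and> measure \<nu> (M - U) = 0 \<and> 0 < b \<and> (\<forall>A\<in>sets \<mu>. measure \<nu> A \<le> b * measure \<mu> A)
     \<and> (\<forall>x\<in>M. \<forall>r>0. measure \<nu> (mball x r) \<le> L * r powr s)"

end

text \<open>\<open>F n\<close> carries the measure \<open>H n * \<mu>\<close>, which is Frostman with exponent \<open>s\<close>
  uniformly in \<open>n\<close>, while giving every fixed ball mass comparable to \<open>\<mu>\<close> for large \<open>n\<close>.\<close>

locale frostman_sequence = ahlfors_metric_space +
  fixes F :: "nat \<Rightarrow> 'a set" and H :: "nat \<Rightarrow> real" and s r1 c C :: real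
  assumes F_open: "\<And>n. openin mtopology (F n)" and F_sets: "\<And>n. F n \<in> sets \<mu>"
    and H_pos: "\<And>n. 0 < H n" and r1_pos: "0 < r1" and c_pos: "0 < c" and C_pos: "0 < C"
    and F_upper: "\<And>n x r. x \<in> M \<Longrightarrow> 0 < r \<Longrightarrow> r \<le> r1 \<Longrightarrow>
       H n * measure \<mu> (F n \<inter> mball x r) \<le> C * r powr s"
    and F_lower: "\<And>x r. x \<in> M \<Longrightarrow> 0 < r \<Longrightarrow> r \<le> r1 \<Longrightarrow>
       eventually (\<lambda>n. c * measure \<mu> (mball x r) \<le> H n * measure \<mu> (F n \<inter> mball x r)) sequentially"
begin

text \<open>Each cell hands its \<open>\<nu>\<close>-mass to the level set inside it, so mass
  travels less than \<open>2 * \<eta>\<close>. For radii at least \<open>2 / \<tau> * \<eta>\<close>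
  this amounts to enlarging a ball by a factor of at most \<open>1 + \<tau>\<close>, and
  \<open>\<tau>\<close> solves \<open>(1 + \<tau>) powr s' = L'/L\<close>. Below that radius the
  Frostman bound of the level set holds with \<open>b\<close> as a factor, and the last condition on
  \<open>\<eta>\<close> makes the surplus \<open>r powr (s - s')\<close> pay for it.\<close>

lemma spread_step_at_scale:
  assumes sp: "spread \<nu> U b L s'"
    and s': "0 < s'" "s' < s" and L: "0 < L" "L < L'"
    and \<tau>: "\<tau> = (L'/L) powr (1/s') - 1"
    and \<eta>: "0 < \<eta>" "\<eta> \<le> r0" "\<eta> \<le> r1" "2 / \<tau> * \<eta> \<le> r1"
      "b * (cu * 2 powr Q / (c * cl)) * C * (2 / \<tau> * \<eta>) powr (s - s') \<le> L'"
    and Z: "finite Z" "Z \<subseteq> M" "pairwise (\<lambda>x y. \<eta> \<le> D x y) Z" "\<And>z. z \<in> Z \<Longrightarrow> mball z \<eta> \<subseteq> U"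
    and big: "\<omega> < measure \<nu> (\<Union>z\<in>Z. mball z \<eta>)"
  shows "\<exists>n\<ge>N. \<exists>\<nu>' U' b'. spread \<nu>' U' b' L' s' \<and> \<omega> < measure \<nu>' U'
            \<and> mtopology closure_of U' \<subseteq> U \<and> U' \<subseteq> F n"
proof -
  interpret mu: finite_measure \<mu> by (rule finite_mu)
  interpret nu: finite_measure \<nu> using sp by (simp add: spread_def)
  have sets_nu: "sets \<nu> = sets \<mu>" and U: "openin mtopology U" "U \<in> sets \<mu>" and b: "0 < b"
    and nu_le: "\<And>A. A \<in> sets \<mu> \<Longrightarrow> measure \<nu> A \<le> b * measure \<mu> A"
    and nu_ball: "\<And>x r. x \<in> M \<Longrightarrow> 0 < r \<Longrightarrow> measure \<nu> (mball x r) \<le> L * r powr s'"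
    using sp by (auto simp: spread_def)
  have "1 < (L'/L) powr (1/s')" using L s' by (simp add: gr_one_powr)
  hence \<tau>_pos: "0 < \<tau>" by (simp add: \<tau>)
  \<comment> \<open>Half the radius makes the receiving balls disjoint, by the separation of
    \<open>Z\<close>, and keeps their closures inside \<open>mball z \<eta>\<close>, hence inside
    \<open>U\<close>.\<close>
  define B where "B z = mball z (\<eta>/2)" for z
  have B_sets: "B z \<in> sets \<mu>" if "z \<in> Z" for z using that Z(2) by (auto simp: B_def sets_mball)
  have B_meas: "cl * (\<eta>/2) powr Q \<le> measure \<mu> (B z)" if "z \<in> Z" for z
    unfolding B_def using that Z(2) \<eta> by (intro lower) auto
  have B_pos: "0 < measure \<mu> (B z)" if "z \<in> Z" for z
    using B_meas[OF that] cl_pos \<eta>(1) by (smt (verit) powr_gt_zero mult_pos_pos half_gt_zero)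
  have B_disj: "B y \<inter> B z = {}" if "y \<in> Z" "z \<in> Z" "y \<noteq> z" for y z
    unfolding B_def using that Z(3) by (intro disjoint_mball) (auto simp: pairwise_def)
  obtain V where V: "\<And>z. z \<in> Z \<Longrightarrow> V z \<in> sets \<mu>" "\<And>z. z \<in> Z \<Longrightarrow> V z \<subseteq> mball z \<eta>"
    "disjoint_family_on V Z" "(\<Union>z\<in>Z. V z) = (\<Union>z\<in>Z. mball z \<eta>)"
    using finite_cover_disjoint_refinement[OF Z(1), of "\<lambda>z. mball z \<eta>" \<mu>] Z(2) sets_mball by blast
  \<comment> \<open>\<open>F_lower\<close> holds from an index on that depends on the ball. The
    cells are finitely many and already fixed, so one late level serves all of them.\<close>
  have "eventually (\<lambda>n. \<forall>z\<in>Z. c * measure \<mu> (B z) \<le> H n * measure \<mu> (F n \<inter> B z)) sequentially"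
    unfolding B_def using Z(1,2) \<eta> by (intro eventually_ball_finite ballI F_lower) auto
  then obtain n where n: "n \<ge> N" "\<And>z. z \<in> Z \<Longrightarrow> c * measure \<mu> (B z) \<le> H n * measure \<mu> (F n \<inter> B z)"
    unfolding eventually_sequentially by (metis nat_le_linear)
  have FB_sets: "F n \<inter> B z \<in> sets \<mu>" if "z \<in> Z" for z using B_sets[OF that] F_sets by auto
  have FB_pos: "0 < measure \<mu> (F n \<inter> B z)" if "z \<in> Z" for z
  proof -
    have "0 < c * measure \<mu> (B z)" using B_pos[OF that] c_pos by simp
    hence "0 < H n * measure \<mu> (F n \<inter> B z)" using n(2)[OF that] by linarith
    thus ?thesis using H_pos[of n] by (simp add: zero_less_mult_iff)
  qed
  \<comment> \<open>With this weight \<open>F n \<inter> B z\<close> receives exactly the mass that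
    \<open>\<nu>\<close> gives to \<open>V z\<close>.\<close>
  define w where "w z = measure \<nu> (V z) / measure \<mu> (F n \<inter> B z)" for z
  have w_nn: "0 \<le> w z" for z by (simp add: w_def)
  \<comment> \<open>By the Ahlfors bounds, \<open>W\<close> compares a ball of radius
    \<open>\<eta>\<close> with \<open>c\<close> times the ball of half that radius.\<close>
  define W where "W = cu * 2 powr Q / (c * cl)"
  have W_pos: "0 < W" using cu_pos c_pos cl_pos by (simp add: W_def)
  have w_le: "w z \<le> H n * b * W" if z: "z \<in> Z" for z
  proof -
    have "measure \<nu> (V z) \<le> b * measure \<mu> (V z)" using V(1)[OF z] by (rule nu_le)
    also have "\<dots> \<le> b * measure \<mu> (mball z \<eta>)"
      using V(1,2)[OF z] b z Z(2) sets_mball by (intro mult_left_mono mu.finite_measure_mono) auto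
    also have "\<dots> \<le> b * (cu * \<eta> powr Q)"
      using b z Z(2) \<eta> by (intro mult_left_mono upper) auto
    also have "\<dots> = b * W * c * (cl * (\<eta>/2) powr Q)"
      using c_pos cl_pos \<eta> by (simp add: W_def powr_divide field_simps)
    also have "\<dots> \<le> b * W * c * measure \<mu> (B z)"
      using b W_pos c_pos B_meas[OF z] by (intro mult_left_mono) auto
    also have "\<dots> = b * W * (c * measure \<mu> (B z))" by simp
    also have "\<dots> \<le> b * W * (H n * measure \<mu> (F n \<inter> B z))"
      using b W_pos n(2)[OF z] by (intro mult_left_mono) auto
    finally show ?thesis using FB_pos[OF z] by (simp add: w_def field_simps)
  qed
  obtain \<nu>' where nu': "finite_measure \<nu>'" "sets \<nu>' = sets \<mu>"
    "\<And>A. A \<in> sets \<mu> \<Longrightarrow> measure \<nu>' A = (\<Sum>z\<in>Z. w z * measure \<mu> (F n \<inter> B z \<inter> A))"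
    by (rule weighted_restrictions_measure[OF finite_mu Z(1), of "\<lambda>z. F n \<inter> B z" w])
      (use FB_sets w_nn in auto)
  define U' where "U' = (\<Union>z\<in>Z. F n \<inter> B z)"
  have U': "openin mtopology U'" "U' \<in> sets \<mu>" "U' \<subseteq> F n"
  proof -
    show "openin mtopology U'" unfolding U'_def B_def by (intro openin_Union) (auto simp: F_open)
    show "U' \<in> sets \<mu>" unfolding U'_def by (intro sets.finite_UN Z(1) FB_sets)
  qed (auto simp: U'_def)
  \<comment> \<open>A cell that meets \<open>A\<close> is charged its full mass. This is crude at
    scales below \<open>\<eta>\<close> but suits large balls, where \<open>far\<close> uses
    it.\<close>
  have nu'_cell: "measure \<nu>' A \<le> (\<Sum>z\<in>{z\<in>Z. A \<inter> B z \<noteq> {}}. measure \<nu> (V z))" if A: "A \<in> sets \<mu>" for A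
  proof -
    have "measure \<nu>' A = (\<Sum>z\<in>{z\<in>Z. A \<inter> B z \<noteq> {}}. w z * measure \<mu> (F n \<inter> B z \<inter> A))"
      unfolding nu'(3)[OF A]
    proof (intro sum.mono_neutral_right Z(1) ballI)
      fix z assume "z \<in> Z - {z\<in>Z. A \<inter> B z \<noteq> {}}"
      hence "F n \<inter> B z \<inter> A = {}" by auto
      thus "w z * measure \<mu> (F n \<inter> B z \<inter> A) = 0" by simp
    qed auto
    also have "\<dots> \<le> (\<Sum>z\<in>{z\<in>Z. A \<inter> B z \<noteq> {}}. w z * measure \<mu> (F n \<inter> B z))"
      using w_nn FB_sets by (intro sum_mono mult_left_mono mu.finite_measure_mono) auto
    also have "\<dots> = (\<Sum>z\<in>{z\<in>Z. A \<inter> B z \<noteq> {}}. measure \<nu> (V z))"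
      using FB_pos by (intro sum.cong) (force simp: w_def)+
    finally show ?thesis .
  qed
  have mass: "measure \<nu>' U' = measure \<nu> (\<Union>z\<in>Z. V z)"
  proof -
    have "measure \<nu>' U' = (\<Sum>z\<in>Z. w z * measure \<mu> (F n \<inter> B z))"
      unfolding nu'(3)[OF U'(2)] by (intro sum.cong arg_cong2[of _ _ _ _ "(*)"] arg_cong[of _ _ "measure \<mu>"]) (auto simp: U'_def)
    also have "\<dots> = (\<Sum>z\<in>Z. measure \<nu> (V z))"
      using FB_pos by (intro sum.cong) (force simp: w_def)+
    also have "\<dots> = measure \<nu> (\<Union>z\<in>Z. V z)"
      using V Z(1) by (intro nu.finite_measure_finite_Union[symmetric]) (auto simp: sets_nu)
    finally show ?thesis .
  qed
  have far: "measure \<nu>' (mball x r) \<le> measure \<nu> (mball x (r + 2 * \<eta>))" if x: "x \<in> M" for x r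
  proof -
    define I where "I = {z\<in>Z. mball x r \<inter> B z \<noteq> {}}"
    have I: "finite I" "I \<subseteq> Z" using Z(1) by (auto simp: I_def)
    have "measure \<nu>' (mball x r) \<le> (\<Sum>z\<in>I. measure \<nu> (V z))"
      unfolding I_def by (rule nu'_cell) (rule sets_mball[OF x])
    also have "\<dots> = measure \<nu> (\<Union>z\<in>I. V z)"
      using V I disjoint_family_on_mono[OF I(2) V(3)]
      by (intro nu.finite_measure_finite_Union[symmetric]) (auto simp: sets_nu)
    also have "\<dots> \<le> measure \<nu> (mball x (r + 2 * \<eta>))"
    proof (intro nu.finite_measure_mono)
      show "(\<Union>z\<in>I. V z) \<subseteq> mball x (r + 2 * \<eta>)"
      proof clarify
        fix y z assume z: "z \<in> I" and y: "y \<in> V z"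
        from z obtain p where p: "p \<in> M" "D x p < r" "D z p < \<eta>/2" "z \<in> M"
          by (auto simp: I_def B_def)
        have "y \<in> mball z \<eta>" using V(2)[of z] z y I by blast
        hence y': "y \<in> M" "D z y < \<eta>" by auto
        have "D x y \<le> D x p + D p y" "D p y \<le> D p z + D z y" using p y' x by (auto intro: triangle)
        hence "D x y < r + 2 * \<eta>" using p y' commute[of p z] \<eta>(1) by linarith
        thus "y \<in> mball x (r + 2 * \<eta>)" using x y' by simp
      qed
    qed (simp add: sets_nu sets_mball x)
    finally show ?thesis .
  qed
  \<comment> \<open>The factor \<open>H n\<close> in \<open>w_le\<close> is the normalisation in
    \<open>F_upper\<close>, and the \<open>B z\<close> are disjoint; so the bound depends neither on
    the level \<open>n\<close> nor on the number of cells.\<close>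
  have near: "measure \<nu>' (mball x r) \<le> b * W * C * r powr s" if x: "x \<in> M" and r: "0 < r" "r \<le> r1" for x r
  proof -
    have "measure \<nu>' (mball x r) \<le> (\<Sum>z\<in>Z. H n * b * W * measure \<mu> (F n \<inter> B z \<inter> mball x r))"
      unfolding nu'(3)[OF sets_mball[OF x]] by (intro sum_mono mult_right_mono w_le) auto
    also have "\<dots> = b * W * (H n * (\<Sum>z\<in>Z. measure \<mu> (F n \<inter> B z \<inter> mball x r)))"
      by (simp add: sum_distrib_left mult_ac)
    also have "(\<Sum>z\<in>Z. measure \<mu> (F n \<inter> B z \<inter> mball x r)) = measure \<mu> (\<Union>z\<in>Z. F n \<inter> B z \<inter> mball x r)"
    proof (intro mu.finite_measure_finite_Union[symmetric])
      show "disjoint_family_on (\<lambda>z. F n \<inter> B z \<inter> mball x r) Z"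
        using B_disj by (fastforce simp: disjoint_family_on_def)
    qed (use Z(1) FB_sets sets_mball[OF x] in auto)
    also have "\<dots> \<le> measure \<mu> (F n \<inter> mball x r)"
      using F_sets sets_mball[OF x] by (intro mu.finite_measure_mono) auto
    finally have "measure \<nu>' (mball x r) \<le> b * W * (H n * measure \<mu> (F n \<inter> mball x r))"
      using b W_pos H_pos[of n] by (simp add: mult_left_mono)
    also have "\<dots> \<le> b * W * (C * r powr s)"
      using b W_pos F_upper[OF x r] by (intro mult_left_mono) auto
    finally show ?thesis by (simp add: mult_ac)
  qed
  have frost: "measure \<nu>' (mball x r) \<le> L' * r powr s'" if x: "x \<in> M" and r: "0 < r" for x r
  proof (cases "2 / \<tau> * \<eta> \<le> r")
    case True
    hence "2 * \<eta> \<le> \<tau> * r" using \<tau>_pos by (simp add: field_simps)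
    have "measure \<nu>' (mball x r) \<le> L * (r + 2 * \<eta>) powr s'"
      using far[OF x, of r] nu_ball[OF x, of "r + 2 * \<eta>"] r \<eta>(1) by linarith
    also have "\<dots> \<le> L * ((L'/L) powr (1/s') * r) powr s'"
      using \<open>2 * \<eta> \<le> \<tau> * r\<close> L r \<eta>(1) s'
      by (intro mult_left_mono powr_mono2) (auto simp: \<tau> algebra_simps)
    also have "\<dots> = L' * r powr s'"
      using L r s' by (simp add: powr_mult powr_powr)
    finally show ?thesis .
  next
    case False
    have "measure \<nu>' (mball x r) \<le> b * W * C * r powr s"
      using False \<eta> by (intro near x r) auto
    also have "\<dots> = b * W * C * r powr (s - s') * r powr s'" by (simp add: powr_add[symmetric])
    also have "\<dots> \<le> b * W * C * (2 / \<tau> * \<eta>) powr (s - s') * r powr s'"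
      using b W_pos C_pos r False s' by (intro mult_right_mono mult_left_mono powr_mono2) auto
    also have "\<dots> \<le> L' * r powr s'" using \<eta>(5) by (intro mult_right_mono) (auto simp: W_def)
    finally show ?thesis .
  qed
  have "mtopology closure_of U' \<subseteq> (\<Union>z\<in>Z. mcball z (\<eta>/2))"
    using Z(1) by (intro closure_of_minimal closedin_Union) (auto simp: U'_def B_def less_imp_le)
  also have "\<dots> \<subseteq> U"
  proof (intro UN_least)
    fix z assume "z \<in> Z"
    have "mcball z (\<eta>/2) \<subseteq> mball z \<eta>" using \<eta>(1) by (intro mcball_subset_mball_concentric) simp
    thus "mcball z (\<eta>/2) \<subseteq> U" using Z(4)[OF \<open>z \<in> Z\<close>] by simp
  qed
  finally have clos: "mtopology closure_of U' \<subseteq> U" .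
  have off: "measure \<nu>' (M - U') = 0"
  proof -
    have "M - U' \<in> sets \<mu>" using U'(2) by (metis sets.compl_sets space_mu)
    moreover have "F n \<inter> B z \<inter> (M - U') = {}" if "z \<in> Z" for z using that by (auto simp: U'_def)
    ultimately show ?thesis by (simp add: nu'(3))
  qed
  \<comment> \<open>The summand 1 keeps the new density bound positive, as \<open>spread\<close>
    demands, whatever the weights are.\<close>
  have dens: "measure \<nu>' A \<le> (1 + (\<Sum>z\<in>Z. w z)) * measure \<mu> A" if A: "A \<in> sets \<mu>" for A
  proof -
    have "measure \<nu>' A \<le> (\<Sum>z\<in>Z. w z * measure \<mu> A)"
      unfolding nu'(3)[OF A] using w_nn A by (intro sum_mono mult_left_mono mu.finite_measure_mono) auto
    thus ?thesis by (simp add: sum_distrib_right[symmetric] distrib_right add_increasing)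
  qed
  have "0 \<le> (\<Sum>z\<in>Z. w z)" by (intro sum_nonneg w_nn)
  hence "spread \<nu>' U' (1 + (\<Sum>z\<in>Z. w z)) L' s'"
    unfolding spread_def using nu'(1,2) U'(1,2) off dens frost by auto
  moreover have "\<omega> < measure \<nu>' U'" using big by (simp add: mass V(4))
  ultimately show ?thesis using n(1) clos U'(3) by blast
qed

text \<open>Net balls contained in the open set \<open>U\<close> exhaust it as their radius shrinks,
  so the mass outside them tends to 0 and the strict bound \<open>\<omega>\<close> survives. Every
  other condition on the scale also holds for all small radii.\<close>

lemma spread_step:
  assumes sp: "spread \<nu> U b L s'"
    and s': "0 < s'" "s' < s" and L: "0 < L" "L < L'" and mass: "\<omega> < measure \<nu> U"
  shows "\<exists>n\<ge>N. \<exists>\<nu>' U' b'. spread \<nu>' U' b' L' s' \<and> \<omega> < measure \<nu>' U'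
            \<and> mtopology closure_of U' \<subseteq> U \<and> U' \<subseteq> F n"
proof -
  interpret nu: finite_measure \<nu> using sp by (simp add: spread_def)
  have sets_nu: "sets \<nu> = sets \<mu>" and U: "openin mtopology U" "U \<in> sets \<mu>" and b: "0 < b"
    using sp by (auto simp: spread_def)
  have space_nu: "space \<nu> = M" using sets_eq_imp_space_eq[OF sets_nu] by (simp add: space_mu)
  define \<eta> :: "nat \<Rightarrow> real" where "\<eta> k = inverse (real (Suc k))" for k
  have \<eta>_pos: "0 < \<eta> k" for k by (simp add: \<eta>_def)
  have \<eta>_lim: "\<eta> \<longlonglongrightarrow> 0" unfolding \<eta>_def by (rule LIMSEQ_inverse_real_of_nat)
  have "\<exists>Z. finite Z \<and> Z \<subseteq> M \<and> pairwise (\<lambda>x y. \<eta> k \<le> D x y) Z \<and> (\<forall>x\<in>M. \<exists>z\<in>Z. D x z < \<eta> k)" for k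
    using exists_separated_net[OF \<eta>_pos[of k]] by metis
  then obtain Z where Z: "\<And>k. finite (Z k)" "\<And>k. Z k \<subseteq> M" "\<And>k. pairwise (\<lambda>x y. \<eta> k \<le> D x y) (Z k)"
     "\<And>k x. x \<in> M \<Longrightarrow> \<exists>z\<in>Z k. D x z < \<eta> k"
    by metis
  define G where "G k = {z\<in>Z k. mball z (\<eta> k) \<subseteq> U}" for k
  define S where "S k = U - (\<Union>z\<in>G k. mball z (\<eta> k))" for k
  have G: "finite (G k)" "G k \<subseteq> M" "pairwise (\<lambda>x y. \<eta> k \<le> D x y) (G k)" for k
    using Z(1-3)[of k] by (auto simp: G_def pairwise_def)
  have cells: "(\<Union>z\<in>G k. mball z (\<eta> k)) \<in> sets \<nu>" for k
    using G[of k] sets_mball unfolding sets_nu by (intro sets.finite_UN) auto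
  have "(\<lambda>k. measure \<nu> (S k)) \<longlonglongrightarrow> 0"
  proof (rule measure_eventually_vanishing_tendsto_0)
    show "S k \<in> sets \<nu>" for k unfolding S_def using U(2) cells by (auto simp: sets_nu)
    fix x assume "x \<in> space \<nu>"
    hence x: "x \<in> M" by (simp add: space_nu)
    show "eventually (\<lambda>k. x \<notin> S k) sequentially"
    proof (cases "x \<in> U")
      case True
      then obtain e where e: "0 < e" "mball x e \<subseteq> U" using U(1) by (auto simp: openin_mtopology)
      \<comment> \<open>A net point within \<open>\<eta> k\<close> of \<open>x\<close> has its ball
        within \<open>2 * \<eta> k\<close> of \<open>x\<close>, hence inside
        \<open>mball x e\<close>.\<close>
      have "eventually (\<lambda>k. \<eta> k < e/2) sequentially"
        using e(1) by (intro order_tendstoD(2)[OF \<eta>_lim]) auto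
      thus ?thesis
      proof eventually_elim
        case (elim k)
        obtain z where z: "z \<in> Z k" "D x z < \<eta> k" using Z(4)[OF x] by blast
        have zM: "z \<in> M" using z(1) Z(2) by blast
        have "mball z (\<eta> k) \<subseteq> mball x e"
          using z elim x zM by (intro mball_subset) (auto simp: commute[of z x])
        hence "z \<in> G k" using z e by (auto simp: G_def)
        thus ?case using z x zM by (auto simp: S_def commute[of z x])
      qed
    qed (simp add: S_def)
  qed (rule nu.finite_measure_axioms)
  hence ev1: "eventually (\<lambda>k. measure \<nu> (S k) < measure \<nu> U - \<omega>) sequentially"
    using mass by (intro order_tendstoD(2)) auto
  define \<tau> where "\<tau> = (L'/L) powr (1/s') - 1"
  have "1 < (L'/L) powr (1/s')" using L s' by (simp add: gr_one_powr)
  hence \<tau>: "0 < \<tau>" by (simp add: \<tau>_def)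
  define W where "W = b * (cu * 2 powr Q / (c * cl)) * C"
  have lim: "(\<lambda>k. 2 / \<tau> * \<eta> k) \<longlonglongrightarrow> 0" using tendsto_mult[OF tendsto_const \<eta>_lim, of "2/\<tau>"] by simp
  \<comment> \<open>Here the loss \<open>s' < s\<close> is spent: \<open>W\<close> contains the
    uncontrolled density bound \<open>b\<close>, and the positive exponent still drives the product
    to 0.\<close>
  have "(\<lambda>k. W * (2 / \<tau> * \<eta> k) powr (s - s')) \<longlonglongrightarrow> W * 0 powr (s - s')"
    using s' \<eta>_pos \<tau>
    by (intro tendsto_mult tendsto_const tendsto_powr'[OF lim tendsto_const]) (auto intro!: always_eventually divide_nonneg_nonneg simp: less_imp_le)
  hence "(\<lambda>k. W * (2 / \<tau> * \<eta> k) powr (s - s')) \<longlonglongrightarrow> 0" by simp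
  hence ev2: "eventually (\<lambda>k. W * (2 / \<tau> * \<eta> k) powr (s - s') < L') sequentially"
    using L by (intro order_tendstoD(2)[where y = 0]) auto
  have ev3: "eventually (\<lambda>k. \<eta> k < r0) sequentially" "eventually (\<lambda>k. \<eta> k < r1) sequentially"
    "eventually (\<lambda>k. 2 / \<tau> * \<eta> k < r1) sequentially"
    by (rule order_tendstoD(2)[OF \<eta>_lim r0_pos] order_tendstoD(2)[OF \<eta>_lim r1_pos]
      order_tendstoD(2)[OF lim r1_pos])+
  have "eventually (\<lambda>k. measure \<nu> (S k) < measure \<nu> U - \<omega> \<and> W * (2 / \<tau> * \<eta> k) powr (s - s') < L'
      \<and> \<eta> k < r0 \<and> \<eta> k < r1 \<and> 2 / \<tau> * \<eta> k < r1) sequentially"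
    using ev1 ev2 ev3 by eventually_elim auto
  then obtain k where k: "measure \<nu> (S k) < measure \<nu> U - \<omega>" "W * (2 / \<tau> * \<eta> k) powr (s - s') < L'"
      "\<eta> k < r0" "\<eta> k < r1" "2 / \<tau> * \<eta> k < r1"
    unfolding eventually_sequentially by blast
  have "measure \<nu> (S k) = measure \<nu> U - measure \<nu> (\<Union>z\<in>G k. mball z (\<eta> k))"
    unfolding S_def using U(2) cells by (intro nu.finite_measure_Diff) (auto simp: sets_nu G_def)
  hence big: "\<omega> < measure \<nu> (\<Union>z\<in>G k. mball z (\<eta> k))" using k(1) by linarith
  show ?thesis
    by (rule spread_step_at_scale[OF sp s' L \<tau>_def \<eta>_pos[of k] _ _ _ _ G[of k] _ big])
       (use k in \<open>auto simp: W_def G_def\<close>)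
qed

section \<open>Iterating the transport and the size of the limit set\<close>

lemma initial_spread:
  assumes x0: "x0 \<in> M" "0 < t" and s': "0 < s'" "s' \<le> Q"
  obtains \<nu> L where "0 < L" "spread \<nu> (mball x0 t) 1 L s'" "0 < measure \<nu> (mball x0 t)"
proof -
  interpret mu: finite_measure \<mu> by (rule finite_mu)
  have B: "mball x0 t \<in> sets \<mu>" using x0 by (intro sets_mball)
  obtain \<nu> where nu: "finite_measure \<nu>" "sets \<nu> = sets \<mu>"
    "\<And>A. A \<in> sets \<mu> \<Longrightarrow> measure \<nu> A = (\<Sum>z\<in>{()}. 1 * measure \<mu> (mball x0 t \<inter> A))"
    by (rule weighted_restrictions_measure[OF finite_mu, of "{()}" "\<lambda>_. mball x0 t" "\<lambda>_. 1"]) (use B in auto)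
  have nu_eq: "measure \<nu> A = measure \<mu> (mball x0 t \<inter> A)" if "A \<in> sets \<mu>" for A
    using nu(3)[OF that] by simp
  have nu_le: "measure \<nu> A \<le> measure \<mu> A" if "A \<in> sets \<mu>" for A
    unfolding nu_eq[OF that] using that B by (intro mu.finite_measure_mono) auto
  \<comment> \<open>The first term serves radii up to \<open>r0\<close>, where Ahlfors regularity
    with \<open>s' \<le> Q\<close> applies; the second serves larger radii through the total
    mass.\<close>
  define L where "L = cu * r0 powr (Q - s') + measure \<mu> M / r0 powr s'"
  have L: "0 < L" using cu_pos r0_pos unfolding L_def by (intro add_pos_nonneg) auto
  have "measure \<nu> (mball x r) \<le> L * r powr s'" if x: "x \<in> M" and r: "0 < r" for x r
  proof (cases "r \<le> r0")
    case True
    have "measure \<nu> (mball x r) \<le> cu * r powr Q"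
      using nu_le[OF sets_mball[OF x]] upper[OF x r True] by (rule order_trans)
    also have "\<dots> = cu * r powr (Q - s') * r powr s'" by (simp add: powr_add[symmetric])
    also have "\<dots> \<le> L * r powr s'"
    proof (intro mult_right_mono)
      have "cu * r powr (Q - s') \<le> cu * r0 powr (Q - s')"
        using cu_pos r True s' by (intro mult_left_mono powr_mono2) auto
      thus "cu * r powr (Q - s') \<le> L" by (simp add: L_def add_increasing2)
    qed auto
    finally show ?thesis .
  next
    case False
    have "measure \<nu> (mball x r) \<le> measure \<mu> (space \<mu>)"
      using nu_le[OF sets_mball[OF x]] mu.bounded_measure order_trans by blast
    also have "\<dots> = measure \<mu> M / r0 powr s' * r0 powr s'" using r0_pos by (simp add: space_mu)
    also have "\<dots> \<le> L * r powr s'"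
      using False r0_pos s' cu_pos unfolding L_def
      by (intro mult_mono powr_mono2) (auto simp: add_increasing)
    finally show ?thesis .
  qed
  moreover have "measure \<nu> (M - mball x0 t) = 0"
  proof -
    have "M - mball x0 t \<in> sets \<mu>" using B by (metis sets.compl_sets space_mu)
    thus ?thesis by (simp add: nu_eq)
  qed
  ultimately have "spread \<nu> (mball x0 t) 1 L s'"
    using nu(1,2) B nu_le by (auto simp: spread_def)
  moreover have "0 < measure \<nu> (mball x0 t)"
  proof -
    have "0 < cl * (min t r0) powr Q" using cl_pos x0 r0_pos by simp
    also have "\<dots> \<le> measure \<mu> (mball x0 (min t r0))" using x0 r0_pos by (intro lower) auto
    also have "\<dots> \<le> measure \<mu> (mball x0 t)"
      using x0 B by (intro mu.finite_measure_mono mball_subset_concentric) auto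
    finally show ?thesis using B by (simp add: nu_eq)
  qed
  ultimately show ?thesis using L that by blast
qed

text \<open>The construction only yields measures on the finite stages \<open>U k\<close>; by compactness a countable
  cover of the limit set already covers some stage, so no weak limit is needed.\<close>

lemma nested_spread_content:
  assumes s': "0 < s'" and L: "0 < L" and \<omega>: "0 < \<omega>"
    and sp: "\<And>k. spread (\<nu> k) (U k) (b k) L s'" and mass: "\<And>k. \<omega> \<le> measure (\<nu> k) (U k)"
    and compact: "compactin mtopology (mtopology closure_of (U 0))"
    and nested: "\<And>k. mtopology closure_of (U (Suc k)) \<subseteq> U k"
    and sub: "(\<Inter>k. mtopology closure_of (U k)) \<subseteq> E"
  shows "hausdorff_measure M D s' E \<noteq> 0"
proof
  assume zero: "hausdorff_measure M D s' E = 0"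
  \<comment> \<open>The cover will cost less than \<open>\<theta>\<close> and its enlargement to
    open balls at most \<open>\<theta>\<close>, giving mass below
    \<open>2 * L * \<theta> = \<omega> / 2\<close>.\<close>
  define \<theta> where "\<theta> = \<omega> / (4 * L)"
  have \<theta>: "0 < \<theta>" using L \<omega> by (simp add: \<theta>_def)
  have "hausdorff_content M D s' 1 E \<le> hausdorff_measure M D s' E"
    unfolding hausdorff_measure_def by (rule SUP_upper) simp
  hence "hausdorff_content M D s' 1 E < ennreal \<theta>" using zero \<theta> by simp
  then obtain V where V: "\<And>j. V j \<subseteq> M" "\<And>j. mbounded (V j)" "E \<subseteq> (\<Union>j. V j)"
      "(\<Sum>j. ennreal (mdiam M D (V j) powr s')) < ennreal \<theta>"
    unfolding hausdorff_content_def INF_less_iff by blast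
  define I where "I = {j. V j \<noteq> {}}"
  define p where "p j = (SOME x. x \<in> V j)" for j
  have p: "p j \<in> V j" "p j \<in> M" if "j \<in> I" for j
  proof -
    show "p j \<in> V j" using that unfolding I_def p_def by (auto intro: someI)
    thus "p j \<in> M" using V(1) by blast
  qed
  have diam: "D x y \<le> mdiam M D (V j)" if "x \<in> V j" "y \<in> V j" for x y j
  proof -
    obtain B where "\<And>x y. x \<in> V j \<Longrightarrow> y \<in> V j \<Longrightarrow> D x y \<le> B"
      using V(2)[of j] unfolding mbounded_alt by blast
    hence "bdd_above ((\<lambda>p. D (fst p) (snd p)) ` (V j \<times> V j))"
      by (intro bdd_aboveI2[of _ _ B]) auto
    hence "D (fst (x,y)) (snd (x,y)) \<le> (SUP p\<in>V j \<times> V j. D (fst p) (snd p))"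
      using that by (intro cSUP_upper) auto
    thus ?thesis using that by (auto simp: mdiam_def)
  qed
  define e where "e j = mdiam M D (V j) powr s'" for j
  \<comment> \<open>The summable slack \<open>g\<close> makes the radius \<open>r j\<close> exceed
    the diameter of \<open>V j\<close> strictly, also for singletons, so that open balls
    cover.\<close>
  define g where "g j = (\<theta> * (1/2) ^ Suc j)" for j
  have g: "0 < g j" for j using \<theta> by (simp add: g_def)
  define r where "r j = (e j + g j) powr (1/s')" for j
  have r: "0 < r j" "r j powr s' = e j + g j" for j
  proof -
    have "0 < e j + g j" using g[of j] by (simp add: e_def add_nonneg_pos)
    thus "0 < r j" "r j powr s' = e j + g j" using s' by (simp_all add: r_def powr_powr)
  qed
  have ball: "V j \<subseteq> mball (p j) (r j)" if "j \<in> I" for j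
  proof
    fix y assume y: "y \<in> V j"
    have "0 \<le> mdiam M D (V j)" using diam[OF p(1)[OF that] y] nonneg order_trans by blast
    hence "mdiam M D (V j) < r j"
      using s' r[of j] g[of j] powr_less_cancel2[of s' "mdiam M D (V j)" "r j"]
      by (cases "mdiam M D (V j) = 0") (auto simp: e_def)
    thus "y \<in> mball (p j) (r j)" using diam[OF p(1)[OF that] y] p[OF that] y V(1) by auto
  qed
  define K where "K k = mtopology closure_of (U k)" for k
  have UM: "U k \<subseteq> M" and UK: "U k \<subseteq> K k" for k
  proof -
    show "U k \<subseteq> M" using sp[of k] openin_subset[of mtopology] by (auto simp: spread_def)
    thus "U k \<subseteq> K k" unfolding K_def by (intro closure_of_subset) simp
  qed
  have K_dec: "K j \<subseteq> K k" if "k \<le> j" for j k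
    using that
  proof (induction rule: dec_induct)
    case (step n)
    have "K (Suc n) \<subseteq> K n" using nested[of n] UK[of n] by (auto simp: K_def)
    thus ?case using step by blast
  qed simp
  \<comment> \<open>A point of \<open>K 0\<close> lies in some cover ball or outside some
    \<open>K n\<close>, so these increasing open sets cover the compact set \<open>K 0\<close> and
    one of them, \<open>Op N\<close>, does so alone. As \<open>U N\<close> lies in
    \<open>K N\<close>, finitely many balls then cover \<open>U N\<close>.\<close>
  define Op where "Op n = (\<Union>j\<in>I \<inter> {..n}. mball (p j) (r j)) \<union> (M - K n)" for n
  have O_mono: "Op m \<subseteq> Op n" if "m \<le> n" for m n
    using K_dec[OF that] that by (auto simp: Op_def)
  have "openin mtopology (Op n)" for n
    unfolding Op_def K_def by (intro openin_Un openin_Union) (auto intro: openin_diff)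
  moreover have "K 0 \<subseteq> \<Union>(range Op)"
  proof
    fix x assume x: "x \<in> K 0"
    have xM: "x \<in> M" using x closure_of_subset_topspace[of mtopology "U 0"] by (auto simp: K_def)
    show "x \<in> \<Union>(range Op)"
    proof (cases "\<exists>n. x \<notin> K n")
      case True
      thus ?thesis using xM by (auto simp: Op_def)
    next
      case False
      hence "x \<in> E" using sub by (auto simp: K_def)
      then obtain j where j: "x \<in> V j" using V(3) by blast
      hence "j \<in> I" by (auto simp: I_def)
      moreover from ball[OF this] j have "x \<in> mball (p j) (r j)" by blast
      ultimately have "x \<in> Op j" by (auto simp: Op_def)
      thus ?thesis by blast
    qed
  qed
  ultimately obtain \<F> where \<F>: "finite \<F>" "\<F> \<subseteq> range Op" "K 0 \<subseteq> \<Union>\<F>"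
    using compactinD[OF compact, of "range Op"] unfolding K_def by blast
  obtain T where T: "finite T" "\<F> = Op ` T" using finite_subset_image[OF \<F>(1,2)] by blast
  define N where "N = Max (insert 0 T)"
  have FO: "\<Union>\<F> \<subseteq> Op N"
    unfolding T(2) N_def using T(1) by (intro UN_least O_mono) auto
  have cover: "U N \<subseteq> (\<Union>j\<in>I \<inter> {..N}. mball (p j) (r j))"
  proof
    fix x assume "x \<in> U N"
    hence "x \<in> K N" using UK by blast
    moreover from this have "x \<in> Op N" using K_dec[of 0 N] \<F>(3) FO by blast
    ultimately show "x \<in> (\<Union>j\<in>I \<inter> {..N}. mball (p j) (r j))" unfolding Op_def by blast
  qed
  interpret nu: finite_measure "\<nu> N" using sp[of N] by (simp add: spread_def)
  have sets_nu: "sets (\<nu> N) = sets \<mu>" using sp[of N] by (simp add: spread_def)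
  have sum_e: "(\<Sum>j\<le>N. e j) < \<theta>"
  proof -
    have "ennreal (\<Sum>j\<le>N. e j) = (\<Sum>j\<le>N. ennreal (e j))" by (intro sum_ennreal[symmetric]) (simp add: e_def)
    also have "\<dots> \<le> (\<Sum>j. ennreal (e j))" by (intro sum_le_suminf) auto
    also have "\<dots> < ennreal \<theta>" using V(4) by (simp add: e_def)
    finally show ?thesis by (simp add: ennreal_less_iff sum_nonneg e_def)
  qed
  have sum_g: "(\<Sum>j\<le>N. g j) \<le> \<theta>"
  proof -
    have "(\<Sum>j\<le>N. (1/2::real) ^ Suc j) = 1 - (1/2) ^ Suc N" by (induction N) auto
    hence "(\<Sum>j\<le>N. (1/2::real) ^ Suc j) \<le> 1" by simp
    from mult_left_mono[OF this, of \<theta>] show ?thesis using \<theta> by (simp add: g_def sum_distrib_left)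
  qed
  have "\<omega> \<le> measure (\<nu> N) (U N)" by (rule mass)
  also have "\<dots> \<le> measure (\<nu> N) (\<Union>j\<in>I \<inter> {..N}. mball (p j) (r j))"
    using cover p(2) sets_mball by (intro nu.finite_measure_mono) (auto simp: sets_nu intro!: sets.finite_UN)
  also have "\<dots> \<le> (\<Sum>j\<in>I \<inter> {..N}. measure (\<nu> N) (mball (p j) (r j)))"
    using p(2) sets_mball by (intro nu.finite_measure_subadditive_finite) (auto simp: sets_nu)
  also have "\<dots> \<le> (\<Sum>j\<in>I \<inter> {..N}. L * (e j + g j))"
  proof (intro sum_mono)
    fix j assume "j \<in> I \<inter> {..N}"
    hence "p j \<in> M" using p(2) by blast
    hence "measure (\<nu> N) (mball (p j) (r j)) \<le> L * r j powr s'"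
      using sp[of N] r(1)[of j] by (auto simp: spread_def)
    thus "measure (\<nu> N) (mball (p j) (r j)) \<le> L * (e j + g j)" by (simp add: r(2))
  qed
  also have "\<dots> \<le> (\<Sum>j\<le>N. L * (e j + g j))"
    using L g less_imp_le by (intro sum_mono2) (auto simp: e_def intro!: mult_nonneg_nonneg add_nonneg_nonneg)
  also have "\<dots> = L * ((\<Sum>j\<le>N. e j) + (\<Sum>j\<le>N. g j))"
    by (simp only: sum_distrib_left[symmetric] sum.distrib)
  also have "\<dots> < L * (\<theta> + \<theta>)" using sum_e sum_g L by (intro mult_strict_left_mono) auto
  also have "\<dots> = \<omega> / 2" using L by (simp add: \<theta>_def)
  finally show False using \<omega> by simp
qed

text \<open>Every step must enlarge the Frostman constant, so the constants run through
  \<open>L * (2 - (1/2) ^ k)\<close>, which increases strictly and stays below \<open>2 * L\<close>.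
  Step \<open>k\<close> uses a level of index at least \<open>k\<close>. Limit points belong only to
  the closures of these levels, whence the sets \<open>E n\<close>.\<close>

theorem hausdorff_measure_limsup_nonzero:
  assumes s': "0 < s'" "s' < s" "s \<le> Q"
    and E: "\<And>n. mtopology closure_of (F n) \<subseteq> E n"
    and x0: "x0 \<in> M" "0 < t" "compactin mtopology (mtopology closure_of (mball x0 t))"
  shows "hausdorff_measure M D s' {x \<in> M. infinite {n. x \<in> E n}} \<noteq> 0"
proof -
  obtain \<nu>0 L where init: "0 < L" "spread \<nu>0 (mball x0 t) 1 L s'" "0 < measure \<nu>0 (mball x0 t)"
    using initial_spread[of x0 t s'] x0 s' by (metis less_imp_le order_trans)
  \<comment> \<open>\<open>spread_step\<close> preserves strict lower bounds on the mass, and half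
    the initial mass is one.\<close>
  define \<omega> where "\<omega> = measure \<nu>0 (mball x0 t) / 2"
  have \<omega>: "0 < \<omega>" using init by (simp add: \<omega>_def)
  \<comment> \<open>The clause for \<open>k = 0\<close> ties the chosen sequence to the precompact
    ball that provides compactness.\<close>
  define P where "P k q \<longleftrightarrow> (case q of (\<nu>, U) \<Rightarrow> (\<exists>b. spread \<nu> U b (L * (2 - (1/2) ^ k)) s')
       \<and> \<omega> < measure \<nu> U \<and> (k = 0 \<longrightarrow> U = mball x0 t))" for k :: nat and q
  define T where "T k q q' \<longleftrightarrow> mtopology closure_of (snd q') \<subseteq> snd q \<and> (\<exists>n\<ge>k. snd q' \<subseteq> F n)"
    for k :: nat and q q' :: "'a measure \<times> 'a set"
  have "P 0 (\<nu>0, mball x0 t)" using init by (auto simp: P_def \<omega>_def)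
  hence "\<exists>q. P 0 q" by blast
  moreover have "\<exists>q'. P (Suc k) q' \<and> T k q q'" if Pkq: "P k q" for k q
  proof -
    obtain \<nu> U where q1: "q = (\<nu>, U)" by (cases q)
    obtain b where q: "q = (\<nu>, U)" "spread \<nu> U b (L * (2 - (1/2) ^ k)) s'" "\<omega> < measure \<nu> U"
      using Pkq q1 by (auto simp: P_def)
    have "(1/2::real) ^ k \<le> 1" "(1/2::real) ^ Suc k < (1/2) ^ k" by (simp_all add: power_le_one)
    hence "0 < L * (2 - (1/2) ^ k)" "L * (2 - (1/2) ^ k) < L * (2 - (1/2) ^ Suc k)"
      using init(1) by (intro mult_pos_pos mult_strict_left_mono; linarith)+
    from spread_step[OF q(2) s'(1,2) this q(3), of k] obtain n \<nu>' U' b' where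
      "n \<ge> k" "spread \<nu>' U' b' (L * (2 - (1/2) ^ Suc k)) s'" "\<omega> < measure \<nu>' U'"
      "mtopology closure_of U' \<subseteq> U" "U' \<subseteq> F n" by blast
    hence "P (Suc k) (\<nu>', U') \<and> T k q (\<nu>', U')" unfolding P_def T_def q by auto
    thus ?thesis by blast
  qed
  ultimately obtain f where f: "\<And>k. P k (f k)" "\<And>k. T k (f k) (f (Suc k))"
    using dependent_nat_choice[of P T] by blast
  have "\<exists>b. spread (fst (f k)) (snd (f k)) b (2 * L) s'" for k
  proof -
    obtain b where b: "spread (fst (f k)) (snd (f k)) b (L * (2 - (1/2) ^ k)) s'"
      using f(1)[of k] by (auto simp: P_def split: prod.splits)
    have "L * (2 - (1/2) ^ k) * r powr s' \<le> 2 * L * r powr s'" for r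
      using init(1) by (intro mult_right_mono) (auto simp: field_simps)
    hence "spread (fst (f k)) (snd (f k)) b (2 * L) s'"
      using b unfolding spread_def by (meson order_trans)
    thus ?thesis ..
  qed
  then obtain b where b: "\<And>k. spread (fst (f k)) (snd (f k)) (b k) (2 * L) s'" by metis
  have U0: "snd (f 0) = mball x0 t" using f(1)[of 0] by (auto simp: P_def split: prod.splits)
  have mass: "\<omega> \<le> measure (fst (f k)) (snd (f k))" for k
    using f(1)[of k] by (auto simp: P_def split: prod.splits)
  show ?thesis
  proof (rule nested_spread_content[OF s'(1) _ \<omega> b mass])
    show "compactin mtopology (mtopology closure_of (snd (f 0)))" unfolding U0 by (rule x0)
    show "mtopology closure_of (snd (f (Suc k))) \<subseteq> snd (f k)" for k using f(2) by (simp add: T_def)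
    show "(\<Inter>k. mtopology closure_of (snd (f k))) \<subseteq> {x \<in> M. infinite {n. x \<in> E n}}"
    proof
      fix x assume x: "x \<in> (\<Inter>k. mtopology closure_of (snd (f k)))"
      have "\<exists>n\<ge>k. x \<in> E n" for k
      proof -
        obtain n where n: "n \<ge> k" "snd (f (Suc k)) \<subseteq> F n" using f(2)[of k] by (auto simp: T_def)
        have "x \<in> mtopology closure_of (F n)" using x closure_of_mono[OF n(2)] by blast
        thus ?thesis using E n(1) by blast
      qed
      hence "infinite {n. x \<in> E n}" by (auto simp: infinite_nat_iff_unbounded_le)
      moreover have "x \<in> M" using x closure_of_subset_topspace[of mtopology] by fastforce
      ultimately show "x \<in> {x \<in> M. infinite {n. x \<in> E n}}" by simp
    qed
  qed (use init(1) in simp)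
qed

end

section \<open>Products of metric measure spaces\<close>

locale metric_measure_product =
  fixes d :: nat and Xs :: "nat \<Rightarrow> 'a set" and ds :: "nat \<Rightarrow> 'a \<Rightarrow> 'a \<Rightarrow> real" and m :: "nat \<Rightarrow> 'a measure"
  assumes d_pos: "1 \<le> d"
    and metric: "\<And>i. i < d \<Longrightarrow> Metric_space (Xs i) (ds i)"
    and prob: "\<And>i. i < d \<Longrightarrow> prob_space (m i)"
    and space_m: "\<And>i. i < d \<Longrightarrow> space (m i) = Xs i"
    and sets_m: "\<And>i. i < d \<Longrightarrow> sets (m i) = metric_borel (Xs i) (ds i)"
begin

abbreviation mtop :: "nat \<Rightarrow> 'a topology" where "mtop i \<equiv> Metric_space.mtopology (Xs i) (ds i)"
abbreviation mb :: "nat \<Rightarrow> 'a \<Rightarrow> real \<Rightarrow> 'a set" where "mb i \<equiv> Metric_space.mball (Xs i) (ds i)"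
abbreviation nb :: "nat \<Rightarrow> 'a set \<Rightarrow> real \<Rightarrow> 'a set" where "nb i \<equiv> nbhd (Xs i) (ds i)"
abbreviation PX :: "(nat \<Rightarrow> 'a) set" where "PX \<equiv> PiE {..<d} Xs"
abbreviation PD :: "(nat \<Rightarrow> 'a) \<Rightarrow> (nat \<Rightarrow> 'a) \<Rightarrow> real" where "PD \<equiv> prod_dist d ds"
abbreviation PM :: "(nat \<Rightarrow> 'a) measure" where "PM \<equiv> PiM {..<d} m"

lemma in_mb: "i < d \<Longrightarrow> y \<in> mb i x r \<longleftrightarrow> x \<in> Xs i \<and> y \<in> Xs i \<and> ds i x y < r"
  by (simp add: Metric_space.in_mball[OF metric])

lemma prod_dist_less: "PD x y < r \<longleftrightarrow> (\<forall>i<d. ds i (x i) (y i) < r)"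
  using d_pos unfolding prod_dist_def by (subst Max_less_iff) (auto simp: lessThan_empty_iff)

lemma prod_dist_le: "PD x y \<le> r \<longleftrightarrow> (\<forall>i<d. ds i (x i) (y i) \<le> r)"
  using d_pos unfolding prod_dist_def by (subst Max_le_iff) (auto simp: lessThan_empty_iff)

lemma coord_le_prod_dist: "i < d \<Longrightarrow> ds i (x i) (y i) \<le> PD x y"
  using prod_dist_le[of x y "PD x y"] by simp

lemma metric_product: "Metric_space PX PD"
proof
  fix x y :: "nat \<Rightarrow> 'a"
  have "0 \<le> ds 0 (x 0) (y 0)" using d_pos by (intro Metric_space.nonneg[OF metric]) simp
  also have "\<dots> \<le> PD x y" using d_pos by (intro coord_le_prod_dist) simp
  finally show "0 \<le> PD x y" .
  have "ds i (x i) (y i) = ds i (y i) (x i)" if "i < d" for i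
    by (rule Metric_space.commute[OF metric[OF that]])
  thus "PD x y = PD y x" unfolding prod_dist_def by (intro arg_cong[of _ _ Max] image_cong) auto
next
  fix x y assume xy: "x \<in> PX" "y \<in> PX"
  show "PD x y = 0 \<longleftrightarrow> x = y"
  proof
    assume "PD x y = 0"
    hence "ds i (x i) (y i) \<le> 0" if "i < d" for i using coord_le_prod_dist[OF that, of x y] by simp
    hence "x i = y i" if "i < d" for i
      using that xy Metric_space.nonneg[OF metric[OF that]] Metric_space.zero[OF metric[OF that], of "x i" "y i"]
      by (metis PiE_mem antisym lessThan_iff)
    thus "x = y" by (intro PiE_ext[OF xy]) auto
  next
    assume "x = y"
    hence "ds i (x i) (y i) = 0" if "i < d" for i
      using that xy Metric_space.zero[OF metric[OF that], of "x i" "y i"] by auto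
    moreover have "{..<d} \<noteq> {}" using d_pos by (auto simp: lessThan_empty_iff)
    ultimately have "(\<lambda>i. ds i (x i) (y i)) ` {..<d} = {0}" by (auto simp: image_iff)
    thus "PD x y = 0" by (simp add: prod_dist_def)
  qed
next
  fix x y z assume xyz: "x \<in> PX" "y \<in> PX" "z \<in> PX"
  show "PD x z \<le> PD x y + PD y z"
    unfolding prod_dist_le
  proof (intro allI impI)
    fix i assume i: "i < d"
    have "ds i (x i) (z i) \<le> ds i (x i) (y i) + ds i (y i) (z i)"
      using xyz i by (intro Metric_space.triangle[OF metric]) auto
    thus "ds i (x i) (z i) \<le> PD x y + PD y z"
      using coord_le_prod_dist[OF i, of x y] coord_le_prod_dist[OF i, of y z] by linarith
  qed
qed

sublocale P: Metric_space PX PD by (rule metric_product)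

lemma mball_product:
  assumes "x \<in> PX"
  shows "P.mball x r = PiE {..<d} (\<lambda>i. mb i (x i) r)"
proof (intro set_eqI iffI)
  fix y assume "y \<in> P.mball x r"
  thus "y \<in> PiE {..<d} (\<lambda>i. mb i (x i) r)"
    using assms by (auto simp: prod_dist_less in_mb PiE_iff)
next
  fix y assume "y \<in> PiE {..<d} (\<lambda>i. mb i (x i) r)"
  thus "y \<in> P.mball x r"
    using assms by (auto simp: prod_dist_less in_mb PiE_iff)
qed

lemma open_sets: "i < d \<Longrightarrow> openin (mtop i) U \<Longrightarrow> U \<in> sets (m i)"
  by (auto simp: sets_m metric_borel_def)

lemma open_mb: "i < d \<Longrightarrow> openin (mtop i) (mb i x r)"
  by (rule Metric_space.openin_mball[OF metric])

lemma open_nb: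
  assumes i: "i < d" and E: "E \<subseteq> Xs i"
  shows "openin (mtop i) (nb i E \<epsilon>)"
proof -
  have "nb i E \<epsilon> = (\<Union>x\<in>E. mb i x \<epsilon>)"
    using E i by (auto simp: nbhd_def in_mb Metric_space.commute[OF metric[OF i]]) blast
  thus ?thesis using i by (auto intro: open_mb)
qed

lemma openin_box:
  assumes "\<And>i. i < d \<Longrightarrow> openin (mtop i) (U i)"
  shows "openin P.mtopology (PiE {..<d} U)"
  unfolding P.openin_mtopology
proof (intro conjI allI impI)
  have "U i \<subseteq> Xs i" if "i < d" for i
    using openin_subset[OF assms[OF that]] by (simp add: Metric_space.topspace_mtopology[OF metric[OF that]])
  thus sub: "PiE {..<d} U \<subseteq> PX" by (intro PiE_mono) auto
  fix x assume x: "x \<in> PiE {..<d} U"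
  have "\<exists>r>0. mb i (x i) r \<subseteq> U i" if "i < d" for i
    using assms[OF that] x that unfolding Metric_space.openin_mtopology[OF metric[OF that]] by auto
  then obtain r where r: "\<And>i. i < d \<Longrightarrow> 0 < r i" "\<And>i. i < d \<Longrightarrow> mb i (x i) (r i) \<subseteq> U i" by metis
  define e where "e = Min (r ` {..<d})"
  have ne: "{..<d} \<noteq> {}" using d_pos by (auto simp: lessThan_empty_iff)
  have e: "0 < e" "\<And>i. i < d \<Longrightarrow> e \<le> r i"
    using r(1) ne by (auto simp: e_def)
  have "mb i (x i) e \<subseteq> U i" if "i < d" for i
    using r(2)[OF that] Metric_space.mball_subset_concentric[OF metric[OF that] e(2)[OF that]] by blast
  hence "P.mball x e \<subseteq> PiE {..<d} U" using x sub by (subst mball_product) (auto intro!: PiE_mono)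
  thus "\<exists>r>0. P.mball x r \<subseteq> PiE {..<d} U" using e(1) by blast
qed

lemma sets_box:
  assumes "\<And>i. i < d \<Longrightarrow> U i \<in> sets (m i)"
  shows "PiE {..<d} U \<in> sets PM"
  using assms by (intro sets_PiM_I_finite) auto

lemma measure_box:
  assumes U: "\<And>i. i < d \<Longrightarrow> U i \<in> sets (m i)"
  shows "measure PM (PiE {..<d} U) = (\<Prod>i<d. measure (m i) (U i))" and "prob_space PM"
proof -
  \<comment> \<open>The product locales ask for a probability space at every index; beyond
    \<open>d\<close> the measure \<open>m 0\<close> fills in.\<close>
  define m' where "m' i = (if i < d then m i else m 0)" for i
  have p: "prob_space (m' i)" for i using prob d_pos by (auto simp: m'_def)
  have eq: "PM = PiM {..<d} m'" by (intro PiM_cong) (auto simp: m'_def)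
  interpret F: finite_product_prob_space m' "{..<d}"
    unfolding finite_product_prob_space_def finite_product_sigma_finite_def product_prob_space_def
      product_sigma_finite_def finite_product_sigma_finite_axioms_def product_prob_space_axioms_def
    using p prob_space_imp_sigma_finite by auto
  show "measure PM (PiE {..<d} U) = (\<Prod>i<d. measure (m i) (U i))"
    unfolding eq using U by (subst F.finite_measure_PiM_emb) (auto simp: m'_def)
  show "prob_space PM" unfolding eq by unfold_locales
qed

lemma space_PM: "space PM = PX"
  unfolding space_PiM by (intro PiE_cong) (simp add: space_m)

lemma sets_mball_product:
  assumes "x \<in> PX" shows "P.mball x r \<in> sets PM"
  unfolding mball_product[OF assms] by (intro sets_box open_sets open_mb)

text \<open>Balls of the maximum metric are finite boxes of open sets. This transfers compactness of
  products, available in the product topology, to the metric topology.\<close>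

lemma openin_product_topology_of_mtopology:
  assumes "openin P.mtopology U"
  shows "openin (product_topology mtop {..<d}) U"
proof -
  have "\<exists>V. openin (product_topology mtop {..<d}) V \<and> x \<in> V \<and> V \<subseteq> U" if x: "x \<in> U" for x
  proof -
    obtain r where r: "0 < r" "P.mball x r \<subseteq> U" and xP: "x \<in> PX"
      using assms x unfolding P.openin_mtopology by blast
    have "openin (product_topology mtop {..<d}) (P.mball x r)"
      unfolding mball_product[OF xP] by (subst openin_PiE) (auto intro: open_mb)
    thus ?thesis using r xP by (intro exI[of _ "P.mball x r"]) auto
  qed
  thus ?thesis by (subst openin_subopen) auto
qed

text \<open>A product of compact coordinate neighbourhoods is compact, hence closed in the Hausdorff
  metric topology, so it contains the closure of any ball inside it.\<close>

lemma exists_precompact_ball: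
  assumes lc: "\<And>i. i < d \<Longrightarrow> locally_compact_space (mtop i)"
  obtains x t where "x \<in> PX" "0 < t" "compactin P.mtopology (P.mtopology closure_of (P.mball x t))"
proof -
  have "\<exists>x. x \<in> Xs i" if i: "i < d" for i
    using prob_space.not_empty[OF prob[OF i]] space_m[OF i] by auto
  then obtain x0 where x0: "\<And>i. i < d \<Longrightarrow> x0 i \<in> Xs i" by metis
  define x where "x = restrict x0 {..<d}"
  have x: "x \<in> PX" using x0 by (auto simp: x_def)
  have "\<exists>U K. openin (mtop i) U \<and> compactin (mtop i) K \<and> x i \<in> U \<and> U \<subseteq> K" if i: "i < d" for i
    using lc[OF i] x i unfolding locally_compact_space_def
    by (simp add: Metric_space.topspace_mtopology[OF metric[OF i]]) (metis PiE_mem lessThan_iff)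
  then obtain U K where UK: "\<And>i. i < d \<Longrightarrow> openin (mtop i) (U i)" "\<And>i. i < d \<Longrightarrow> compactin (mtop i) (K i)"
     "\<And>i. i < d \<Longrightarrow> x i \<in> U i" "\<And>i. i < d \<Longrightarrow> U i \<subseteq> K i" by metis
  have "x \<in> PiE {..<d} U" using x UK(3) by (auto simp: PiE_iff)
  then obtain t where t: "0 < t" "P.mball x t \<subseteq> PiE {..<d} U"
    using openin_box[of U] UK(1) unfolding P.openin_mtopology by blast
  have compact: "compactin (product_topology mtop {..<d}) (PiE {..<d} K)"
    using UK(2) by (subst compactin_PiE) auto
  have "compactin P.mtopology (PiE {..<d} K)"
    unfolding compactin_def P.topspace_mtopology
  proof (intro conjI allI impI)
    show "PiE {..<d} K \<subseteq> PX"
      using compactin_subset_topspace[OF UK(2)]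
      by (intro PiE_mono) (auto simp: Metric_space.topspace_mtopology[OF metric])
    fix \<U> assume "(\<forall>U\<in>\<U>. openin P.mtopology U) \<and> PiE {..<d} K \<subseteq> \<Union>\<U>"
    thus "\<exists>\<F>. finite \<F> \<and> \<F> \<subseteq> \<U> \<and> PiE {..<d} K \<subseteq> \<Union>\<F>"
      by (intro compactinD[OF compact]) (auto intro: openin_product_topology_of_mtopology)
  qed
  moreover from this have "closedin P.mtopology (PiE {..<d} K)"
    by (intro compactin_imp_closedin P.Hausdorff_space_mtopology)
  moreover have "P.mball x t \<subseteq> PiE {..<d} K"
    using t(2) PiE_mono[of "{..<d}" U K] UK(4) by auto
  ultimately have "compactin P.mtopology (P.mtopology closure_of (P.mball x t))"
    by (meson closed_compactin closedin_closure_of closure_of_minimal)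
  thus ?thesis using that x t(1) by blast
qed

end

section \<open>Level sets of small rectangles\<close>

locale scaling_product = metric_measure_product +
  fixes \<delta> :: "nat \<Rightarrow> real" and \<kappa> :: real and cl cu c2 c3 r0 :: real
    and J :: "'j set" and R :: "'j \<Rightarrow> nat \<Rightarrow> 'a set"
  assumes \<delta>_pos: "\<And>i. i < d \<Longrightarrow> 0 < \<delta> i" and \<kappa>: "0 \<le> \<kappa>" "\<kappa> < 1"
    and cl_pos: "0 < cl" and cu_pos: "0 < cu" and c2_pos: "0 < c2" and c3_pos: "0 < c3" and r0_pos: "0 < r0"
    and ahlfors_lower: "\<And>i x r. i < d \<Longrightarrow> x \<in> Xs i \<Longrightarrow> 0 < r \<Longrightarrow> r \<le> r0 \<Longrightarrow>
       cl * r powr \<delta> i \<le> measure (m i) (mb i x r)"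
    and ahlfors_upper: "\<And>i x r. i < d \<Longrightarrow> x \<in> Xs i \<Longrightarrow> 0 < r \<Longrightarrow> r \<le> r0 \<Longrightarrow>
       measure (m i) (mb i x r) \<le> cu * r powr \<delta> i"
    and R_sub: "\<And>\<alpha> i. \<alpha> \<in> J \<Longrightarrow> i < d \<Longrightarrow> R \<alpha> i \<subseteq> Xs i"
    and scaling_lower: "\<And>\<alpha> i x \<epsilon> r. \<alpha> \<in> J \<Longrightarrow> i < d \<Longrightarrow> x \<in> R \<alpha> i \<Longrightarrow> 0 < \<epsilon> \<Longrightarrow> \<epsilon> < r \<Longrightarrow> r \<le> r0 \<Longrightarrow>
       c2 * r powr (\<delta> i * \<kappa>) * \<epsilon> powr (\<delta> i * (1 - \<kappa>)) \<le> measure (m i) (mb i x r \<inter> nb i (R \<alpha> i) \<epsilon>)"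
    and scaling_upper: "\<And>\<alpha> i x \<epsilon> r. \<alpha> \<in> J \<Longrightarrow> i < d \<Longrightarrow> x \<in> R \<alpha> i \<Longrightarrow> 0 < \<epsilon> \<Longrightarrow> \<epsilon> < r \<Longrightarrow> r \<le> r0 \<Longrightarrow>
       measure (m i) (mb i x r \<inter> nb i (R \<alpha> i) \<epsilon>) \<le> c3 * r powr (\<delta> i * \<kappa>) * \<epsilon> powr (\<delta> i * (1 - \<kappa>))"
begin

lemma coord_triangle: "i < d \<Longrightarrow> x \<in> Xs i \<Longrightarrow> y \<in> Xs i \<Longrightarrow> z \<in> Xs i \<Longrightarrow> ds i x z \<le> ds i x y + ds i y z"
  by (rule Metric_space.triangle[OF metric])

lemma coord_commute: "i < d \<Longrightarrow> ds i x y = ds i y x"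
  by (rule Metric_space.commute[OF metric])

lemma coord_finite: "i < d \<Longrightarrow> finite_measure (m i)"
  using prob by (simp add: prob_space_def)

lemma nb_sets: "\<alpha> \<in> J \<Longrightarrow> i < d \<Longrightarrow> nb i (R \<alpha> i) e \<in> sets (m i)"
  by (intro open_sets open_nb R_sub)

lemma mb_sets: "i < d \<Longrightarrow> mb i x r \<in> sets (m i)"
  by (intro open_sets open_mb)

lemma mb_Int_nb_sets: "\<alpha> \<in> J \<Longrightarrow> i < d \<Longrightarrow> mb i x r \<inter> nb i (R \<alpha> i) e \<in> sets (m i)"
  by (intro sets.Int mb_sets nb_sets)

text \<open>One formula covers three regimes: for \<open>p \<le> r\<close> the scaling bound at
  \<open>z\<close>, for \<open>e < r < p\<close> the scaling bound at a nearby point of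
  \<open>R \<alpha> i\<close>, and for \<open>r \<le> e\<close> plain Ahlfors regularity.\<close>

lemma piece_bound:
  assumes \<alpha>: "\<alpha> \<in> J" and i: "i < d" and z: "z \<in> R \<alpha> i" and x: "x \<in> Xs i"
    and e: "0 < e" "e < p" "p \<le> r0" and r: "0 < r" "3 * r \<le> r0"
  shows "measure (m i) (mb i z p \<inter> nb i (R \<alpha> i) e \<inter> mb i x r)
     \<le> (c3 * 3 powr \<delta> i + cu) * min r p powr (\<delta> i * \<kappa>) * min (min r p) e powr (\<delta> i * (1 - \<kappa>))"
proof -
  interpret mi: finite_measure "m i" by (rule coord_finite[OF i])
  have d1: "0 < \<delta> i" using i by (rule \<delta>_pos)
  have three: "1 \<le> (3::real) powr \<delta> i" using d1 by (simp add: ge_one_powr_ge_zero)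
  have K: "c3 \<le> c3 * 3 powr \<delta> i + cu" "cu \<le> c3 * 3 powr \<delta> i + cu" "c3 * 3 powr \<delta> i \<le> c3 * 3 powr \<delta> i + cu"
    using c3_pos cu_pos mult_left_mono[OF three, of c3] by linarith+
  show ?thesis
  proof (cases "p \<le> r")
    case True
    have "measure (m i) (mb i z p \<inter> nb i (R \<alpha> i) e \<inter> mb i x r) \<le> measure (m i) (mb i z p \<inter> nb i (R \<alpha> i) e)"
      by (intro mi.finite_measure_mono mb_Int_nb_sets \<alpha> i) auto
    also have "\<dots> \<le> c3 * p powr (\<delta> i * \<kappa>) * e powr (\<delta> i * (1 - \<kappa>))"
      by (rule scaling_upper) (use \<alpha> i z e in auto)
    also have "\<dots> \<le> (c3 * 3 powr \<delta> i + cu) * p powr (\<delta> i * \<kappa>) * e powr (\<delta> i * (1 - \<kappa>))"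
      by (intro mult_right_mono K) auto
    finally show ?thesis using True e by (simp only: min.absorb2 less_imp_le)
  next
    case False
    show ?thesis
    proof (cases "e < r")
      case True
      show ?thesis
      proof (cases "nb i (R \<alpha> i) e \<inter> mb i x r = {}")
        case True
        hence "mb i z p \<inter> nb i (R \<alpha> i) e \<inter> mb i x r = {}" by blast
        thus ?thesis using c3_pos cu_pos by simp
      next
        case nonempty: False
        then obtain y w where y: "y \<in> Xs i" "ds i x y < r" "w \<in> R \<alpha> i" "ds i y w < e"
          using i by (auto simp: nbhd_def in_mb)
        have w: "w \<in> Xs i" using y R_sub[OF \<alpha> i] by blast
        \<comment> \<open>The scaling property speaks of balls centred on
          \<open>R \<alpha> i\<close>. Moving the centre from \<open>x\<close> to \<open>w\<close>
          costs \<open>r + e < 2 * r\<close>.\<close>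
        have "mb i x r \<subseteq> mb i w (3 * r)"
        proof
          fix u assume "u \<in> mb i x r"
          hence u: "u \<in> Xs i" "ds i x u < r" using i by (auto simp: in_mb)
          have "ds i w u \<le> ds i w y + ds i y u" "ds i y u \<le> ds i y x + ds i x u"
            using i w y u x by (auto intro: coord_triangle)
          hence "ds i w u < 3 * r" using y u \<open>e < r\<close> coord_commute[OF i, of w y] coord_commute[OF i, of x y] by linarith
          thus "u \<in> mb i w (3 * r)" using u w i by (simp add: in_mb)
        qed
        hence "measure (m i) (mb i z p \<inter> nb i (R \<alpha> i) e \<inter> mb i x r) \<le> measure (m i) (mb i w (3*r) \<inter> nb i (R \<alpha> i) e)"
          by (intro mi.finite_measure_mono mb_Int_nb_sets \<alpha> i) auto
        also have "\<dots> \<le> c3 * (3*r) powr (\<delta> i * \<kappa>) * e powr (\<delta> i * (1 - \<kappa>))"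
          by (rule scaling_upper) (use \<alpha> i y e r \<open>e < r\<close> in auto)
        also have "\<dots> = c3 * 3 powr (\<delta> i * \<kappa>) * r powr (\<delta> i * \<kappa>) * e powr (\<delta> i * (1 - \<kappa>))"
          using r by (simp add: powr_mult)
        also have "\<dots> \<le> (c3 * 3 powr \<delta> i + cu) * r powr (\<delta> i * \<kappa>) * e powr (\<delta> i * (1 - \<kappa>))"
        proof (intro mult_right_mono)
          have "c3 * 3 powr (\<delta> i * \<kappa>) \<le> c3 * 3 powr \<delta> i"
            using c3_pos d1 \<kappa> by (intro mult_left_mono powr_mono) auto
          thus "c3 * 3 powr (\<delta> i * \<kappa>) \<le> c3 * 3 powr \<delta> i + cu" using cu_pos by simp
        qed auto
        finally show ?thesis using \<open>\<not> p \<le> r\<close> \<open>e < r\<close>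
          by (simp only: min.absorb1 min.absorb2 not_le less_imp_le)
      qed
    next
      case small: False
      have "measure (m i) (mb i z p \<inter> nb i (R \<alpha> i) e \<inter> mb i x r) \<le> measure (m i) (mb i x r)"
        by (intro mi.finite_measure_mono mb_sets i) auto
      also have "\<dots> \<le> cu * r powr \<delta> i" using i x r by (intro ahlfors_upper) auto
      also have "\<dots> \<le> (c3 * 3 powr \<delta> i + cu) * r powr \<delta> i" by (intro mult_right_mono K) auto
      also have "r powr \<delta> i = r powr (\<delta> i * \<kappa>) * r powr (\<delta> i * (1 - \<kappa>))"
        by (simp add: powr_add[symmetric] algebra_simps)
      finally show ?thesis using False small
        by (simp only: min.absorb1 not_le not_less less_imp_le mult.assoc)
    qed
  qed
qed

text \<open>The factors on the left are, per coordinate, the normalising weight, the number of boxes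
  that meet a ball of radius \<open>r\<close>, and the mass of one piece as in
  \<open>piece_bound\<close>. On the right stands the Ahlfors size times the concentration visible
  at radius \<open>r\<close>.\<close>

lemma profile_identity:
  fixes r p e D :: real
  assumes "0 < r" "0 < p" "0 < e" "e < p"
  shows "(p/e) powr (D * (1 - \<kappa>)) * (max r p / p) powr D
      * (min r p powr (D * \<kappa>) * min (min r p) e powr (D * (1 - \<kappa>)))
     = r powr D * (p / max e (min r p)) powr (D * (1 - \<kappa>))"
proof -
  have split: "y powr D = y powr (D * \<kappa>) * y powr (D * (1 - \<kappa>))" for y :: real
    by (simp add: powr_add[symmetric] algebra_simps)
  consider "p \<le> r" | "e \<le> r" "r < p" | "r < e" by linarith
  thus ?thesis
  proof cases
    case 1
    hence "max r p = r" "min r p = p" "min p e = e" "max e p = p" using assms by auto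
    thus ?thesis using assms by (simp only: powr_divide less_imp_le split[of p]) (simp add: field_simps)
  next
    case 2
    hence "max r p = p" "min r p = r" "min r e = e" "max e r = r" using assms by auto
    thus ?thesis using assms 2 by (simp only: powr_divide less_imp_le split[of r]) (simp add: field_simps)
  next
    case 3
    hence "max r p = p" "min r p = r" "min r e = r" "max e r = e" using assms by auto
    thus ?thesis using assms 3 by (simp only: powr_divide less_imp_le split[of r]) (simp add: field_simps)
  qed
qed

text \<open>Per coordinate, the first factor comes from counting the boxes that meet a ball, the
  second from \<open>piece_bound\<close>.\<close>

definition upper_const :: real where
  "upper_const = (\<Prod>i<d. (cu * 3 powr \<delta> i / cl) * (c3 * 3 powr \<delta> i + cu))"

text \<open>Per coordinate, the cost of comparing a tripled box with the thin piece inside the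
  original one.\<close>

definition lower_const :: real where
  "lower_const = (\<Prod>i<d. cu * 3 powr \<delta> i / c2)"

lemma consts_pos: "0 < upper_const" "0 < lower_const"
  unfolding upper_const_def lower_const_def
  using cu_pos cl_pos c2_pos c3_pos by (auto intro!: prod_pos mult_pos_pos divide_pos_pos add_pos_pos)

text \<open>Up to constants, the mass of a box divided by the mass of its thin piece:
  \<open>p powr \<delta>\<close> over \<open>p powr (\<delta> * \<kappa>) * e powr (\<delta> * (1 -
  \<kappa>))\<close> in each coordinate.\<close>

definition level_weight :: "(nat \<Rightarrow> real) \<Rightarrow> (nat \<Rightarrow> real) \<Rightarrow> real" where
  "level_weight p e = (\<Prod>i<d. (p i / e i) powr (\<delta> i * (1 - \<kappa>)))"

text \<open>Upper bound: the number of disjoint boxes near the ball times the mass of one piece in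
  it. Lower bound: by maximality the tripled boxes cover the ubiquity set, and each is comparable to
  its weighted piece. The latter asks for \<open>8 * p i \<le> r\<close>: a piece whose tripled box
  meets the ball of radius \<open>r/2\<close> lies within \<open>r/2 + 4 * p i\<close> of the
  centre.\<close>

lemma level_set:
  assumes A: "A \<subseteq> J" and e_pos: "\<And>i. i < d \<Longrightarrow> 0 < e i" and e_p: "\<And>i. i < d \<Longrightarrow> e i < p i"
    and p_le: "\<And>i. i < d \<Longrightarrow> 3 * p i \<le> r0"
  obtains F where "openin P.mtopology F" "F \<in> sets PM"
    "F \<subseteq> (\<Union>\<alpha>\<in>A. PiE {..<d} (\<lambda>i. nb i (R \<alpha> i) (e i)))"
    "\<And>x r. x \<in> PX \<Longrightarrow> 0 < r \<Longrightarrow> 3 * r \<le> r0 \<Longrightarrow>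
       level_weight p e * measure PM (F \<inter> P.mball x r)
       \<le> upper_const * (\<Prod>i<d. r powr \<delta> i * (p i / max (e i) (min r (p i))) powr (\<delta> i * (1 - \<kappa>)))"
    "\<And>x r. x \<in> PX \<Longrightarrow> 0 < r \<Longrightarrow> (\<And>i. i < d \<Longrightarrow> 8 * p i \<le> r) \<Longrightarrow>
       measure PM (P.mball x (r/2) \<inter> (\<Union>\<alpha>\<in>A. PiE {..<d} (\<lambda>i. nb i (R \<alpha> i) (p i))))
       \<le> lower_const * (level_weight p e * measure PM (F \<inter> P.mball x r))"
proof -
  interpret PP: prob_space PM by (rule measure_box(2)) (rule sets.empty_sets)
  have p_pos: "0 < p i" if "i < d" for i using e_pos[OF that] e_p[OF that] by linarith
  have p_r0: "p i \<le> r0" if "i < d" for i using p_pos[OF that] p_le[OF that] by linarith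
  define S where "S = (\<Union>\<alpha>\<in>A. PiE {..<d} (R \<alpha>))"
  \<comment> \<open>A point may lie in the product sets of many indices; one is fixed so that its
    piece surrounds a single \<open>R \<alpha>\<close>.\<close>
  define al where "al x = (SOME \<alpha>. \<alpha> \<in> A \<and> x \<in> PiE {..<d} (R \<alpha>))" for x
  have al: "al x \<in> A \<and> x \<in> PiE {..<d} (R (al x))" if "x \<in> S" for x
  proof -
    have "\<exists>\<alpha>. \<alpha> \<in> A \<and> x \<in> PiE {..<d} (R \<alpha>)" using that by (auto simp: S_def)
    from someI_ex[OF this] show ?thesis unfolding al_def .
  qed
  have alJ: "al x \<in> J" if "x \<in> S" for x using al[OF that] A by blast
  have xR: "x i \<in> R (al x) i" if "x \<in> S" "i < d" for x i using al[OF that(1)] that(2) by auto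
  have xX: "x i \<in> Xs i" if "x \<in> S" "i < d" for x i using xR[OF that] R_sub alJ that by blast
  have S_PX: "S \<subseteq> PX"
    using A R_sub unfolding S_def by (intro UN_least PiE_mono) auto
  define box where "box t x = PiE {..<d} (\<lambda>i. mb i (x i) (t * p i))" for t :: real and x
  have box_sets: "box t x \<in> sets PM" for t x unfolding box_def by (intro sets_box mb_sets)
  have box_meas: "measure PM (box t x) = (\<Prod>i<d. measure (m i) (mb i (x i) (t * p i)))" for t x
    unfolding box_def by (intro measure_box mb_sets)
  define v where "v = (\<Prod>i<d. cl * p i powr \<delta> i)"
  have v_pos: "0 < v"
    unfolding v_def
  proof (rule prod_pos)
    fix i assume "i \<in> {..<d}"
    hence "0 < p i" using p_pos by simp
    thus "0 < cl * p i powr \<delta> i" using cl_pos by simp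
  qed
  have box_ge: "v \<le> measure PM (box 1 x)" if "x \<in> S" for x
    unfolding v_def box_meas using xX[OF that] p_pos p_r0 cl_pos
    by (intro prod_mono) (auto intro!: ahlfors_lower)
  \<comment> \<open>One coordinate, measured against its own side length, suffices to make boxes
    disjoint. The negation is closeness in all coordinates, which is what covering asks for.\<close>
  define sep where "sep x y \<longleftrightarrow> (\<exists>i<d. 2 * p i \<le> ds i (x i) (y i))" for x y
  have box_disj: "box 1 x \<inter> box 1 y = {}" if xy: "sep x y" for x y
  proof (rule ccontr)
    assume "box 1 x \<inter> box 1 y \<noteq> {}"
    then obtain z where z: "z \<in> box 1 x" "z \<in> box 1 y" by blast
    obtain i where i: "i < d" "2 * p i \<le> ds i (x i) (y i)" using xy by (auto simp: sep_def)
    have "z i \<in> mb i (x i) (p i)" "z i \<in> mb i (y i) (p i)" using z i by (auto simp: box_def)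
    hence "x i \<in> Xs i" "y i \<in> Xs i" "z i \<in> Xs i" "ds i (x i) (z i) < p i" "ds i (y i) (z i) < p i"
      using i by (auto simp: in_mb)
    thus False using coord_triangle[OF i(1), of "x i" "z i" "y i"] coord_commute[OF i(1), of "y i" "z i"] i(2)
      by linarith
  qed
  have disj_family: "disjoint_family_on (box 1) Z" if "pairwise sep Z" for Z
    using that box_disj by (auto simp: disjoint_family_on_def pairwise_def)
  have card: "card Z \<le> nat \<lfloor>1 / v\<rfloor>" if Z: "finite Z" "Z \<subseteq> S" "pairwise sep Z" for Z
  proof -
    have "real (card Z) * v \<le> measure PM (space PM)"
      using Z box_ge box_sets sets.sets_into_space[OF box_sets]
      by (intro card_times_le_measure[where P = "box 1"] disj_family) (auto simp: PP.finite_measure_axioms)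
    hence "real (card Z) \<le> 1 / v" using v_pos by (simp add: PP.prob_space field_simps)
    thus ?thesis by (rule le_nat_floor)
  qed
  obtain Z where Z: "finite Z" "Z \<subseteq> S" "pairwise sep Z" "\<And>x. x \<in> S \<Longrightarrow> x \<notin> Z \<Longrightarrow> \<exists>z\<in>Z. \<not> sep x z"
  proof (rule exists_maximal_pairwise_subset[of S sep, OF card])
    show "sep y x" if "sep x y" for x y using that coord_commute by (auto simp: sep_def)
  qed (assumption, assumption, assumption, rule that)
  have near: "\<exists>z\<in>Z. \<forall>i<d. ds i (x i) (z i) < 2 * p i" if x: "x \<in> S" for x
  proof (cases "x \<in> Z")
    case True
    have "ds i (x i) (x i) < 2 * p i" if "i < d" for i
      using Metric_space.mdist_zero[OF metric[OF that] xX[OF x that]] p_pos[OF that] by simp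
    thus ?thesis using True by blast
  next
    case False
    thus ?thesis using Z(4)[OF x] by (force simp: sep_def not_le)
  qed
  define Q where "Q z = PiE {..<d} (\<lambda>i. mb i (z i) (p i) \<inter> nb i (R (al z) i) (e i))" for z
  have Q_box: "Q z \<subseteq> box 1 z" for z unfolding Q_def box_def by (intro PiE_mono) auto
  have Q_open: "openin P.mtopology (Q z)" if "z \<in> S" for z
    unfolding Q_def using alJ[OF that] R_sub by (intro openin_box openin_Int open_mb open_nb) auto
  have Q_sets: "Q z \<in> sets PM" if "z \<in> S" for z
    unfolding Q_def using alJ[OF that] by (intro sets_box mb_Int_nb_sets) auto
  \<comment> \<open>A lower mass bound common to all pieces; it applies because each centre lies on
    the resonant set of its chosen index.\<close>
  define q where "q = (\<Prod>i<d. c2 * p i powr (\<delta> i * \<kappa>) * e i powr (\<delta> i * (1 - \<kappa>)))"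
  have Q_ge: "q \<le> measure PM (Q z)" if z: "z \<in> S" for z
  proof -
    have "measure PM (Q z) = (\<Prod>i<d. measure (m i) (mb i (z i) (p i) \<inter> nb i (R (al z) i) (e i)))"
      unfolding Q_def using alJ[OF z] by (intro measure_box mb_Int_nb_sets) auto
    thus ?thesis
      unfolding q_def using alJ[OF z] xR[OF z] c2_pos e_pos e_p p_r0
      by (auto intro!: prod_mono scaling_lower)
  qed
  define F where "F = (\<Union>z\<in>Z. Q z)"
  have F_sets: "F \<in> sets PM" unfolding F_def using Q_sets Z by (intro sets.finite_UN) auto
  show ?thesis
  proof (rule that[of F])
    show "F \<in> sets PM" by (rule F_sets)
    show "openin P.mtopology F" unfolding F_def using Q_open Z(2) by (intro openin_Union) auto

    show "F \<subseteq> (\<Union>\<alpha>\<in>A. PiE {..<d} (\<lambda>i. nb i (R \<alpha> i) (e i)))"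
    proof
      fix x assume "x \<in> F"
      then obtain z where z: "z \<in> Z" "x \<in> Q z" by (auto simp: F_def)
      have "x \<in> PiE {..<d} (\<lambda>i. nb i (R (al z) i) (e i))" using z(2) unfolding Q_def by (auto simp: PiE_iff)
      thus "x \<in> (\<Union>\<alpha>\<in>A. PiE {..<d} (\<lambda>i. nb i (R \<alpha> i) (e i)))" using al[of z] z(1) Z(2) by blast
    qed
  next
    fix x and r :: real assume x: "x \<in> PX" and r: "0 < r" "3 * r \<le> r0"
    have xi: "x i \<in> Xs i" if "i < d" for i using x that by auto
    define I where "I = {z\<in>Z. Q z \<inter> P.mball x r \<noteq> {}}"
    have I: "finite I" "I \<subseteq> Z" "I \<subseteq> S" "pairwise sep I"
      using Z by (auto simp: I_def pairwise_def)
    \<comment> \<open>A unit box that meets the ball stays within \<open>r + p i + p i\<close> of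
      \<open>x\<close> in coordinate \<open>i\<close>.\<close>
    define B where "B = PiE {..<d} (\<lambda>i. mb i (x i) (3 * max r (p i)))"
    have "real (card I) * v \<le> measure PM B"
    proof (rule card_times_le_measure[where P = "box 1"])
      fix z assume z: "z \<in> I"
      obtain y where y: "y \<in> Q z" "y \<in> P.mball x r" using z unfolding I_def by blast
      have zS: "z \<in> S" using z I by blast
      have "box 1 z \<subseteq> B"
        unfolding box_def B_def
      proof (intro PiE_mono subsetI)
        fix i u assume "i \<in> {..<d}" and u: "u \<in> mb i (z i) (1 * p i)"
        hence i: "i < d" by simp
        have "y i \<in> mb i (z i) (p i)" using y(1) i by (auto simp: Q_def PiE_iff)
        moreover have "y i \<in> mb i (x i) r" using y(2) i unfolding mball_product[OF x] by (auto simp: PiE_iff)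
        ultimately have a: "y i \<in> Xs i" "z i \<in> Xs i" "ds i (z i) (y i) < p i" "ds i (x i) (y i) < r" "u \<in> Xs i" "ds i (z i) u < p i"
          using i u by (auto simp: in_mb)
        have "ds i (x i) u \<le> ds i (x i) (y i) + ds i (y i) u" "ds i (y i) u \<le> ds i (y i) (z i) + ds i (z i) u"
          using a i xi by (auto intro: coord_triangle)
        hence "ds i (x i) u < 3 * max r (p i)" using a coord_commute[OF i, of "y i" "z i"] by linarith
        thus "u \<in> mb i (x i) (3 * max r (p i))" using i a xi by (simp add: in_mb)
      qed
      thus "box 1 z \<in> sets PM \<and> box 1 z \<subseteq> B \<and> v \<le> measure PM (box 1 z)"
        using box_ge[OF zS] box_sets by blast
    qed (use I PP.finite_measure_axioms disj_family in \<open>auto simp: B_def intro!: sets_box mb_sets\<close>)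
    also have "measure PM B = (\<Prod>i<d. measure (m i) (mb i (x i) (3 * max r (p i))))"
      unfolding B_def by (intro measure_box mb_sets)
    also have "\<dots> \<le> (\<Prod>i<d. cu * (3 * max r (p i)) powr \<delta> i)"
      using r p_le p_pos xi by (intro prod_mono) (auto intro!: ahlfors_upper simp: max_def)
    also have "\<dots> = (\<Prod>i<d. cu * 3 powr \<delta> i / cl * (max r (p i) / p i) powr \<delta> i) * v"
      unfolding v_def prod.distrib[symmetric]
    proof (intro prod.cong refl)
      fix i assume "i \<in> {..<d}"
      hence "0 < p i" using p_pos by simp
      thus "cu * (3 * max r (p i)) powr \<delta> i = cu * 3 powr \<delta> i / cl * (max r (p i) / p i) powr \<delta> i * (cl * p i powr \<delta> i)"
        using cl_pos r by (simp add: powr_mult powr_divide)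
    qed
    finally have cardI: "real (card I) \<le> (\<Prod>i<d. cu * 3 powr \<delta> i / cl * (max r (p i) / p i) powr \<delta> i)"
      using v_pos by simp
    define w where "w i = (c3 * 3 powr \<delta> i + cu) * (min r (p i) powr (\<delta> i * \<kappa>) * min (min r (p i)) (e i) powr (\<delta> i * (1 - \<kappa>)))" for i
    have w_nn: "0 \<le> w i" for i unfolding w_def using c3_pos cu_pos by auto
    have piece: "measure PM (Q z \<inter> P.mball x r) \<le> (\<Prod>i<d. w i)" if z: "z \<in> S" for z
    proof -
      have "Q z \<inter> P.mball x r = PiE {..<d} (\<lambda>i. mb i (z i) (p i) \<inter> nb i (R (al z) i) (e i) \<inter> mb i (x i) r)"
        unfolding Q_def mball_product[OF x] by (rule PiE_Int)
      also have "measure PM \<dots> = (\<Prod>i<d. measure (m i) (mb i (z i) (p i) \<inter> nb i (R (al z) i) (e i) \<inter> mb i (x i) r))"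
        using alJ[OF z] by (intro measure_box sets.Int mb_sets nb_sets) auto
      also have "\<dots> \<le> (\<Prod>i<d. w i)"
        unfolding w_def mult.assoc[symmetric]
        using alJ[OF z] xR[OF z] xi e_pos e_p p_r0 r by (intro prod_mono conjI piece_bound) auto
      finally show ?thesis .
    qed
    have "measure PM (F \<inter> P.mball x r) \<le> measure PM (\<Union>z\<in>I. Q z \<inter> P.mball x r)"
      using I Q_sets sets_mball_product[OF x]
      by (intro PP.finite_measure_mono sets.finite_UN) (auto simp: F_def I_def)
    also have "\<dots> \<le> (\<Sum>z\<in>I. measure PM (Q z \<inter> P.mball x r))"
      using I Q_sets sets_mball_product[OF x] by (intro PP.finite_measure_subadditive_finite) auto
    also have "\<dots> \<le> real (card I) * (\<Prod>i<d. w i)"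
      using I piece by (intro sum_bounded_above) auto
    also have "\<dots> \<le> (\<Prod>i<d. cu * 3 powr \<delta> i / cl * (max r (p i) / p i) powr \<delta> i) * (\<Prod>i<d. w i)"
      using w_nn by (intro mult_right_mono cardI prod_nonneg) auto
    finally have le: "measure PM (F \<inter> P.mball x r) \<le> \<dots>" .
    have "0 \<le> level_weight p e" unfolding level_weight_def by (intro prod_nonneg) auto
    from mult_left_mono[OF le this]
    have "level_weight p e * measure PM (F \<inter> P.mball x r)
       \<le> (\<Prod>i<d. (p i / e i) powr (\<delta> i * (1 - \<kappa>)) * (cu * 3 powr \<delta> i / cl * (max r (p i) / p i) powr \<delta> i * w i))"
      by (simp only: level_weight_def prod.distrib)
    also have "\<dots> = (\<Prod>i<d. (cu * 3 powr \<delta> i / cl * (c3 * 3 powr \<delta> i + cu)) * 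
         (r powr \<delta> i * (p i / max (e i) (min r (p i))) powr (\<delta> i * (1 - \<kappa>))))"
    proof (intro prod.cong refl)
      fix i assume "i \<in> {..<d}"
      hence i: "i < d" by simp
      show "(p i / e i) powr (\<delta> i * (1 - \<kappa>)) * (cu * 3 powr \<delta> i / cl * (max r (p i) / p i) powr \<delta> i * w i)
         = (cu * 3 powr \<delta> i / cl * (c3 * 3 powr \<delta> i + cu)) * 
         (r powr \<delta> i * (p i / max (e i) (min r (p i))) powr (\<delta> i * (1 - \<kappa>)))"
        unfolding profile_identity[OF r(1) p_pos[OF i] e_pos[OF i] e_p[OF i], symmetric] w_def
        by (simp only: mult_ac)
    qed
    also have "\<dots> = upper_const * (\<Prod>i<d. r powr \<delta> i * (p i / max (e i) (min r (p i))) powr (\<delta> i * (1 - \<kappa>)))"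
      by (simp only: upper_const_def prod.distrib)
    finally show "level_weight p e * measure PM (F \<inter> P.mball x r)
       \<le> upper_const * (\<Prod>i<d. r powr \<delta> i * (p i / max (e i) (min r (p i))) powr (\<delta> i * (1 - \<kappa>)))" .
  next
    fix x and r :: real assume x: "x \<in> PX" and r: "0 < r" and pr: "\<And>i. i < d \<Longrightarrow> 8 * p i \<le> r"
    have xi: "x i \<in> Xs i" if "i < d" for i using x that by auto
    define I where "I = {z\<in>Z. box 3 z \<inter> P.mball x (r/2) \<noteq> {}}"
    have I: "finite I" "I \<subseteq> Z" "I \<subseteq> S" "pairwise sep I"
      using Z by (auto simp: I_def pairwise_def)
    \<comment> \<open>The factor 3 adds \<open>p i\<close>, from \<open>y\<close> to a point
      \<open>w\<close> of the resonant set, and \<open>2 * p i\<close>, from \<open>w\<close> to a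
      chosen centre.\<close>
    have cov: "P.mball x (r/2) \<inter> (\<Union>\<alpha>\<in>A. PiE {..<d} (\<lambda>i. nb i (R \<alpha> i) (p i))) \<subseteq> (\<Union>z\<in>I. box 3 z)"
    proof
      fix y assume y: "y \<in> P.mball x (r/2) \<inter> (\<Union>\<alpha>\<in>A. PiE {..<d} (\<lambda>i. nb i (R \<alpha> i) (p i)))"
      then obtain \<alpha> where \<alpha>: "\<alpha> \<in> A" "y \<in> PiE {..<d} (\<lambda>i. nb i (R \<alpha> i) (p i))" by blast
      have "\<exists>w. w \<in> R \<alpha> i \<and> ds i (y i) w < p i" if "i < d" for i
        using \<alpha>(2) that by (auto simp: PiE_iff nbhd_def)
      then obtain w where w: "\<And>i. i < d \<Longrightarrow> w i \<in> R \<alpha> i" "\<And>i. i < d \<Longrightarrow> ds i (y i) (w i) < p i" by metis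
      have "restrict w {..<d} \<in> S" using w(1) \<alpha>(1) unfolding S_def by auto
      from near[OF this] obtain z where z: "z \<in> Z" "\<And>i. i < d \<Longrightarrow> ds i (w i) (z i) < 2 * p i" by auto
      have "y \<in> box 3 z"
        unfolding box_def PiE_iff
      proof (intro conjI ballI)
        show "y \<in> extensional {..<d}" using \<alpha>(2) by (simp add: PiE_iff)
        fix i assume "i \<in> {..<d}"
        hence i: "i < d" by simp
        have a: "y i \<in> Xs i" "w i \<in> Xs i" "z i \<in> Xs i"
          using \<alpha>(2) i w(1)[OF i] R_sub[of \<alpha> i] \<alpha>(1) A xX[of z i] z(1) Z(2) by (auto simp: PiE_iff nbhd_def)
        have "ds i (z i) (y i) \<le> ds i (z i) (w i) + ds i (w i) (y i)" using a i by (intro coord_triangle)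
        hence "ds i (z i) (y i) < 3 * p i"
          using w(2)[OF i] z(2)[OF i] coord_commute[OF i, of "z i" "w i"] coord_commute[OF i, of "y i" "w i"] by linarith
        thus "y i \<in> mb i (z i) (3 * p i)" using a i by (simp add: in_mb)
      qed
      moreover from this have "z \<in> I" using y z(1) unfolding I_def by blast
      ultimately show "y \<in> (\<Union>z\<in>I. box 3 z)" by blast
    qed
    have Q_in: "Q z \<subseteq> F \<inter> P.mball x r" if z: "z \<in> I" for z
    proof
      fix u assume u: "u \<in> Q z"
      obtain y where y: "y \<in> box 3 z" "y \<in> P.mball x (r/2)" using z unfolding I_def by blast
      have "ds i (x i) (u i) < r" if i: "i < d" for i
      proof -
        have "y i \<in> mb i (z i) (3 * p i)" using y(1) i by (auto simp: box_def PiE_iff)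
        moreover have "y i \<in> mb i (x i) (r/2)" using y(2) i unfolding mball_product[OF x] by (auto simp: PiE_iff)
        moreover have "u i \<in> mb i (z i) (p i)" using u i by (auto simp: Q_def PiE_iff)
        ultimately have a: "y i \<in> Xs i" "z i \<in> Xs i" "u i \<in> Xs i" "ds i (z i) (y i) < 3 * p i"
           "ds i (x i) (y i) < r/2" "ds i (z i) (u i) < p i"
          using i by (auto simp: in_mb)
        have "ds i (x i) (u i) \<le> ds i (x i) (y i) + ds i (y i) (u i)" "ds i (y i) (u i) \<le> ds i (y i) (z i) + ds i (z i) (u i)"
          using a i xi by (auto intro: coord_triangle)
        thus ?thesis using a coord_commute[OF i, of "y i" "z i"] pr[OF i] by linarith
      qed
      moreover have "u \<in> PX" using u Q_sets[of z] sets.sets_into_space[of "Q z" PM] z I(3) by (auto simp: space_PM)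
      ultimately have "u \<in> P.mball x r" using x by (simp add: prod_dist_less)
      thus "u \<in> F \<inter> P.mball x r" using u z I(2) by (auto simp: F_def)
    qed
    have cardI: "real (card I) * q \<le> measure PM (F \<inter> P.mball x r)"
    proof (rule card_times_le_measure[OF PP.finite_measure_axioms I(1)])
      show "disjoint_family_on Q I"
        using disj_family[OF I(4)] Q_box unfolding disjoint_family_on_def by blast
      show "Q z \<in> sets PM \<and> Q z \<subseteq> F \<inter> P.mball x r \<and> q \<le> measure PM (Q z)" if "z \<in> I" for z
        using that I(3) Q_sets Q_in Q_ge by blast
      show "F \<inter> P.mball x r \<in> sets PM" using F_sets sets_mball_product[OF x] by blast
    qed
    have box3: "measure PM (box 3 z) \<le> lower_const * (level_weight p e * q)" if z: "z \<in> S" for z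
    proof -
      have "measure PM (box 3 z) \<le> (\<Prod>i<d. cu * (3 * p i) powr \<delta> i)"
        unfolding box_meas using xX[OF z] p_pos p_le by (intro prod_mono) (auto intro!: ahlfors_upper)
      also have "\<dots> = (\<Prod>i<d. cu * 3 powr \<delta> i / c2 * ((p i / e i) powr (\<delta> i * (1 - \<kappa>)) * (c2 * p i powr (\<delta> i * \<kappa>) * e i powr (\<delta> i * (1 - \<kappa>)))))"
      proof (intro prod.cong refl)
        fix i assume "i \<in> {..<d}"
        hence "0 < p i" "0 < e i" using p_pos e_pos by auto
        moreover have "p i powr \<delta> i = p i powr (\<delta> i * \<kappa>) * p i powr (\<delta> i * (1 - \<kappa>))"
          by (simp add: powr_add[symmetric] algebra_simps)
        ultimately show "cu * (3 * p i) powr \<delta> i = cu * 3 powr \<delta> i / c2 * ((p i / e i) powr (\<delta> i * (1 - \<kappa>)) * (c2 * p i powr (\<delta> i * \<kappa>) * e i powr (\<delta> i * (1 - \<kappa>))))"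
          using c2_pos by (simp add: powr_mult powr_divide)
      qed
      also have "\<dots> = lower_const * (level_weight p e * q)"
        by (simp only: lower_const_def level_weight_def q_def prod.distrib)
      finally show ?thesis .
    qed
    have "measure PM (P.mball x (r/2) \<inter> (\<Union>\<alpha>\<in>A. PiE {..<d} (\<lambda>i. nb i (R \<alpha> i) (p i)))) \<le> measure PM (\<Union>z\<in>I. box 3 z)"
      using cov I box_sets by (intro PP.finite_measure_mono sets.finite_UN) auto
    also have "\<dots> \<le> (\<Sum>z\<in>I. measure PM (box 3 z))"
      using I box_sets by (intro PP.finite_measure_subadditive_finite) auto
    also have "\<dots> \<le> real (card I) * (lower_const * (level_weight p e * q))"
      using I box3 by (intro sum_bounded_above) auto
    also have "\<dots> = lower_const * (level_weight p e * (real (card I) * q))" by simp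
    also have "\<dots> \<le> lower_const * (level_weight p e * measure PM (F \<inter> P.mball x r))"
      using consts_pos cardI by (intro mult_left_mono) (auto simp: level_weight_def intro!: prod_nonneg)
    finally show "measure PM (P.mball x (r/2) \<inter> (\<Union>\<alpha>\<in>A. PiE {..<d} (\<lambda>i. nb i (R \<alpha> i) (p i))))
       \<le> lower_const * (level_weight p e * measure PM (F \<inter> P.mball x r))" .
  qed
qed

end

section \<open>The dimensional number as a minimum over all scales\<close>

definition clip :: "real \<Rightarrow> real \<Rightarrow> real \<Rightarrow> real" where
  "clip a t A = min t (max 0 (A - a))"

definition dim_profile :: "nat \<Rightarrow> (nat \<Rightarrow> real) \<Rightarrow> real \<Rightarrow> (nat \<Rightarrow> real) \<Rightarrow> (nat \<Rightarrow> real) \<Rightarrow> real \<Rightarrow> real" where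
  "dim_profile n \<delta> \<kappa> a t A = (\<Sum>k<n. \<delta> k * (1 - (1 - \<kappa>) * clip (a k) (t k) A / A))"

definition breakpoints :: "nat \<Rightarrow> (nat \<Rightarrow> real) \<Rightarrow> (nat \<Rightarrow> real) \<Rightarrow> real set" where
  "breakpoints n a t = (\<lambda>i. a i) ` {..<n} \<union> (\<lambda>i. a i + t i) ` {..<n}"

text \<open>\<open>clip\<close> equals 0 on K1, \<open>t k\<close> on K2 and \<open>A - a k\<close>
  on K3. In the last case \<open>1 - (1 - \<kappa>) * (A - a k) / A\<close> becomes
  \<open>\<kappa> + (1 - \<kappa>) * a k / A\<close>, the source of both K3 sums.\<close>

lemma dim_number_eq_Min_profile:
  assumes a: "\<And>k. k < n \<Longrightarrow> 0 < a k" and t: "\<And>k. k < n \<Longrightarrow> 0 \<le> t k"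
  shows "dim_number n \<delta> \<kappa> a t = Min (dim_profile n \<delta> \<kappa> a t ` breakpoints n a t)"
proof -
  have "(let K1 = {k\<in>{..<n}. a k \<ge> A}; K2 = {k\<in>{..<n}. a k + t k \<le> A} - K1; K3 = {..<n} - (K1 \<union> K2)
         in (\<Sum>k\<in>K1. \<delta> k) + (\<Sum>k\<in>K2. \<delta> k) + \<kappa> * (\<Sum>k\<in>K3. \<delta> k)
             + (1 - \<kappa>) * ((\<Sum>k\<in>K3. a k * \<delta> k) - (\<Sum>k\<in>K2. t k * \<delta> k)) / A) = dim_profile n \<delta> \<kappa> a t A"
    if A: "A \<in> breakpoints n a t" for A
  proof -
    have A_pos: "0 < A" using A a t by (force simp: breakpoints_def intro: add_pos_nonneg)
    define K1 where "K1 = {k\<in>{..<n}. a k \<ge> A}"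
    define K2 where "K2 = {k\<in>{..<n}. a k + t k \<le> A} - K1"
    define K3 where "K3 = {..<n} - (K1 \<union> K2)"
    let ?f = "\<lambda>k. \<delta> k * (1 - (1 - \<kappa>) * clip (a k) (t k) A / A)"
    have fin: "finite K1" "finite K2" "finite K3" by (auto simp: K1_def K2_def K3_def)
    have "{..<n} = K1 \<union> K2 \<union> K3" by (auto simp: K1_def K2_def K3_def)
    hence "dim_profile n \<delta> \<kappa> a t A = sum ?f (K1 \<union> K2 \<union> K3)" by (simp add: dim_profile_def)
    also have "\<dots> = sum ?f K1 + sum ?f K2 + sum ?f K3"
    proof -
      have "(K1 \<union> K2) \<inter> K3 = {}" "K1 \<inter> K2 = {}" by (auto simp: K2_def K3_def)
      thus ?thesis using fin by (simp add: sum.union_disjoint)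
    qed
    also have "sum ?f K1 = (\<Sum>k\<in>K1. \<delta> k)"
    proof (intro sum.cong refl)
      fix k assume "k \<in> K1"
      hence "clip (a k) (t k) A = 0" using t[of k] by (auto simp: K1_def clip_def)
      thus "?f k = \<delta> k" by simp
    qed
    also have "sum ?f K2 = (\<Sum>k\<in>K2. \<delta> k - (1 - \<kappa>) / A * (t k * \<delta> k))"
    proof (intro sum.cong refl)
      fix k assume "k \<in> K2"
      hence "clip (a k) (t k) A = t k" using t[of k] by (auto simp: K2_def K1_def clip_def)
      thus "?f k = \<delta> k - (1 - \<kappa>) / A * (t k * \<delta> k)" by (simp add: algebra_simps)
    qed
    also have "sum ?f K3 = (\<Sum>k\<in>K3. \<kappa> * \<delta> k + (1 - \<kappa>) / A * (a k * \<delta> k))"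
    proof (intro sum.cong refl)
      fix k assume "k \<in> K3"
      hence clip: "clip (a k) (t k) A = A - a k" using t[of k] by (auto simp: K3_def K2_def K1_def clip_def)
      show "?f k = \<kappa> * \<delta> k + (1 - \<kappa>) / A * (a k * \<delta> k)" unfolding clip using A_pos by (simp add: field_simps)
    qed
    finally show ?thesis
      unfolding Let_def K1_def[symmetric] K2_def[symmetric] K3_def[symmetric]
      by (simp only: sum.distrib sum_subtractf sum_distrib_left[symmetric])
         (use A_pos in \<open>simp add: field_simps\<close>)
  qed
  thus ?thesis unfolding dim_number_def breakpoints_def[symmetric]
    by (intro arg_cong[of _ _ Min] image_cong refl)
qed

text \<open>The only kinks of \<open>clip a t\<close> are at \<open>a\<close> and
  \<open>a + t\<close>, and the last two hypotheses keep both out of the open interval.\<close>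

lemma clip_affine:
  assumes "A1 \<le> A" "A \<le> A2" "0 \<le> t" "a \<le> A1 \<or> A2 \<le> a" "a + t \<le> A1 \<or> A2 \<le> a + t"
  shows "(A2 - A1) * clip a t A = (A2 - A) * clip a t A1 + (A - A1) * clip a t A2"
proof -
  consider "A2 \<le> a" | "a + t \<le> A1" | "a \<le> A1" "A2 \<le> a + t" using assms by linarith
  thus ?thesis
  proof cases
    case 1
    hence "clip a t A = 0" "clip a t A1 = 0" "clip a t A2 = 0" using assms by (auto simp: clip_def)
    thus ?thesis by simp
  next
    case 2
    hence "clip a t A = t" "clip a t A1 = t" "clip a t A2 = t" using assms by (auto simp: clip_def)
    thus ?thesis by (simp add: algebra_simps)
  next
    case 3
    hence clip: "clip a t A = A - a" "clip a t A1 = A1 - a" "clip a t A2 = A2 - a"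
      using assms by (auto simp: clip_def)
    show ?thesis unfolding clip by (simp add: algebra_simps)
  qed
qed

context
  fixes n :: nat and \<delta> a t :: "nat \<Rightarrow> real" and \<kappa> :: real
  assumes n: "1 \<le> n" and \<delta>: "\<And>k. k < n \<Longrightarrow> 0 < \<delta> k" and a: "\<And>k. k < n \<Longrightarrow> 0 < a k"
    and t: "\<And>k. k < n \<Longrightarrow> 0 \<le> t k" and \<kappa>: "0 \<le> \<kappa>" "\<kappa> < 1"
begin

lemma breakpoints_finite: "finite (breakpoints n a t)" "breakpoints n a t \<noteq> {}"
  using n by (auto simp: breakpoints_def lessThan_empty_iff)

lemma breakpoints_pos: "A \<in> breakpoints n a t \<Longrightarrow> 0 < A"
  using a t by (force simp: breakpoints_def intro: add_pos_nonneg)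

lemma dim_number_le_sum: "dim_number n \<delta> \<kappa> a t \<le> (\<Sum>k<n. \<delta> k)"
proof -
  have A: "a 0 \<in> breakpoints n a t" using n by (auto simp: breakpoints_def)
  hence "dim_number n \<delta> \<kappa> a t \<le> dim_profile n \<delta> \<kappa> a t (a 0)"
    using breakpoints_finite a t by (subst dim_number_eq_Min_profile) auto
  also have "\<dots> \<le> (\<Sum>k<n. \<delta> k * 1)"
    unfolding dim_profile_def
  proof (intro sum_mono mult_left_mono)
    fix k assume "k \<in> {..<n}"
    hence "0 \<le> clip (a k) (t k) (a 0)" "0 < a 0" "0 \<le> \<delta> k" using t[of k] a[of 0] n \<delta>[of k] by (auto simp: clip_def)
    thus "1 - (1 - \<kappa>) * clip (a k) (t k) (a 0) / a 0 \<le> 1" "0 \<le> \<delta> k" using \<kappa> by auto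
  qed
  finally show ?thesis by simp
qed

text \<open>The minimum over the breakpoints is the minimum over all scales, because between
  consecutive breakpoints \<open>A * dim_profile A\<close> is affine.\<close>

lemma dim_number_le_profile:
  assumes A: "0 < A"
  shows "dim_number n \<delta> \<kappa> a t \<le> dim_profile n \<delta> \<kappa> a t A"
proof -
  define s where "s = dim_number n \<delta> \<kappa> a t"
  define D where "D = (\<Sum>k<n. \<delta> k)"
  \<comment> \<open>\<open>h\<close> clears the denominator in \<open>dim_profile - s\<close>. It is
    affine between breakpoints and vanishes at 0, so 0 can act as an additional left
    endpoint.\<close>
  define h where "h B = (D - s) * B - (\<Sum>k<n. \<delta> k * (1 - \<kappa>) * clip (a k) (t k) B)" for B
  have h_eq: "h B = B * (dim_profile n \<delta> \<kappa> a t B - s)" if "0 < B" for B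
  proof -
    have "B * dim_profile n \<delta> \<kappa> a t B = (\<Sum>k<n. \<delta> k * B - \<delta> k * (1 - \<kappa>) * clip (a k) (t k) B)"
      unfolding dim_profile_def sum_distrib_left using that by (intro sum.cong) (auto simp: field_simps)
    also have "\<dots> = D * B - (\<Sum>k<n. \<delta> k * (1 - \<kappa>) * clip (a k) (t k) B)"
      by (simp add: sum_subtractf D_def sum_distrib_right)
    finally show ?thesis by (simp add: h_def algebra_simps)
  qed
  have h_break: "0 \<le> h B" if "B \<in> insert 0 (breakpoints n a t)" for B
  proof (cases "B = 0")
    case True
    have "clip (a k) (t k) 0 = 0" if "k < n" for k using a[OF that] t[OF that] by (auto simp: clip_def)
    thus ?thesis using True by (simp add: h_def)
  next
    case False
    hence B: "B \<in> breakpoints n a t" using that by simp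
    have "s \<le> dim_profile n \<delta> \<kappa> a t B"
      unfolding s_def using breakpoints_finite B a t by (subst dim_number_eq_Min_profile) auto
    thus ?thesis using breakpoints_pos[OF B] by (simp add: h_eq)
  qed
  have sD: "s \<le> D" unfolding s_def D_def by (rule dim_number_le_sum)
  define A1 where "A1 = Max {b \<in> insert 0 (breakpoints n a t). b \<le> A}"
  have "A1 \<in> {b \<in> insert 0 (breakpoints n a t). b \<le> A}"
    unfolding A1_def using breakpoints_finite A by (intro Max_in) auto
  hence A1: "A1 \<in> insert 0 (breakpoints n a t)" "A1 \<le> A" by auto
  have A1_max: "b \<le> A1" if "b \<in> breakpoints n a t" "b \<le> A" for b
    unfolding A1_def using breakpoints_finite that by (intro Max_ge) auto
  have mem: "a k \<in> breakpoints n a t" "a k + t k \<in> breakpoints n a t" if "k < n" for k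
    using that by (auto simp: breakpoints_def)
  have "0 \<le> h A"
  proof (cases "\<exists>b\<in>breakpoints n a t. A < b")
    case True
    define A2 where "A2 = Min {b \<in> breakpoints n a t. A < b}"
    have "A2 \<in> {b \<in> breakpoints n a t. A < b}"
      unfolding A2_def using breakpoints_finite True by (intro Min_in) auto
    hence A2: "A2 \<in> breakpoints n a t" "A < A2" by auto
    have A2_min: "A2 \<le> b" if "b \<in> breakpoints n a t" "A < b" for b
      unfolding A2_def using breakpoints_finite that by (intro Min_le) auto
    have clip: "(A2 - A1) * clip (a k) (t k) A = (A2 - A) * clip (a k) (t k) A1 + (A - A1) * clip (a k) (t k) A2"
      if k: "k < n" for k
      using A1(2) A2(2) t[OF k] A1_max[OF mem(1)[OF k]] A1_max[OF mem(2)[OF k]]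
        A2_min[OF mem(1)[OF k]] A2_min[OF mem(2)[OF k]]
      by (intro clip_affine) linarith+
    have "(A2 - A1) * (\<Sum>k<n. \<delta> k * (1 - \<kappa>) * clip (a k) (t k) A)
        = (\<Sum>k<n. \<delta> k * (1 - \<kappa>) * ((A2 - A1) * clip (a k) (t k) A))"
      by (simp add: sum_distrib_left mult_ac)
    also have "\<dots> = (\<Sum>k<n. (A2 - A) * (\<delta> k * (1 - \<kappa>) * clip (a k) (t k) A1) + (A - A1) * (\<delta> k * (1 - \<kappa>) * clip (a k) (t k) A2))"
    proof (intro sum.cong refl)
      fix k assume "k \<in> {..<n}"
      hence k: "k < n" by simp
      show "\<delta> k * (1 - \<kappa>) * ((A2 - A1) * clip (a k) (t k) A)
          = (A2 - A) * (\<delta> k * (1 - \<kappa>) * clip (a k) (t k) A1) + (A - A1) * (\<delta> k * (1 - \<kappa>) * clip (a k) (t k) A2)"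
        unfolding clip[OF k] by (simp add: algebra_simps)
    qed
    also have "\<dots> = (A2 - A) * (\<Sum>k<n. \<delta> k * (1 - \<kappa>) * clip (a k) (t k) A1) + (A - A1) * (\<Sum>k<n. \<delta> k * (1 - \<kappa>) * clip (a k) (t k) A2)"
      by (simp only: sum.distrib sum_distrib_left)
    finally have "(A2 - A1) * h A = (A2 - A) * h A1 + (A - A1) * h A2"
      unfolding h_def by (simp add: algebra_simps)
    also have "0 \<le> \<dots>"
      using A1(2) A2(2) h_break[OF A1(1)] h_break[of A2] A2(1) by (intro add_nonneg_nonneg mult_nonneg_nonneg) auto
    finally show ?thesis using A1(2) A2(2) by (simp add: zero_le_mult_iff)
  next
    case False
    \<comment> \<open>Beyond the last breakpoint \<open>clip\<close> is constant and
      \<open>h\<close> has slope \<open>D - s\<close>, nonnegative by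
      \<open>dim_number_le_sum\<close>.\<close>
    hence all: "b \<le> A1" if "b \<in> breakpoints n a t" for b using A1_max that by force
    have "clip (a k) (t k) A = clip (a k) (t k) A1" if k: "k < n" for k
      using all[OF mem(2)[OF k]] A1(2) t[OF k] by (auto simp: clip_def)
    hence "h A = h A1 + (D - s) * (A - A1)" by (simp add: h_def algebra_simps)
    thus ?thesis using h_break[OF A1(1)] sD A1(2) by simp
  qed
  thus ?thesis using A by (simp add: h_eq s_def zero_le_mult_iff)
qed

text \<open>Raising \<open>t\<close> by \<open>\<epsilon>\<close> raises \<open>clip\<close> by at
  most \<open>\<epsilon>\<close>, and breakpoints are at least the smallest \<open>a k\<close>. The
  perturbed breakpoints differ from the old ones, which is why the comparison with the profile at
  arbitrary scales enters.\<close>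

lemma dim_number_perturb:
  assumes "\<sigma> < dim_number n \<delta> \<kappa> a t"
  obtains \<epsilon> where "0 < \<epsilon>" "\<sigma> < dim_number n \<delta> \<kappa> a (\<lambda>i. t i + \<epsilon>)"
proof -
  define b where "b = Min (a ` {..<n})"
  have ne: "{..<n} \<noteq> {}" using n by (auto simp: lessThan_empty_iff)
  have b: "0 < b" "\<And>k. k < n \<Longrightarrow> b \<le> a k" using a ne by (auto simp: b_def)
  define D where "D = (\<Sum>k<n. \<delta> k)"
  have D: "0 < D" unfolding D_def using \<delta> ne by (intro sum_pos) auto
  \<comment> \<open>Chosen so that the loss \<open>D * (\<epsilon> / b)\<close> is half the
    available gap.\<close>
  define \<epsilon> where "\<epsilon> = (dim_number n \<delta> \<kappa> a t - \<sigma>) * b / (2 * D)"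
  have \<epsilon>: "0 < \<epsilon>" using assms b D by (simp add: \<epsilon>_def)
  let ?t = "\<lambda>i. t i + \<epsilon>"
  have t': "0 \<le> ?t k" if "k < n" for k using t[OF that] \<epsilon> by simp
  have "\<sigma> < dim_profile n \<delta> \<kappa> a ?t A" if A: "A \<in> breakpoints n a ?t" for A
  proof -
    have bA: "b \<le> A" using A b(2) t' by (force simp: breakpoints_def intro: add_increasing2)
    hence A_pos: "0 < A" using b(1) by linarith
    have "dim_profile n \<delta> \<kappa> a t A - D * (\<epsilon> / b) = (\<Sum>k<n. \<delta> k * (1 - (1 - \<kappa>) * clip (a k) (t k) A / A - \<epsilon> / b))"
      by (simp add: dim_profile_def D_def sum_distrib_right sum_divide_distrib sum_subtractf right_diff_distrib)
    also have "\<dots> \<le> dim_profile n \<delta> \<kappa> a ?t A"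
      unfolding dim_profile_def
    proof (intro sum_mono mult_left_mono)
      fix k assume "k \<in> {..<n}"
      hence k: "k < n" by simp
      show "0 \<le> \<delta> k" using \<delta>[OF k] by simp
      have "(1 - \<kappa>) * clip (a k) (?t k) A \<le> (1 - \<kappa>) * (clip (a k) (t k) A + \<epsilon>)"
        using \<kappa> \<epsilon> by (intro mult_left_mono) (auto simp: clip_def)
      also have "\<dots> \<le> (1 - \<kappa>) * clip (a k) (t k) A + \<epsilon>"
        using \<kappa> \<epsilon> by (simp add: algebra_simps)
      finally have "(1 - \<kappa>) * clip (a k) (?t k) A / A \<le> (1 - \<kappa>) * clip (a k) (t k) A / A + \<epsilon> / A"
        using A_pos by (simp add: divide_right_mono flip: add_divide_distrib)
      also have "\<epsilon> / A \<le> \<epsilon> / b" using \<epsilon> b bA by (intro divide_left_mono) auto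
      finally show "1 - (1 - \<kappa>) * clip (a k) (t k) A / A - \<epsilon> / b \<le> 1 - (1 - \<kappa>) * clip (a k) (?t k) A / A"
        by simp
    qed
    finally have "dim_profile n \<delta> \<kappa> a t A - D * (\<epsilon> / b) \<le> dim_profile n \<delta> \<kappa> a ?t A" .
    moreover have eq: "D * (\<epsilon> / b) = (dim_number n \<delta> \<kappa> a t - \<sigma>) / 2" using D b by (simp add: \<epsilon>_def)
    ultimately have "dim_profile n \<delta> \<kappa> a t A - (dim_number n \<delta> \<kappa> a t - \<sigma>) / 2 \<le> dim_profile n \<delta> \<kappa> a ?t A"
      by (simp only: eq)
    thus ?thesis using assms dim_number_le_profile[OF A_pos] by (simp add: field_simps)
  qed
  moreover have "finite (breakpoints n a ?t)" "breakpoints n a ?t \<noteq> {}"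
    using ne by (auto simp: breakpoints_def)
  ultimately have "\<sigma> < dim_number n \<delta> \<kappa> a ?t"
    using dim_number_eq_Min_profile[of n a ?t \<delta> \<kappa>, OF a t'] by simp
  with \<epsilon> that show ?thesis by blast
qed

text \<open>Write \<open>r = \<rho> powr A\<close>. As \<open>\<rho> < 1\<close>, powers reverse
  order, so \<open>max\<close> and \<open>min\<close> of radii become \<open>min\<close> and
  \<open>max\<close> of exponents, that is \<open>clip\<close>. The product is then
  \<open>\<rho> powr (A * dim_profile n \<delta> \<kappa> a t A)\<close>.\<close>

lemma profile_product_le:
  fixes \<rho> r :: real
  assumes \<rho>: "0 < \<rho>" "\<rho> < 1" and r: "0 < r" "r < 1"
  shows "(\<Prod>i<n. r powr \<delta> i * (\<rho> powr a i / max (\<rho> powr (a i + t i)) (min r (\<rho> powr a i))) powr (\<delta> i * (1 - \<kappa>)))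
     \<le> r powr dim_number n \<delta> \<kappa> a t"
proof -
  define A where "A = ln r / ln \<rho>"
  have A: "0 < A" using \<rho> r by (simp add: A_def divide_neg_neg)
  have r_eq: "r = \<rho> powr A" using \<rho> r by (simp add: A_def powr_def)
  have anti: "\<rho> powr y \<le> \<rho> powr x" if "x \<le> y" for x y using \<rho> that by (intro powr_mono') auto
  hence antimono: "antimono (\<lambda>x. \<rho> powr x)" by (intro antimonoI)
  have fac: "\<rho> powr a i / max (\<rho> powr (a i + t i)) (min r (\<rho> powr a i)) = \<rho> powr (- clip (a i) (t i) A)"
    if i: "i < n" for i
  proof -
    have "min r (\<rho> powr a i) = \<rho> powr (max A (a i))"
      unfolding r_eq by (rule min_of_antimono[OF antimono])
    moreover have "max (\<rho> powr (a i + t i)) (\<rho> powr (max A (a i))) = \<rho> powr (min (a i + t i) (max A (a i)))"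
      by (rule max_of_antimono[OF antimono])
    moreover have "min (a i + t i) (max A (a i)) = a i + clip (a i) (t i) A" using t[OF i] by (auto simp: clip_def)
    ultimately show ?thesis using \<rho> by (simp add: powr_minus powr_add field_simps)
  qed
  have "(\<Prod>i<n. r powr \<delta> i * (\<rho> powr a i / max (\<rho> powr (a i + t i)) (min r (\<rho> powr a i))) powr (\<delta> i * (1 - \<kappa>)))
      = (\<Prod>i<n. \<rho> powr (A * (\<delta> i * (1 - (1 - \<kappa>) * clip (a i) (t i) A / A))))"
  proof (intro prod.cong refl)
    fix i assume "i \<in> {..<n}"
    hence i: "i < n" by simp
    show "r powr \<delta> i * (\<rho> powr a i / max (\<rho> powr (a i + t i)) (min r (\<rho> powr a i))) powr (\<delta> i * (1 - \<kappa>))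
       = \<rho> powr (A * (\<delta> i * (1 - (1 - \<kappa>) * clip (a i) (t i) A / A)))"
    proof -
      have "A * (\<delta> i * (1 - (1 - \<kappa>) * clip (a i) (t i) A / A)) = A * \<delta> i + (- clip (a i) (t i) A) * (\<delta> i * (1 - \<kappa>))"
        using A by (simp add: field_simps)
      thus ?thesis unfolding fac[OF i] unfolding r_eq by (simp only: powr_powr powr_add)
    qed
  qed
  also have "\<dots> = \<rho> powr (\<Sum>i<n. A * (\<delta> i * (1 - (1 - \<kappa>) * clip (a i) (t i) A / A)))"
    using \<rho> by (simp add: powr_sum)
  also have "\<dots> = \<rho> powr (A * dim_profile n \<delta> \<kappa> a t A)" by (simp add: dim_profile_def sum_distrib_left)
  also have "\<dots> \<le> \<rho> powr (A * dim_number n \<delta> \<kappa> a t)"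
    using A by (intro anti mult_left_mono dim_number_le_profile) auto
  also have "\<dots> = r powr dim_number n \<delta> \<kappa> a t" by (simp add: r_eq powr_powr)
  finally show ?thesis .
qed

end

section \<open>Limsup sets of rectangles\<close>

context scaling_product
begin

lemma measure_mball_product:
  assumes x: "x \<in> PX" and r: "0 < r" "r \<le> r0"
  shows "cl ^ d * r powr (\<Sum>i<d. \<delta> i) \<le> measure PM (P.mball x r)"
    and "measure PM (P.mball x r) \<le> cu ^ d * r powr (\<Sum>i<d. \<delta> i)"
proof -
  have xi: "x i \<in> Xs i" if "i < d" for i using x that by auto
  have eq: "measure PM (P.mball x r) = (\<Prod>i<d. measure (m i) (mb i (x i) r))"
    unfolding mball_product[OF x] by (intro measure_box mb_sets)
  have prod: "(\<Prod>i<d. k * r powr \<delta> i) = k ^ d * r powr (\<Sum>i<d. \<delta> i)" for k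
    using r by (simp add: prod.distrib powr_sum)
  show "cl ^ d * r powr (\<Sum>i<d. \<delta> i) \<le> measure PM (P.mball x r)"
    unfolding eq prod[symmetric] using xi r cl_pos by (intro prod_mono) (auto intro!: ahlfors_lower)
  show "measure PM (P.mball x r) \<le> cu ^ d * r powr (\<Sum>i<d. \<delta> i)"
    unfolding eq prod[symmetric] using xi r by (intro prod_mono) (auto intro!: ahlfors_upper)
qed

lemma ahlfors_product: "ahlfors_metric_space PX PD PM (\<Sum>i<d. \<delta> i) (cl ^ d) (cu ^ d) r0"
proof (intro ahlfors_metric_space.intro metric_product ahlfors_metric_space_axioms.intro)
  show "finite_measure PM" using measure_box(2)[of "\<lambda>_. {}"] by (simp add: prob_space_def)
  show "space PM = PX" by (rule space_PM)
  show "0 < (\<Sum>i<d. \<delta> i)" using \<delta>_pos d_pos by (intro sum_pos) (auto simp: lessThan_empty_iff)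
qed (use cl_pos cu_pos r0_pos measure_mball_product sets_mball_product in auto)

text \<open>The union may be infinite, so its closure is not simply the union of closures.
  Approximating a limit point within the smallest \<open>e i\<close> is uniform in \<alpha>, and
  doubling the radii absorbs the error.\<close>

lemma closure_of_box_union:
  assumes F: "F \<subseteq> (\<Union>\<alpha>\<in>A. PiE {..<d} (\<lambda>i. nb i (R \<alpha> i) (e i)))" and A: "A \<subseteq> J"
    and e: "\<And>i. i < d \<Longrightarrow> 0 < e i"
  shows "P.mtopology closure_of F \<subseteq> (\<Union>\<alpha>\<in>A. PiE {..<d} (\<lambda>i. nb i (R \<alpha> i) (2 * e i)))"
proof
  fix y assume y: "y \<in> P.mtopology closure_of F"
  define b where "b = Min (e ` {..<d})"
  have ne: "{..<d} \<noteq> {}" using d_pos by (auto simp: lessThan_empty_iff)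
  have b: "0 < b" "\<And>i. i < d \<Longrightarrow> b \<le> e i" using e ne by (auto simp: b_def)
  obtain x where x: "x \<in> F" "x \<in> P.mball y b" and yP: "y \<in> PX"
    using y b(1) unfolding P.metric_closure_of by blast
  obtain \<alpha> where \<alpha>: "\<alpha> \<in> A" "x \<in> PiE {..<d} (\<lambda>i. nb i (R \<alpha> i) (e i))" using F x(1) by blast
  have "y \<in> PiE {..<d} (\<lambda>i. nb i (R \<alpha> i) (2 * e i))"
    unfolding PiE_iff
  proof (intro conjI ballI)
    show "y \<in> extensional {..<d}" using yP by (simp add: PiE_iff)
    fix i assume "i \<in> {..<d}"
    hence i: "i < d" by simp
    have xi: "x i \<in> nb i (R \<alpha> i) (e i)" using \<alpha>(2) i by (simp add: PiE_iff)
    then obtain w where w: "w \<in> R \<alpha> i" "ds i (x i) w < e i" "x i \<in> Xs i" by (auto simp: nbhd_def)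
    have wX: "w \<in> Xs i" using w(1) R_sub[of \<alpha> i] \<alpha>(1) A i by blast
    have "x i \<in> mb i (y i) b" using x(2) i unfolding mball_product[OF yP] by (simp add: PiE_iff)
    hence yi: "y i \<in> Xs i" "ds i (y i) (x i) < b" using i by (auto simp: in_mb)
    have "ds i (y i) w \<le> ds i (y i) (x i) + ds i (x i) w" using yi w wX i by (intro coord_triangle)
    hence "ds i (y i) w < 2 * e i" using yi(2) w(2) b(2)[OF i] by linarith
    thus "y i \<in> nb i (R \<alpha> i) (2 * e i)" using w(1) yi(1) by (auto simp: nbhd_def)
  qed
  thus "y \<in> (\<Union>\<alpha>\<in>A. PiE {..<d} (\<lambda>i. nb i (R \<alpha> i) (2 * e i)))" using \<alpha>(1) by blast
qed

lemma hausdorff_measure_limsup_rectangles_nonzero: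
  fixes A :: "nat \<Rightarrow> 'j set" and \<rho> :: "nat \<Rightarrow> real" and a t :: "nat \<Rightarrow> real"
  assumes lc: "\<And>i. i < d \<Longrightarrow> locally_compact_space (mtop i)"
    and A: "\<And>k. A k \<subseteq> J" and a: "\<And>i. i < d \<Longrightarrow> 0 < a i" and t: "\<And>i. i < d \<Longrightarrow> 0 < t i"
    and \<rho>: "\<And>k. 0 < \<rho> k" "\<rho> \<longlonglongrightarrow> 0" and c: "0 < c"
    and ubiq: "\<And>x r. x \<in> PX \<Longrightarrow> 0 < r \<Longrightarrow> eventually (\<lambda>k. c * measure PM (P.mball x r)
         \<le> measure PM (P.mball x r \<inter> (\<Union>\<alpha>\<in>A k. PiE {..<d} (\<lambda>i. nb i (R \<alpha> i) (\<rho> k powr a i))))) sequentially"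
    and \<sigma>: "0 < \<sigma>" "\<sigma> < dim_number d \<delta> \<kappa> a t"
  shows "hausdorff_measure PX PD \<sigma>
     {x \<in> PX. infinite {k. x \<in> (\<Union>\<alpha>\<in>A k. PiE {..<d} (\<lambda>i. nb i (R \<alpha> i) (2 * \<rho> k powr (a i + t i))))}} \<noteq> 0"
proof -
  define p where "p k i = \<rho> k powr a i" for k i
  define e where "e k i = \<rho> k powr (a i + t i)" for k i
  define s where "s = dim_number d \<delta> \<kappa> a t"
  define H where "H k = level_weight (p k) (e k)" for k
  \<comment> \<open>\<open>level_set\<close> and \<open>profile_product_le\<close> apply only to
    small scales. At the finitely many other levels the empty set meets the Frostman bound, and the
    lower bound is claimed only eventually.\<close>
  define good where "good k \<longleftrightarrow> \<rho> k < 1 \<and> (\<forall>i<d. 3 * p k i \<le> r0)" for k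
  have pos: "0 < p k i" "0 < e k i" for k i using \<rho>(1)[of k] by (auto simp: p_def e_def)
  have H_pos: "0 < H k" for k
    unfolding H_def level_weight_def using pos by (intro prod_pos) (auto simp: less_imp_neq[THEN not_sym])
  have p_lim: "(\<lambda>k. p k i) \<longlonglongrightarrow> 0" if "i < d" for i
  proof -
    have "(\<lambda>k. \<rho> k powr a i) \<longlonglongrightarrow> 0 powr a i"
      using a[OF that] \<rho> by (intro tendsto_powr' tendsto_const) (auto intro!: always_eventually less_imp_le)
    thus ?thesis by (simp add: p_def)
  qed
  have p_small: "eventually (\<lambda>k. \<forall>i<d. p k i \<le> \<eta>) sequentially" if "0 < \<eta>" for \<eta>
  proof -
    have "eventually (\<lambda>k. \<forall>i\<in>{..<d}. p k i \<le> \<eta>) sequentially"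
    proof (intro eventually_ball_finite ballI)
      fix i assume "i \<in> {..<d}"
      hence "i < d" by simp
      from order_tendstoD(2)[OF p_lim[OF this] that] show "eventually (\<lambda>k. p k i \<le> \<eta>) sequentially"
        by eventually_elim simp
    qed simp
    thus ?thesis by eventually_elim auto
  qed
  have r03: "0 < r0/3" using r0_pos by simp
  have ev_good: "eventually good sequentially"
    using p_small[OF r03] order_tendstoD(2)[OF \<rho>(2) zero_less_one]
    by eventually_elim (auto simp: good_def)
  have dim_ctx: "1 \<le> d" "\<And>k. k < d \<Longrightarrow> 0 < \<delta> k" "\<And>k. k < d \<Longrightarrow> 0 < a k" "\<And>k. k < d \<Longrightarrow> 0 \<le> t k" "0 \<le> \<kappa>" "\<kappa> < 1"
    using d_pos \<delta>_pos a t \<kappa> by (auto intro: less_imp_le)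
  define level where "level k F \<longleftrightarrow> openin P.mtopology F \<and> F \<in> sets PM \<and> F \<subseteq> (\<Union>\<alpha>\<in>A k. PiE {..<d} (\<lambda>i. nb i (R \<alpha> i) (e k i)))
     \<and> (\<forall>x\<in>PX. \<forall>r. 0 < r \<and> r < 1 \<and> 3 * r \<le> r0 \<longrightarrow> H k * measure PM (F \<inter> P.mball x r) \<le> upper_const * r powr s)
     \<and> (good k \<longrightarrow> (\<forall>x\<in>PX. \<forall>r. 0 < r \<and> (\<forall>i<d. 8 * p k i \<le> r) \<longrightarrow>
        measure PM (P.mball x (r/2) \<inter> (\<Union>\<alpha>\<in>A k. PiE {..<d} (\<lambda>i. nb i (R \<alpha> i) (p k i))))
          \<le> lower_const * (H k * measure PM (F \<inter> P.mball x r))))" for k F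
  have "\<exists>F. level k F" for k
  proof (cases "good k")
    case False
    have "0 \<le> upper_const * r powr s" for r using consts_pos(1) by simp
    thus ?thesis using False by (intro exI[of _ "{}"]) (auto simp: level_def)
  next
    case True
    hence \<rho>1: "\<rho> k < 1" and p3: "\<And>i. i < d \<Longrightarrow> 3 * p k i \<le> r0" by (auto simp: good_def)
    have ep: "e k i < p k i" if "i < d" for i
      unfolding e_def p_def using \<rho>(1)[of k] \<rho>1 t[OF that] by (intro powr_less_mono') auto
    obtain F where F: "openin P.mtopology F" "F \<in> sets PM"
       "F \<subseteq> (\<Union>\<alpha>\<in>A k. PiE {..<d} (\<lambda>i. nb i (R \<alpha> i) (e k i)))"
       "\<And>x r. x \<in> PX \<Longrightarrow> 0 < r \<Longrightarrow> 3 * r \<le> r0 \<Longrightarrow> H k * measure PM (F \<inter> P.mball x r)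
       \<le> upper_const * (\<Prod>i<d. r powr \<delta> i * (p k i / max (e k i) (min r (p k i))) powr (\<delta> i * (1 - \<kappa>)))"
       "\<And>x r. x \<in> PX \<Longrightarrow> 0 < r \<Longrightarrow> (\<And>i. i < d \<Longrightarrow> 8 * p k i \<le> r) \<Longrightarrow>
       measure PM (P.mball x (r/2) \<inter> (\<Union>\<alpha>\<in>A k. PiE {..<d} (\<lambda>i. nb i (R \<alpha> i) (p k i))))
       \<le> lower_const * (H k * measure PM (F \<inter> P.mball x r))"
      unfolding H_def by (rule level_set[OF A, of "e k" "p k"]) (use pos ep p3 in auto)
    have "H k * measure PM (F \<inter> P.mball x r) \<le> upper_const * r powr s"
      if x: "x \<in> PX" and r: "0 < r" "r < 1" "3 * r \<le> r0" for x r
    proof -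
      have "(\<Prod>i<d. r powr \<delta> i * (p k i / max (e k i) (min r (p k i))) powr (\<delta> i * (1 - \<kappa>))) \<le> r powr s"
        unfolding p_def e_def s_def by (rule profile_product_le[OF dim_ctx \<rho>(1) \<rho>1 r(1,2)])
      hence "upper_const * (\<Prod>i<d. r powr \<delta> i * (p k i / max (e k i) (min r (p k i))) powr (\<delta> i * (1 - \<kappa>)))
         \<le> upper_const * r powr s" using consts_pos(1) by (intro mult_left_mono) auto
      thus ?thesis using F(4)[OF x r(1,3)] by linarith
    qed
    thus ?thesis using F(1-3,5) unfolding level_def
      by (intro exI[of _ F] conjI ballI allI impI) (assumption | simp)+
  qed
  then obtain F where level: "\<And>k. level k (F k)" by metis
  note lv = level[unfolded level_def]
  have F: "openin P.mtopology (F k)" "F k \<in> sets PM"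
     "F k \<subseteq> (\<Union>\<alpha>\<in>A k. PiE {..<d} (\<lambda>i. nb i (R \<alpha> i) (e k i)))" for k
    by (rule lv[THEN conjunct1] lv[THEN conjunct2, THEN conjunct1] lv[THEN conjunct2, THEN conjunct2, THEN conjunct1])+
  have F_up: "H k * measure PM (F k \<inter> P.mball x r) \<le> upper_const * r powr s"
    if "x \<in> PX" "0 < r" "r < 1" "3 * r \<le> r0" for k x r
    using lv[THEN conjunct2, THEN conjunct2, THEN conjunct2, THEN conjunct1, rule_format, of x r k] that by blast
  have F_low: "measure PM (P.mball x (r/2) \<inter> (\<Union>\<alpha>\<in>A k. PiE {..<d} (\<lambda>i. nb i (R \<alpha> i) (p k i))))
      \<le> lower_const * (H k * measure PM (F k \<inter> P.mball x r))"
    if "good k" "x \<in> PX" "0 < r" "\<forall>i<d. 8 * p k i \<le> r" for k x r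
    using lv[THEN conjunct2, THEN conjunct2, THEN conjunct2, THEN conjunct2, rule_format, OF that(1,2), of r] that(3,4) by blast
  define Q where "Q = (\<Sum>i<d. \<delta> i)"
  define r1 where "r1 = min (1/2) (r0/3)"
  have r1: "0 < r1" "r1 < 1" "3 * r1 \<le> r0" using r0_pos by (auto simp: r1_def)
  \<comment> \<open>Ubiquity is used on the ball of half the radius; \<open>cl ^ d\<close>,
    \<open>cu ^ d\<close> and \<open>2 powr Q\<close> compare the two balls, and
    \<open>lower_const\<close> comes from \<open>level_set\<close>.\<close>
  define c0 where "c0 = c * cl ^ d / (lower_const * cu ^ d * 2 powr Q)"
  have c0: "0 < c0" using c cl_pos cu_pos consts_pos(2) by (simp add: c0_def)
  have "frostman_sequence PX PD PM Q (cl ^ d) (cu ^ d) r0 F H s r1 c0 upper_const"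
  proof (intro frostman_sequence.intro frostman_sequence_axioms.intro)
    show "ahlfors_metric_space PX PD PM Q (cl ^ d) (cu ^ d) r0" unfolding Q_def by (rule ahlfors_product)
    show "H n * measure PM (F n \<inter> P.mball x r) \<le> upper_const * r powr s" if "x \<in> PX" "0 < r" "r \<le> r1" for n x r
      using that r1 by (intro F_up) auto
    show "eventually (\<lambda>n. c0 * measure PM (P.mball x r) \<le> H n * measure PM (F n \<inter> P.mball x r)) sequentially"
      if x: "x \<in> PX" and r: "0 < r" "r \<le> r1" for x r
    proof -
      have rr: "r \<le> r0" using r r1 by linarith
      have "0 < r/2" "0 < r/8" using r(1) by auto
      from ubiq[OF x this(1)] p_small[OF this(2)] ev_good show ?thesis
      proof eventually_elim
        case (elim k)
        have "lower_const * (c0 * measure PM (P.mball x r)) \<le> lower_const * (c0 * (cu ^ d * r powr Q))"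
          using consts_pos(2) c0 measure_mball_product(2)[OF x r(1) rr] by (intro mult_left_mono) (auto simp: Q_def)
        also have "\<dots> = c * (cl ^ d * (r/2) powr Q)"
          using consts_pos(2) cu_pos r by (simp add: c0_def powr_divide)
        also have "\<dots> \<le> c * measure PM (P.mball x (r/2))"
          using c r rr measure_mball_product(1)[OF x, of "r/2"] by (intro mult_left_mono) (auto simp: Q_def)
        also have "\<dots> \<le> measure PM (P.mball x (r/2) \<inter> (\<Union>\<alpha>\<in>A k. PiE {..<d} (\<lambda>i. nb i (R \<alpha> i) (p k i))))"
          using elim(1) by (simp add: p_def)
        also have "\<dots> \<le> lower_const * (H k * measure PM (F k \<inter> P.mball x r))"
          using elim(2,3) x r by (intro F_low) auto
        finally show ?case using consts_pos(2) by simp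
      qed
    qed
  qed (use F H_pos r1 c0 consts_pos in auto)
  then interpret frostman_sequence PX PD PM Q "cl ^ d" "cu ^ d" r0 F H s r1 c0 upper_const .
  obtain x0 t0 where x0: "x0 \<in> PX" "0 < t0" "compactin P.mtopology (P.mtopology closure_of (P.mball x0 t0))"
    using exists_precompact_ball[OF lc] by blast
  have "P.mtopology closure_of (F k) \<subseteq> (\<Union>\<alpha>\<in>A k. PiE {..<d} (\<lambda>i. nb i (R \<alpha> i) (2 * e k i)))" for k
    using pos by (intro closure_of_box_union F(3) A)
  moreover have "s \<le> Q" unfolding s_def Q_def by (rule dim_number_le_sum[OF dim_ctx])
  ultimately show ?thesis
    using \<sigma> x0 unfolding e_def by (intro hausdorff_measure_limsup_nonzero[of \<sigma> _ x0 t0]) (auto simp: s_def)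
qed

end

section \<open>From measures to dimension, and from accumulation points to subsequences\<close>

lemma hausdorff_measure_mono:
  assumes "E \<subseteq> E'"
  shows "hausdorff_measure M D s E \<le> hausdorff_measure M D s E'"
  unfolding hausdorff_measure_def hausdorff_content_def
  using assms by (intro SUP_subset_mono INF_superset_mono) auto

lemma hausdorff_dim_geI:
  assumes "\<And>\<sigma>. 0 < \<sigma> \<Longrightarrow> \<sigma> < s \<Longrightarrow> hausdorff_measure M D \<sigma> E \<noteq> 0"
  shows "ereal s \<le> hausdorff_dim M D E"
  unfolding hausdorff_dim_def using assms by (intro Inf_greatest) (auto simp: not_less[symmetric])

lemma acc_points_subsequence:
  assumes "t \<in> acc_points d v"
  obtains n :: "nat \<Rightarrow> nat" where "filterlim n at_top sequentially" "\<And>i. i < d \<Longrightarrow> (\<lambda>k. v (n k) i) \<longlonglongrightarrow> t i"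
proof -
  have "\<exists>m\<ge>k. \<forall>i<d. \<bar>v m i - t i\<bar> < inverse (real (Suc k))" for k :: nat
    using assms by (simp add: acc_points_def)
  then obtain n where n: "\<And>k. n k \<ge> k" "\<And>k i. i < d \<Longrightarrow> \<bar>v (n k) i - t i\<bar> < inverse (real (Suc k))" by metis
  have "filterlim n at_top sequentially"
    by (rule filterlim_at_top_mono[OF filterlim_ident]) (use n(1) in auto)
  moreover have "(\<lambda>k. v (n k) i) \<longlonglongrightarrow> t i" if "i < d" for i
  proof (rule LIM_zero_cancel, rule Lim_null_comparison)
    show "eventually (\<lambda>k. norm (v (n k) i - t i) \<le> inverse (real (Suc k))) sequentially"
      using n(2)[OF that] by (auto intro!: always_eventually less_imp_le)
  qed (rule LIMSEQ_inverse_real_of_nat)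
  ultimately show ?thesis by (rule that)
qed

lemma filterlim_last_index:
  fixes u :: "nat \<Rightarrow> real"
  assumes u: "mono u" "filterlim u at_top sequentially"
  obtains lev :: "real \<Rightarrow> nat" where "filterlim lev at_top at_top"
    "\<And>x. u 0 \<le> x \<Longrightarrow> u (lev x) \<le> x \<and> x < u (Suc (lev x))"
proof -
  \<comment> \<open>The inserted 0 is a default for arguments below \<open>u 0\<close>, where the
    set is empty.\<close>
  define lev where "lev x = Max (insert 0 {m. u m \<le> x})" for x
  have fin: "finite {m. u m \<le> x}" for x
  proof -
    obtain N where "\<And>m. m \<ge> N \<Longrightarrow> x < u m"
      using u(2) unfolding filterlim_at_top_dense eventually_sequentially by blast
    hence "{m. u m \<le> x} \<subseteq> {..<N}" by (force simp: not_less[symmetric])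
    thus ?thesis by (rule finite_subset) simp
  qed
  have ge: "m \<le> lev x" if "u m \<le> x" for m x
    unfolding lev_def using fin that by (intro Max_ge) auto
  have "u (lev x) \<le> x \<and> x < u (Suc (lev x))" if "u 0 \<le> x" for x
  proof
    have "lev x \<in> insert 0 {m. u m \<le> x}" unfolding lev_def using fin by (intro Max_in) auto
    thus "u (lev x) \<le> x" using that by auto
    show "x < u (Suc (lev x))" using ge[of "Suc (lev x)" x] by force
  qed
  moreover have "filterlim lev at_top at_top"
    unfolding filterlim_at_top
  proof
    fix m
    show "eventually (\<lambda>x. m \<le> lev x) at_top"
      using eventually_ge_at_top[of "u m"] by eventually_elim (rule ge)
  qed
  ultimately show ?thesis using that by blast
qed

context scaling_product
begin

text \<open>Each \<alpha> in window \<open>n k\<close> satisfies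
  \<open>\<beta> \<alpha> \<le> u (n k) \<le> y k\<close>, so the radii formed with
  \<open>\<rho> (u (n k))\<close> and \<open>\<Psi> i (y k)\<close> are at most those in the limsup
  set. Hence \<open>y\<close> may be any sequence above \<open>u (n k)\<close> with the right
  logarithmic quotients.\<close>

lemma hausdorff_dim_limsup_ge:
  fixes \<beta> :: "'j \<Rightarrow> real" and l u :: "nat \<Rightarrow> real" and \<rho> :: "real \<Rightarrow> real" and \<Psi> :: "nat \<Rightarrow> real \<Rightarrow> real"
    and a t :: "nat \<Rightarrow> real" and n :: "nat \<Rightarrow> nat" and y :: "nat \<Rightarrow> real"
  assumes lc: "\<And>i. i < d \<Longrightarrow> locally_compact_space (mtop i)"
    and a: "\<And>i. i < d \<Longrightarrow> 0 < a i" and t: "\<And>i. i < d \<Longrightarrow> 0 \<le> t i"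
    and \<beta>_pos: "\<And>\<alpha>. \<alpha> \<in> J \<Longrightarrow> 0 < \<beta> \<alpha>"
    and l_le_u: "\<And>n. l n \<le> u n" and l_lim: "filterlim l at_top sequentially"
    and \<rho>_pos: "\<And>x. 0 < x \<Longrightarrow> 0 < \<rho> x" and \<rho>_noninc: "\<And>x y. 0 < x \<Longrightarrow> x \<le> y \<Longrightarrow> \<rho> y \<le> \<rho> x"
    and \<rho>_lim: "(\<rho> \<longlongrightarrow> 0) at_top"
    and \<Psi>_pos: "\<And>i x. i < d \<Longrightarrow> 0 < x \<Longrightarrow> 0 < \<Psi> i x"
    and \<Psi>_noninc: "\<And>i x y. i < d \<Longrightarrow> 0 < x \<Longrightarrow> x \<le> y \<Longrightarrow> \<Psi> i y \<le> \<Psi> i x"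
    and ubiquity: "\<exists>c>0. \<forall>x\<in>PX. \<forall>r>0. \<exists>n0. \<forall>n\<ge>n0.
          measure PM (PiE {..<d} (\<lambda>i. mb i (x i) r) \<inter>
             (\<Union>\<alpha>\<in>{\<alpha>\<in>J. l n \<le> \<beta> \<alpha> \<and> \<beta> \<alpha> \<le> u n}. PiE {..<d} (\<lambda>i. nb i (R \<alpha> i) (\<rho> (u n) powr a i))))
          \<ge> c * measure PM (PiE {..<d} (\<lambda>i. mb i (x i) r))"
    and n_lim: "filterlim n at_top sequentially"
    and u_le_y: "eventually (\<lambda>k. u (n k) \<le> y k) sequentially"
    and v_lim: "\<And>i. i < d \<Longrightarrow> (\<lambda>k. ln (\<Psi> i (y k)) / ln (\<rho> (u (n k)))) \<longlonglongrightarrow> t i"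
  shows "ereal (dim_number d \<delta> \<kappa> a t) \<le> hausdorff_dim PX PD
     {x \<in> PX. infinite {\<alpha>\<in>J. \<forall>i<d. x i \<in> nb i (R \<alpha> i) (\<rho> (\<beta> \<alpha>) powr a i * \<Psi> i (\<beta> \<alpha>))}}"
    (is "_ \<le> hausdorff_dim PX PD ?W")
proof (rule hausdorff_dim_geI)
  fix \<sigma> assume \<sigma>: "0 < \<sigma>" "\<sigma> < dim_number d \<delta> \<kappa> a t"
  obtain \<epsilon> where \<epsilon>: "0 < \<epsilon>" "\<sigma> < dim_number d \<delta> \<kappa> a (\<lambda>i. t i + \<epsilon>)"
    using dim_number_perturb[of d \<delta> a t \<kappa> \<sigma>, OF d_pos \<delta>_pos a t \<kappa> \<sigma>(2)] by blast
  obtain c where c: "0 < c" and ub: "\<And>x r. x \<in> PX \<Longrightarrow> 0 < r \<Longrightarrow> \<exists>n0. \<forall>n\<ge>n0.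
          measure PM (PiE {..<d} (\<lambda>i. mb i (x i) r) \<inter>
             (\<Union>\<alpha>\<in>{\<alpha>\<in>J. l n \<le> \<beta> \<alpha> \<and> \<beta> \<alpha> \<le> u n}. PiE {..<d} (\<lambda>i. nb i (R \<alpha> i) (\<rho> (u n) powr a i))))
          \<ge> c * measure PM (PiE {..<d} (\<lambda>i. mb i (x i) r))"
    using ubiquity by blast
  define A where "A k = {\<alpha>\<in>J. l (n k) \<le> \<beta> \<alpha> \<and> \<beta> \<alpha> \<le> u (n k)}" for k
  \<comment> \<open>Positivity of \<open>\<rho>\<close> is known only at positive arguments; the
    default 1 covers the finitely many other \<open>k\<close>.\<close>
  define \<rho>' where "\<rho>' k = (if 0 < u (n k) then \<rho> (u (n k)) else 1)" for k
  have ln_lim: "filterlim (\<lambda>k. l (n k)) at_top sequentially" by (rule filterlim_compose[OF l_lim n_lim])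
  have un_lim: "filterlim (\<lambda>k. u (n k)) at_top sequentially"
    by (rule filterlim_at_top_mono[OF ln_lim]) (simp add: l_le_u)
  have u_pos: "eventually (\<lambda>k. 0 < u (n k)) sequentially"
    using un_lim by (simp add: filterlim_at_top_dense)
  hence \<rho>'_eq: "eventually (\<lambda>k. \<rho>' k = \<rho> (u (n k))) sequentially" by eventually_elim (simp add: \<rho>'_def)
  have \<rho>'_pos: "0 < \<rho>' k" for k by (simp add: \<rho>'_def \<rho>_pos)
  have \<rho>'_lim: "\<rho>' \<longlonglongrightarrow> 0"
    using filterlim_compose[OF \<rho>_lim un_lim] by (rule Lim_transform_eventually) (use \<rho>'_eq in \<open>eventually_elim, simp\<close>)
  define E where "E = {x \<in> PX. infinite {k. x \<in> (\<Union>\<alpha>\<in>A k. PiE {..<d} (\<lambda>i. nb i (R \<alpha> i) (2 * \<rho>' k powr (a i + (t i + \<epsilon>)))))}}"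
  have "hausdorff_measure PX PD \<sigma> E \<noteq> 0"
    unfolding E_def
  proof (rule hausdorff_measure_limsup_rectangles_nonzero[OF lc _ a _ \<rho>'_pos \<rho>'_lim c _ \<sigma>(1) \<epsilon>(2)])
    show "A k \<subseteq> J" for k by (auto simp: A_def)
    show "0 < t i + \<epsilon>" if "i < d" for i using t[OF that] \<epsilon>(1) by simp
    fix x and r :: real assume x: "x \<in> PX" and r: "0 < r"
    obtain n0 where n0: "\<And>n. n \<ge> n0 \<Longrightarrow> c * measure PM (PiE {..<d} (\<lambda>i. mb i (x i) r)) \<le>
          measure PM (PiE {..<d} (\<lambda>i. mb i (x i) r) \<inter>
             (\<Union>\<alpha>\<in>{\<alpha>\<in>J. l n \<le> \<beta> \<alpha> \<and> \<beta> \<alpha> \<le> u n}. PiE {..<d} (\<lambda>i. nb i (R \<alpha> i) (\<rho> (u n) powr a i))))"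
      using ub[OF x r] by blast
    have "eventually (\<lambda>k. n0 \<le> n k) sequentially" using n_lim by (simp add: filterlim_at_top)
    thus "eventually (\<lambda>k. c * measure PM (P.mball x r) \<le> measure PM (P.mball x r \<inter>
        (\<Union>\<alpha>\<in>A k. PiE {..<d} (\<lambda>i. nb i (R \<alpha> i) (\<rho>' k powr a i))))) sequentially"
      using \<rho>'_eq
    proof eventually_elim
      case (elim k)
      show ?case unfolding mball_product[OF x] A_def elim(2) by (rule n0[OF elim(1)])
    qed
  qed
  moreover have "E \<subseteq> ?W"
  proof
    fix x assume "x \<in> E"
    hence x: "x \<in> PX" and inf: "infinite {k. x \<in> (\<Union>\<alpha>\<in>A k. PiE {..<d} (\<lambda>i. nb i (R \<alpha> i) (2 * \<rho>' k powr (a i + (t i + \<epsilon>)))))}"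
      by (auto simp: E_def)
    define S where "S = {\<alpha>\<in>J. \<forall>i<d. x i \<in> nb i (R \<alpha> i) (\<rho> (\<beta> \<alpha>) powr a i * \<Psi> i (\<beta> \<alpha>))}"
    \<comment> \<open>One half of \<open>\<epsilon>\<close> covers the deviation of the quotient
      from \<open>t i\<close>, the other half absorbs the factor 2 from taking closures.\<close>
    have rad: "eventually (\<lambda>k. 2 * \<rho>' k powr (a i + (t i + \<epsilon>)) \<le> \<rho> (u (n k)) powr a i * \<Psi> i (y k)) sequentially"
      if i: "i < d" for i
    proof -
      have "(\<lambda>k. \<rho>' k powr (\<epsilon>/2)) \<longlonglongrightarrow> 0 powr (\<epsilon>/2)"
        using \<epsilon>(1) \<rho>'_pos \<rho>'_lim by (intro tendsto_powr' tendsto_const) (auto intro!: always_eventually less_imp_le)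
      hence "(\<lambda>k. \<rho>' k powr (\<epsilon>/2)) \<longlonglongrightarrow> 0" by simp
      hence e1: "eventually (\<lambda>k. \<rho>' k powr (\<epsilon>/2) < 1/2) sequentially" by (rule order_tendstoD) simp
      have e2: "eventually (\<lambda>k. ln (\<Psi> i (y k)) / ln (\<rho> (u (n k))) < t i + \<epsilon>/2) sequentially"
        using v_lim[OF i] \<epsilon>(1) by (intro order_tendstoD(2)) auto
      have e3: "eventually (\<lambda>k. \<rho>' k < 1) sequentially" by (rule order_tendstoD(2)[OF \<rho>'_lim]) simp
      from e1 e2 e3 u_le_y u_pos \<rho>'_eq show ?thesis
      proof eventually_elim
        case (elim k)
        have y: "0 < y k" using elim by linarith
        have "ln (\<rho>' k) < 0" using elim(3) \<rho>'_pos[of k] by simp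
        hence "(t i + \<epsilon>/2) * ln (\<rho>' k) < ln (\<Psi> i (y k))" using elim(2,6) by (simp add: neg_divide_less_eq)
        hence "exp ((t i + \<epsilon>/2) * ln (\<rho>' k)) < exp (ln (\<Psi> i (y k)))" by simp
        hence \<Psi>: "\<rho>' k powr (t i + \<epsilon>/2) < \<Psi> i (y k)"
          using \<rho>'_pos[of k] \<Psi>_pos[OF i y] by (simp add: powr_def)
        have "2 * \<rho>' k powr (a i + (t i + \<epsilon>)) = \<rho>' k powr a i * \<rho>' k powr (t i + \<epsilon>/2) * (2 * \<rho>' k powr (\<epsilon>/2))"
          by (simp add: powr_add[symmetric] add_ac)
        also have "\<dots> \<le> \<rho>' k powr a i * \<rho>' k powr (t i + \<epsilon>/2) * 1"
          using elim(1) by (intro mult_left_mono) auto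
        also have "\<dots> \<le> \<rho>' k powr a i * \<Psi> i (y k)" using \<Psi> by (simp add: mult_left_mono)
        finally show ?case using elim(6) by simp
      qed
    qed
    have "eventually (\<lambda>k. \<forall>i\<in>{..<d}. 2 * \<rho>' k powr (a i + (t i + \<epsilon>)) \<le> \<rho> (u (n k)) powr a i * \<Psi> i (y k)) sequentially"
      using rad by (intro eventually_ball_finite) auto
    hence in_S: "eventually (\<lambda>k. \<forall>\<alpha>\<in>A k. x \<in> PiE {..<d} (\<lambda>i. nb i (R \<alpha> i) (2 * \<rho>' k powr (a i + (t i + \<epsilon>)))) \<longrightarrow> \<alpha> \<in> S) sequentially"
      using u_le_y
    proof eventually_elim
      case (elim k)
      show ?case
      proof (intro ballI impI)
        fix \<alpha> assume \<alpha>: "\<alpha> \<in> A k" and xk: "x \<in> PiE {..<d} (\<lambda>i. nb i (R \<alpha> i) (2 * \<rho>' k powr (a i + (t i + \<epsilon>))))"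
        have \<beta>: "\<alpha> \<in> J" "0 < \<beta> \<alpha>" "\<beta> \<alpha> \<le> u (n k)" using \<alpha> \<beta>_pos by (auto simp: A_def)
        have "x i \<in> nb i (R \<alpha> i) (\<rho> (\<beta> \<alpha>) powr a i * \<Psi> i (\<beta> \<alpha>))" if i: "i < d" for i
        proof -
          have "2 * \<rho>' k powr (a i + (t i + \<epsilon>)) \<le> \<rho> (u (n k)) powr a i * \<Psi> i (y k)" using elim(1) i by simp
          also have "\<dots> \<le> \<rho> (\<beta> \<alpha>) powr a i * \<Psi> i (\<beta> \<alpha>)"
          proof (intro mult_mono powr_mono2)
            show "\<Psi> i (y k) \<le> \<Psi> i (\<beta> \<alpha>)" using i \<beta> elim(2) by (intro \<Psi>_noninc) auto
            have "0 < \<Psi> i (y k)" using i \<beta> elim(2) by (intro \<Psi>_pos) auto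
            thus "0 \<le> \<Psi> i (y k)" by simp
            show "\<rho> (u (n k)) \<le> \<rho> (\<beta> \<alpha>)" using \<beta> by (intro \<rho>_noninc) auto
            show "0 \<le> \<rho> (u (n k))" using \<rho>_pos[of "u (n k)"] \<beta> by simp
          qed (use a[OF i] in auto)
          finally have le: "2 * \<rho>' k powr (a i + (t i + \<epsilon>)) \<le> \<rho> (\<beta> \<alpha>) powr a i * \<Psi> i (\<beta> \<alpha>)" .
          have "x i \<in> nb i (R \<alpha> i) (2 * \<rho>' k powr (a i + (t i + \<epsilon>)))" using xk i by (simp add: PiE_iff)
          then obtain w where "x i \<in> Xs i" "w \<in> R \<alpha> i" "ds i (x i) w < 2 * \<rho>' k powr (a i + (t i + \<epsilon>))"
            by (auto simp: nbhd_def)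
          thus ?thesis using le by (auto simp: nbhd_def intro!: bexI[of _ w])
        qed
        thus "\<alpha> \<in> S" using \<beta>(1) by (simp add: S_def)
      qed
    qed
    \<comment> \<open>Infinitely many windows must yield infinitely many indices: \<beta> would be
      bounded on a finite \<open>S\<close>, while window \<open>k\<close> only has values at least
      \<open>l (n k)\<close>, which tends to infinity.\<close>
    have "infinite S"
    proof
      assume fin: "finite S"
      define b where "b = Max (insert 0 (\<beta> ` S))"
      have b: "\<beta> \<alpha> \<le> b" if "\<alpha> \<in> S" for \<alpha> unfolding b_def using fin that by (intro Max_ge) auto
      have "eventually (\<lambda>k. b < l (n k)) sequentially" using ln_lim by (simp add: filterlim_at_top_dense)
      from eventually_conj[OF this in_S] obtain K where K: "\<And>k. k \<ge> K \<Longrightarrow> b < l (n k)"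
        "\<And>k \<alpha>. k \<ge> K \<Longrightarrow> \<alpha> \<in> A k \<Longrightarrow> x \<in> PiE {..<d} (\<lambda>i. nb i (R \<alpha> i) (2 * \<rho>' k powr (a i + (t i + \<epsilon>)))) \<Longrightarrow> \<alpha> \<in> S"
        unfolding eventually_sequentially by blast
      obtain k where k: "k \<ge> K" "x \<in> (\<Union>\<alpha>\<in>A k. PiE {..<d} (\<lambda>i. nb i (R \<alpha> i) (2 * \<rho>' k powr (a i + (t i + \<epsilon>)))))"
        using inf unfolding infinite_nat_iff_unbounded_le by blast
      then obtain \<alpha> where \<alpha>: "\<alpha> \<in> A k" "\<alpha> \<in> S" using K(2) by blast
      have "b < \<beta> \<alpha>" using K(1)[OF k(1)] \<alpha>(1) by (auto simp: A_def)
      thus False using b[OF \<alpha>(2)] by simp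
    qed
    thus "x \<in> ?W" using x by (simp add: S_def)
  qed
  ultimately show "hausdorff_measure PX PD \<sigma> ?W \<noteq> 0"
    using hausdorff_measure_mono[of E ?W PX PD \<sigma>] by (metis le_zero_eq)
qed

end

theorem mainTheorem3:
  fixes d :: nat
    and Xs :: "nat \<Rightarrow> 'a set" and ds :: "nat \<Rightarrow> 'a \<Rightarrow> 'a \<Rightarrow> real"
    and m :: "nat \<Rightarrow> 'a measure" and \<delta> :: "nat \<Rightarrow> real"
    and J :: "'j set" and \<beta> :: "'j \<Rightarrow> real"
    and l u :: "nat \<Rightarrow> real" and \<rho> :: "real \<Rightarrow> real"
    and R :: "'j \<Rightarrow> nat \<Rightarrow> 'a set" and \<kappa> :: real
    and a :: "nat \<Rightarrow> real" and \<Psi> :: "nat \<Rightarrow> real \<Rightarrow> real"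
  assumes d_pos: "1 \<le> d"
    and metric: "\<And>i. i < d \<Longrightarrow> Metric_space (Xs i) (ds i)"
    and bounded: "\<And>i. i < d \<Longrightarrow> Metric_space.mbounded (Xs i) (ds i) (Xs i)"
    and loc_compact: "\<And>i. i < d \<Longrightarrow>
          locally_compact_space (Metric_space.mtopology (Xs i) (ds i))"
    and prob: "\<And>i. i < d \<Longrightarrow> prob_space (m i)"
    and space_m: "\<And>i. i < d \<Longrightarrow> space (m i) = Xs i"
    and sets_m: "\<And>i. i < d \<Longrightarrow> sets (m i) = metric_borel (Xs i) (ds i)"
    and \<delta>_pos: "\<And>i. i < d \<Longrightarrow> 0 < \<delta> i"
    and ahlfors: "\<And>i. i < d \<Longrightarrow> \<exists>c C r0. 0 < c \<and> 0 < C \<and> 0 < r0 \<and>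
          (\<forall>x\<in>Xs i. \<forall>r. 0 < r \<and> r \<le> r0 \<longrightarrow>
             c * r powr \<delta> i \<le> measure (m i) (Metric_space.mball (Xs i) (ds i) x r) \<and>
             measure (m i) (Metric_space.mball (Xs i) (ds i) x r) \<le> C * r powr \<delta> i)"
    and J_countable: "countable J" and J_infinite: "infinite J"
    and \<beta>_pos: "\<And>\<alpha>. \<alpha> \<in> J \<Longrightarrow> 0 < \<beta> \<alpha>"
    and \<beta>_finite: "\<And>M. M > 1 \<Longrightarrow> finite {\<alpha>\<in>J. \<beta> \<alpha> < M}"
    and l_mono: "mono l" and u_mono: "mono u"
    and l_le_u: "\<And>n. l n \<le> u n"
    and l_lim: "filterlim l at_top sequentially"
    and \<rho>_pos: "\<And>x. 0 < x \<Longrightarrow> 0 < \<rho> x"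
    and \<rho>_noninc: "\<And>x y. 0 < x \<Longrightarrow> x \<le> y \<Longrightarrow> \<rho> y \<le> \<rho> x"
    and \<rho>_lim: "(\<rho> \<longlongrightarrow> 0) at_top"
    and R_sub: "\<And>\<alpha> i. \<alpha> \<in> J \<Longrightarrow> i < d \<Longrightarrow> R \<alpha> i \<subseteq> Xs i"
    and \<kappa>_range: "0 \<le> \<kappa>" "\<kappa> < 1"
    and scaling: "\<exists>c2 c3 r0. 0 < c2 \<and> 0 < c3 \<and> 0 < r0 \<and>
          (\<forall>\<alpha>\<in>J. \<forall>i<d. \<forall>x\<in>R \<alpha> i. \<forall>\<epsilon> r. 0 < \<epsilon> \<and> \<epsilon> < r \<and> r \<le> r0 \<longrightarrow>
             c2 * r powr (\<delta> i * \<kappa>) * \<epsilon> powr (\<delta> i * (1 - \<kappa>))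
               \<le> measure (m i) (Metric_space.mball (Xs i) (ds i) x r \<inter> nbhd (Xs i) (ds i) (R \<alpha> i) \<epsilon>) \<and>
             measure (m i) (Metric_space.mball (Xs i) (ds i) x r \<inter> nbhd (Xs i) (ds i) (R \<alpha> i) \<epsilon>)
               \<le> c3 * r powr (\<delta> i * \<kappa>) * \<epsilon> powr (\<delta> i * (1 - \<kappa>)))"
    and a_pos: "\<And>i. i < d \<Longrightarrow> 0 < a i"
    and ubiquity: "\<exists>c>0. \<forall>x\<in>PiE {..<d} Xs. \<forall>r>0. \<exists>n0. \<forall>n\<ge>n0.
          measure (PiM {..<d} m)
            (PiE {..<d} (\<lambda>i. Metric_space.mball (Xs i) (ds i) (x i) r) \<inter>
             (\<Union>\<alpha>\<in>{\<alpha>\<in>J. l n \<le> \<beta> \<alpha> \<and> \<beta> \<alpha> \<le> u n}.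
                PiE {..<d} (\<lambda>i. nbhd (Xs i) (ds i) (R \<alpha> i) (\<rho> (u n) powr a i))))
          \<ge> c * measure (PiM {..<d} m)
                 (PiE {..<d} (\<lambda>i. Metric_space.mball (Xs i) (ds i) (x i) r))"
    and \<Psi>_pos: "\<And>i x. i < d \<Longrightarrow> 0 < x \<Longrightarrow> 0 < \<Psi> i x"
    and \<Psi>_noninc: "\<And>i x y. i < d \<Longrightarrow> 0 < x \<Longrightarrow> x \<le> y \<Longrightarrow> \<Psi> i y \<le> \<Psi> i x"
  shows
    "((\<forall>t\<in>acc_points d (\<lambda>n i. ln (\<Psi> i (u n)) / ln (\<rho> (u n))). \<forall>i<d. 0 \<le> t i) \<longrightarrow>
        hausdorff_dim (PiE {..<d} Xs) (prod_dist d ds)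
          {x \<in> PiE {..<d} Xs. infinite {\<alpha>\<in>J. \<forall>i<d.
             x i \<in> nbhd (Xs i) (ds i) (R \<alpha> i) (\<rho> (\<beta> \<alpha>) powr a i * \<Psi> i (\<beta> \<alpha>))}}
        \<ge> Sup ((\<lambda>t. ereal (dim_number d \<delta> \<kappa> a t)) `
                 acc_points d (\<lambda>n i. ln (\<Psi> i (u n)) / ln (\<rho> (u n)))))
     \<and>
     ((\<forall>t\<in>acc_points d (\<lambda>n i. ln (\<Psi> i (real n)) / ln (\<rho> (real n))). \<forall>i<d. 0 \<le> t i) \<longrightarrow>
      (\<lambda>n. ln (\<rho> (u (Suc n))) / ln (\<rho> (u n))) \<longlonglongrightarrow> 1 \<longrightarrow>
        hausdorff_dim (PiE {..<d} Xs) (prod_dist d ds)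
          {x \<in> PiE {..<d} Xs. infinite {\<alpha>\<in>J. \<forall>i<d.
             x i \<in> nbhd (Xs i) (ds i) (R \<alpha> i) (\<rho> (\<beta> \<alpha>) powr a i * \<Psi> i (\<beta> \<alpha>))}}
        \<ge> Sup ((\<lambda>t. ereal (dim_number d \<delta> \<kappa> a t)) `
                 acc_points d (\<lambda>n i. ln (\<Psi> i (real n)) / ln (\<rho> (real n)))))"
proof -
  have ne: "{..<d} \<noteq> {}" using d_pos by (auto simp: lessThan_empty_iff)
  obtain c C q where ahl: "\<And>i. i < d \<Longrightarrow> 0 < c i \<and> 0 < C i \<and> 0 < q i \<and>
          (\<forall>x\<in>Xs i. \<forall>r. 0 < r \<and> r \<le> q i \<longrightarrow>
             c i * r powr \<delta> i \<le> measure (m i) (Metric_space.mball (Xs i) (ds i) x r) \<and>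
             measure (m i) (Metric_space.mball (Xs i) (ds i) x r) \<le> C i * r powr \<delta> i)"
    using ahlfors by metis
  obtain c2 c3 q' where sc: "0 < c2" "0 < c3" "0 < q'" and scal: "\<And>\<alpha> i x \<epsilon> r. \<alpha> \<in> J \<Longrightarrow> i < d \<Longrightarrow> x \<in> R \<alpha> i \<Longrightarrow>
      0 < \<epsilon> \<Longrightarrow> \<epsilon> < r \<Longrightarrow> r \<le> q' \<Longrightarrow>
             c2 * r powr (\<delta> i * \<kappa>) * \<epsilon> powr (\<delta> i * (1 - \<kappa>))
               \<le> measure (m i) (Metric_space.mball (Xs i) (ds i) x r \<inter> nbhd (Xs i) (ds i) (R \<alpha> i) \<epsilon>) \<and>
             measure (m i) (Metric_space.mball (Xs i) (ds i) x r \<inter> nbhd (Xs i) (ds i) (R \<alpha> i) \<epsilon>)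
               \<le> c3 * r powr (\<delta> i * \<kappa>) * \<epsilon> powr (\<delta> i * (1 - \<kappa>))"
    using scaling by (elim exE conjE) (rule that; blast)
  \<comment> \<open>Regularity constants may depend on the coordinate; the worst of finitely many
    serve all coordinates.\<close>
  define cl where "cl = Min (c ` {..<d})"
  define cu where "cu = Max (C ` {..<d})"
  define r0 where "r0 = min q' (Min (q ` {..<d}))"
  have pos: "0 < cl" "0 < r0" using ahl sc ne by (auto simp: cl_def r0_def)
  have cu_pos: "0 < cu"
    using ahl[of 0] d_pos by (auto simp: cu_def Max_gr_iff ne intro!: bexI[of _ 0])
  have r0_le: "r0 \<le> q'" "\<And>i. i < d \<Longrightarrow> r0 \<le> q i" by (auto simp: r0_def intro: min.coboundedI2)
  have cl_le: "cl \<le> c i" and cu_ge: "C i \<le> cu" if "i < d" for i using that by (auto simp: cl_def cu_def)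
  have "scaling_product d Xs ds m \<delta> \<kappa> cl cu c2 c3 r0 J R"
  proof (intro scaling_product.intro metric_measure_product.intro scaling_product_axioms.intro)
    fix i x and r :: real assume i: "i < d" and x: "x \<in> Xs i" and r: "0 < r" "r \<le> r0"
    have "cl * r powr \<delta> i \<le> c i * r powr \<delta> i" "C i * r powr \<delta> i \<le> cu * r powr \<delta> i"
      using cl_le[OF i] cu_ge[OF i] by (auto intro!: mult_right_mono)
    moreover have "r \<le> q i" using r r0_le(2)[OF i] by simp
    ultimately show "cl * r powr \<delta> i \<le> measure (m i) (Metric_space.mball (Xs i) (ds i) x r)"
      "measure (m i) (Metric_space.mball (Xs i) (ds i) x r) \<le> cu * r powr \<delta> i"
      using ahl[OF i] x r by (meson order_trans)+
  qed (use assms scal sc pos cu_pos r0_le in auto)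
  then interpret scaling_product d Xs ds m \<delta> \<kappa> cl cu c2 c3 r0 J R .
  have u_lim: "filterlim u at_top sequentially"
    by (rule filterlim_at_top_mono[OF l_lim]) (simp add: l_le_u)
  let ?W = "{x \<in> PX. infinite {\<alpha>\<in>J. \<forall>i<d. x i \<in> nb i (R \<alpha> i) (\<rho> (\<beta> \<alpha>) powr a i * \<Psi> i (\<beta> \<alpha>))}}"
  have main: "ereal (dim_number d \<delta> \<kappa> a t) \<le> hausdorff_dim PX PD ?W"
    if "\<And>i. i < d \<Longrightarrow> 0 \<le> t i" "filterlim n at_top sequentially"
      "eventually (\<lambda>k. u (n k) \<le> y k) sequentially"
      "\<And>i. i < d \<Longrightarrow> (\<lambda>k. ln (\<Psi> i (y k)) / ln (\<rho> (u (n k)))) \<longlonglongrightarrow> t i" for t n y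
    by (rule hausdorff_dim_limsup_ge[OF loc_compact a_pos that(1) \<beta>_pos l_le_u l_lim \<rho>_pos \<rho>_noninc \<rho>_lim
          \<Psi>_pos \<Psi>_noninc ubiquity that(2-4)])
  have first: "ereal (dim_number d \<delta> \<kappa> a t) \<le> hausdorff_dim PX PD ?W"
    if t: "t \<in> acc_points d (\<lambda>n i. ln (\<Psi> i (u n)) / ln (\<rho> (u n)))" "\<And>i. i < d \<Longrightarrow> 0 \<le> t i" for t
  proof -
    obtain n where n: "filterlim n at_top sequentially"
      "\<And>i. i < d \<Longrightarrow> (\<lambda>k. ln (\<Psi> i (u (n k))) / ln (\<rho> (u (n k)))) \<longlonglongrightarrow> t i"
      using acc_points_subsequence[OF t(1)] by blast
    show ?thesis
      by (rule main[OF t(2) n(1) _ n(2)]) auto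
  qed
  have second: "ereal (dim_number d \<delta> \<kappa> a t) \<le> hausdorff_dim PX PD ?W"
    if t: "t \<in> acc_points d (\<lambda>n i. ln (\<Psi> i (real n)) / ln (\<rho> (real n)))" "\<And>i. i < d \<Longrightarrow> 0 \<le> t i"
      and ratio: "(\<lambda>n. ln (\<rho> (u (Suc n))) / ln (\<rho> (u n))) \<longlonglongrightarrow> 1" for t
  proof -
    obtain N where N: "filterlim N at_top sequentially"
      "\<And>i. i < d \<Longrightarrow> (\<lambda>k. ln (\<Psi> i (real (N k))) / ln (\<rho> (real (N k)))) \<longlonglongrightarrow> t i"
      using acc_points_subsequence[OF t(1)] by blast
    obtain lev :: "real \<Rightarrow> nat" where lev: "filterlim lev at_top at_top"
      "\<And>x. u 0 \<le> x \<Longrightarrow> u (lev x) \<le> x \<and> x < u (Suc (lev x))"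
      using filterlim_last_index[OF u_mono u_lim] by blast
    \<comment> \<open>The last window endpoint not exceeding \<open>N k\<close>: it gives
      \<open>u (n k) \<le> y k\<close>, while \<open>u (Suc (n k))\<close> bounds \<open>N k\<close>
      from above.\<close>
    define n where "n k = lev (real (N k))" for k
    have N_real: "filterlim (\<lambda>k. real (N k)) at_top sequentially"
      by (rule filterlim_compose[OF filterlim_real_sequentially N(1)])
    have n_lim: "filterlim n at_top sequentially"
      unfolding n_def by (rule filterlim_compose[OF lev(1) N_real])
    have "eventually (\<lambda>k. u 0 \<le> real (N k)) sequentially" using N_real by (simp add: filterlim_at_top)
    hence between: "eventually (\<lambda>k. u (n k) \<le> real (N k) \<and> real (N k) < u (Suc (n k))) sequentially"
      by eventually_elim (simp add: n_def lev(2))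
    have un_lim: "filterlim (\<lambda>k. u (n k)) at_top sequentially" by (rule filterlim_compose[OF u_lim n_lim])
    have un_pos: "eventually (\<lambda>k. 0 < u (n k)) sequentially"
      using un_lim by (simp add: filterlim_at_top_dense)
    have \<rho>_small: "eventually (\<lambda>k. \<rho> (u (n k)) < 1) sequentially"
      using filterlim_compose[OF \<rho>_lim un_lim] by (rule order_tendstoD) simp
    \<comment> \<open>\<open>\<rho>\<close> is non-increasing and these logarithms are negative, so
      dividing reverses the inequalities. The quotient is squeezed between 1 and the ratio of
      consecutive logarithms.\<close>
    have bounds: "eventually (\<lambda>k. 1 \<le> ln (\<rho> (real (N k))) / ln (\<rho> (u (n k))) \<and>
        ln (\<rho> (real (N k))) / ln (\<rho> (u (n k))) \<le> ln (\<rho> (u (Suc (n k)))) / ln (\<rho> (u (n k))) \<and>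
        ln (\<rho> (real (N k))) \<noteq> 0) sequentially"
      using between un_pos \<rho>_small
    proof eventually_elim
      case (elim k)
      have "\<rho> (u (Suc (n k))) \<le> \<rho> (real (N k))" "\<rho> (real (N k)) \<le> \<rho> (u (n k))"
        "0 < \<rho> (u (Suc (n k)))" "0 < \<rho> (real (N k))" "0 < \<rho> (u (n k))"
        using elim by (auto intro!: \<rho>_noninc \<rho>_pos)
      hence "ln (\<rho> (u (Suc (n k)))) \<le> ln (\<rho> (real (N k)))" "ln (\<rho> (real (N k))) \<le> ln (\<rho> (u (n k)))"
        "ln (\<rho> (u (n k))) < 0" using elim by auto
      thus ?case by (auto simp: le_divide_eq intro!: divide_right_mono_neg)
    qed
    have q_lim: "(\<lambda>k. ln (\<rho> (real (N k))) / ln (\<rho> (u (n k)))) \<longlonglongrightarrow> 1"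
      by (rule tendsto_sandwich[OF _ _ tendsto_const filterlim_compose[OF ratio n_lim]])
         (use bounds in \<open>eventually_elim, simp\<close>)+
    \<comment> \<open>Multiplying the given quotient by the factor tending to 1 exchanges
      \<open>\<rho> (real (N k))\<close> for \<open>\<rho> (u (n k))\<close>; the cancelled
      logarithm is eventually nonzero.\<close>
    have v_lim: "(\<lambda>k. ln (\<Psi> i (real (N k))) / ln (\<rho> (u (n k)))) \<longlonglongrightarrow> t i" if i: "i < d" for i
    proof (rule Lim_transform_eventually)
      show "(\<lambda>k. ln (\<Psi> i (real (N k))) / ln (\<rho> (real (N k))) * (ln (\<rho> (real (N k))) / ln (\<rho> (u (n k))))) \<longlonglongrightarrow> t i"
        using tendsto_mult[OF N(2)[OF i] q_lim] by simp
      show "eventually (\<lambda>k. ln (\<Psi> i (real (N k))) / ln (\<rho> (real (N k))) * (ln (\<rho> (real (N k))) / ln (\<rho> (u (n k))))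
          = ln (\<Psi> i (real (N k))) / ln (\<rho> (u (n k)))) sequentially"
        using bounds by eventually_elim simp
    qed
    have "eventually (\<lambda>k. u (n k) \<le> real (N k)) sequentially"
      using between by eventually_elim simp
    from main[OF t(2) n_lim this v_lim] show ?thesis .
  qed
  show ?thesis
  proof (intro conjI impI Sup_least; elim imageE; hypsubst)
    fix t
    assume "\<forall>t\<in>acc_points d (\<lambda>n i. ln (\<Psi> i (u n)) / ln (\<rho> (u n))). \<forall>i<d. 0 \<le> t i"
      and "t \<in> acc_points d (\<lambda>n i. ln (\<Psi> i (u n)) / ln (\<rho> (u n)))"
    thus "ereal (dim_number d \<delta> \<kappa> a t) \<le> hausdorff_dim PX PD ?W" by (intro first) auto
  next
    fix t
    assume "\<forall>t\<in>acc_points d (\<lambda>n i. ln (\<Psi> i (real n)) / ln (\<rho> (real n))). \<forall>i<d. 0 \<le> t i"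
      and "(\<lambda>n. ln (\<rho> (u (Suc n))) / ln (\<rho> (u n))) \<longlonglongrightarrow> 1"
      and "t \<in> acc_points d (\<lambda>n i. ln (\<Psi> i (real n)) / ln (\<rho> (real n)))"
    thus "ereal (dim_number d \<delta> \<kappa> a t) \<le> hausdorff_dim PX PD ?W" by (intro second) auto
  qed
qed

end
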